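(* Consider the linear stochastic Schr\"odinger equation with additive noise $\mathrm{i}\,\mathrm{d}u-\Delta u\,\mathrm{d}t=\mathrm{d}W$ on $\mathbb{R}^d\times(0,\infty)$, $u(0)=u_0$, where $u_0$ is an $\mathcal{F}_0$-measurable random variable and $W$ is a $Q$-Wiener process. Let $k>0$, $t_n=nk$, and let $u^n$ be the exponential integrator defined by $u^0=u_0$ and $$u^n=S(k)u^{n-1}-\mathrm{i}S(k)\bigl(W(t_n)-W(t_{n-1})\bigr),\qquad n\ge1.$$ Let $p(u)=\mathrm{i}\int_{\mathbb{R}^d}(u\nabla\bar u-\bar u\nabla u)\,\mathrm{d}x$ denote the momentum. Assume that $\mathbb{E}[p(u_0)]<\infty$ and that $Q^{1/2}\in\mathcal{L}_2^1$. Then $$\mathbb{E}[p(u^n)]=\mathbb{E}[p(u_0)]-2t_n\,\mathrm{Im}\,\langle Q^{1/2},\nabla Q^{1/2}\rangle_{\mathcal{L}_2^0}\qquad\text{for all }t_n=nk.$$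
   Context: $d\ge1$ is arbitrary. $L^2=L^2(\mathbb{R}^d)$ is the space of complex-valued square integrable functions, with real inner product $(u,v)=\mathrm{Re}\int_{\mathbb{R}^d}u\bar v\,\mathrm{d}x$; also $\langle u,v\rangle=\int_{\mathbb{R}^d}u\bar v\,\mathrm{d}x$ (the usual complex-valued $L^2$ inner product; for a vector field $v=\nabla w$ it is taken componentwise). $H^1=H^1(\mathbb{R}^d)$ is the Sobolev space of order 1; $\mathcal{L}_2^1$ is the space of Hilbert--Schmidt operators from $L^2$ to $H^1$. $\langle\cdot,\cdot\rangle_{\mathcal{L}_2^0}$ is the Hilbert--Schmidt inner product from $L^2$ to $L^2$ built from $\langle\cdot,\cdot\rangle$: $\langle Q^{1/2},\nabla Q^{1/2}\rangle_{\mathcal{L}_2^0}=\sum_j\langle Q^{1/2}e_j,\nabla Q^{1/2}e_j\rangle$, with $(e_j)$ an orthonormal basis of $L^2$. $S(t)=\mathrm{e}^{-\mathrm{i}t\Delta}$ is the unitary group generated by $-\mathrm{i}\Delta$. $(\Omega,\mathcal{F},\mathbb{P},\{\mathcal{F}_t\}_{t\ge0})$ is a filtered probability space with a normal filtration, and $W$ is a complex-valued (i.e. $L^2$-valued), square integrable $Q$-Wiener process with respect to $\{\mathcal{F}_t\}$, where the covariance operator $Q$ is a nonnegative self-adjoint operator on $L^2$; thus $W(t)=\sum_j\beta_j(t)Q^{1/2}e_j$ with independent standard Brownian motions $\beta_j$.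
   Formalization: E[p(u_0)] finite does not ensure E[p(u^n)] exists (u_0=ξφ real, E|ξ|=∞); the identity is proved for every n for which p(u^n) is integrable, which is shown to hold when E‖u_0‖<∞; u_0 is in H^1 a.s. so that p(u_0) is defined. *)

theory Defs
  imports "HOL-Probability.Probability"
begin

section \<open>The Hilbert space of square integrable complex functions\<close>

definition square_integrable :: "(real^'n \<Rightarrow> complex) \<Rightarrow> bool" where
  "square_integrable f \<longleftrightarrow>
     f \<in> borel_measurable lborel \<and> integrable lborel (\<lambda>x. (cmod (f x))\<^sup>2)"

lemma square_integrable_measurable:
  "square_integrable f \<Longrightarrow> f \<in> borel_measurable borel"
  by (simp add: square_integrable_def)

lemma square_integrable_0: "square_integrable (\<lambda>x. 0)"
  by (simp add: square_integrable_def)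

lemma square_integrable_add:
  assumes "square_integrable f" "square_integrable g"
  shows "square_integrable (\<lambda>x. f x + g x)"
proof -
  have [measurable]: "f \<in> borel_measurable lborel" "g \<in> borel_measurable lborel"
    using assms by (auto simp: square_integrable_def)
  have bnd: "(cmod (a + b))\<^sup>2 \<le> 2 * (cmod a)\<^sup>2 + 2 * (cmod b)\<^sup>2" for a b :: complex
  proof -
    have "(cmod (a + b))\<^sup>2 \<le> (cmod a + cmod b)\<^sup>2"
      by (simp add: norm_triangle_ineq power_mono)
    also have "\<dots> \<le> 2 * (cmod a)\<^sup>2 + 2 * (cmod b)\<^sup>2"
      using zero_le_power2[of "cmod a - cmod b"] by (simp add: power2_eq_square algebra_simps)
    finally show ?thesis .
  qed
  have "integrable lborel (\<lambda>x. 2 * (cmod (f x))\<^sup>2 + 2 * (cmod (g x))\<^sup>2)"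
    using assms by (auto simp: square_integrable_def)
  then have "integrable lborel (\<lambda>x. (cmod (f x + g x))\<^sup>2)"
    by (rule Bochner_Integration.integrable_bound) (use bnd in auto)
  then show ?thesis
    by (simp add: square_integrable_def)
qed

lemma square_integrable_cmult: "square_integrable f \<Longrightarrow> square_integrable (\<lambda>x. c * f x)"
  by (auto simp: square_integrable_def norm_mult power_mult_distrib)

lemma square_integrable_uminus: "square_integrable f \<Longrightarrow> square_integrable (\<lambda>x. - f x)"
  by (auto simp: square_integrable_def)

lemma borel_measurable_cnj [measurable (raw)]:
  "f \<in> borel_measurable M \<Longrightarrow> (\<lambda>x. cnj (f x)) \<in> borel_measurable M"
  by (rule borel_measurable_continuous_on[of cnj]) (auto intro: continuous_intros)

lemma square_integrable_prod:
  assumes "square_integrable f" "square_integrable g"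
  shows "integrable lborel (\<lambda>x. f x * cnj (g x))"
proof -
  have [measurable]: "f \<in> borel_measurable lborel" "g \<in> borel_measurable lborel"
    using assms by (auto simp: square_integrable_def)
  have bnd: "cmod (a * cnj b) \<le> (cmod a)\<^sup>2 + (cmod b)\<^sup>2" for a b :: complex
  proof -
    have "0 \<le> (cmod a - cmod b)\<^sup>2 + (cmod a)\<^sup>2 + (cmod b)\<^sup>2"
      by simp
    then show ?thesis
      by (simp add: norm_mult power2_diff)
  qed
  have "integrable lborel (\<lambda>x. (cmod (f x))\<^sup>2 + (cmod (g x))\<^sup>2)"
    using assms by (auto simp: square_integrable_def)
  then show ?thesis
    by (rule Bochner_Integration.integrable_bound) (use bnd in auto)
qed

definition L2_rel :: "(real^'n \<Rightarrow> complex) \<Rightarrow> (real^'n \<Rightarrow> complex) \<Rightarrow> bool" where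
  "L2_rel f g \<longleftrightarrow> square_integrable f \<and> square_integrable g \<and> (AE x in lborel. f x = g x)"

quotient_type 'n L2 = "(real^'n::finite) \<Rightarrow> complex" / partial: L2_rel
proof (rule part_equivpI)
  show "\<exists>f. L2_rel f f"
    using square_integrable_0 by (auto simp: L2_rel_def)
  show "symp L2_rel"
    by (rule sympI) (auto simp: L2_rel_def)
  show "transp L2_rel"
    by (rule transpI) (auto simp: L2_rel_def elim: AE_mp)
qed

instantiation L2 :: (finite) real_inner
begin

lift_definition zero_L2 :: "'a L2" is "\<lambda>x. 0"
  by (simp add: L2_rel_def square_integrable_0)

lift_definition plus_L2 :: "'a L2 \<Rightarrow> 'a L2 \<Rightarrow> 'a L2" is "\<lambda>f g x. f x + g x"
  by (auto simp: L2_rel_def intro: square_integrable_add)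

lift_definition scaleR_L2 :: "real \<Rightarrow> 'a L2 \<Rightarrow> 'a L2" is "\<lambda>r f x. complex_of_real r * f x"
  by (auto simp: L2_rel_def intro: square_integrable_cmult)

lift_definition uminus_L2 :: "'a L2 \<Rightarrow> 'a L2" is "\<lambda>f x. - f x"
  by (auto simp: L2_rel_def intro: square_integrable_uminus)

definition minus_L2 :: "'a L2 \<Rightarrow> 'a L2 \<Rightarrow> 'a L2" where "minus_L2 u v = u + (- v)"

lift_definition inner_L2 :: "'a L2 \<Rightarrow> 'a L2 \<Rightarrow> real"
  is "\<lambda>f g. Re (\<integral>x. f x * cnj (g x) \<partial>lborel)"
  unfolding L2_rel_def
  by (intro arg_cong[where f = Re] integral_cong_AE)
    (auto dest!: square_integrable_measurable)

definition norm_L2 :: "'a L2 \<Rightarrow> real" where "norm_L2 u = sqrt (inner u u)"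
definition sgn_L2 :: "'a L2 \<Rightarrow> 'a L2" where "sgn_L2 u = inverse (norm u) *\<^sub>R u"
definition dist_L2 :: "'a L2 \<Rightarrow> 'a L2 \<Rightarrow> real" where "dist_L2 u v = norm (u - v)"
definition uniformity_L2 :: "('a L2 \<times> 'a L2) filter"
  where "uniformity_L2 = (INF e\<in>{0<..}. principal {(u, v). dist u v < e})"
definition open_L2 :: "'a L2 set \<Rightarrow> bool"
  where "open_L2 U \<longleftrightarrow> (\<forall>u\<in>U. eventually (\<lambda>(u', v). u' = u \<longrightarrow> v \<in> U) uniformity)"

instance
proof
  have self: "(\<integral>x. f x * cnj (f x) \<partial>lborel) = complex_of_real (\<integral>x. (cmod (f x))\<^sup>2 \<partial>lborel)"
    for f :: "real^'a \<Rightarrow> complex"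
    by (simp only: complex_norm_square[symmetric] integral_complex_of_real)
  fix u v w :: "'a L2" and r s :: real
  show "u + v + w = u + (v + w)"
    by transfer (auto simp: L2_rel_def add.assoc intro!: square_integrable_add)
  show "u + v = v + u"
    by transfer (auto simp: L2_rel_def add.commute intro!: square_integrable_add)
  show "0 + u = u"
    by transfer (auto simp: L2_rel_def)
  show "- u + u = 0"
    by transfer (auto simp: L2_rel_def square_integrable_0)
  show "u - v = u + - v"
    by (simp add: minus_L2_def)
  show "r *\<^sub>R (u + v) = r *\<^sub>R u + r *\<^sub>R v"
    by transfer (auto simp: L2_rel_def distrib_left
        intro!: square_integrable_add square_integrable_cmult)
  show "(r + s) *\<^sub>R u = r *\<^sub>R u + s *\<^sub>R u"
    by transfer (auto simp: L2_rel_def distrib_right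
        intro!: square_integrable_add square_integrable_cmult)
  show "r *\<^sub>R s *\<^sub>R u = (r * s) *\<^sub>R u"
    by transfer (auto simp: L2_rel_def mult.assoc intro!: square_integrable_cmult)
  show "1 *\<^sub>R u = u"
    by transfer (auto simp: L2_rel_def)
  show "sgn u = inverse (norm u) *\<^sub>R u"
    by (simp add: sgn_L2_def)
  show "dist u v = norm (u - v)"
    by (simp add: dist_L2_def)
  show "inner u v = inner v u"
  proof transfer
    fix f g :: "real^'a \<Rightarrow> complex"
    assume "L2_rel f f" "L2_rel g g"
    then have "integrable lborel (\<lambda>x. f x * cnj (g x))"
      by (simp add: L2_rel_def square_integrable_prod)
    then have "(\<integral>x. cnj (f x * cnj (g x)) \<partial>lborel) = cnj (\<integral>x. f x * cnj (g x) \<partial>lborel)"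
      by (rule integral_bounded_linear[OF bounded_linear_cnj])
    then have "(\<integral>x. g x * cnj (f x) \<partial>lborel) = cnj (\<integral>x. f x * cnj (g x) \<partial>lborel)"
      by (simp add: mult.commute)
    then show "Re (\<integral>x. f x * cnj (g x) \<partial>lborel) = Re (\<integral>x. g x * cnj (f x) \<partial>lborel)"
      by simp
  qed
  show "inner (u + v) w = inner u w + inner v w"
    by transfer (simp add: L2_rel_def distrib_right square_integrable_prod)
  show "inner (r *\<^sub>R u) v = r * inner u v"
    by transfer (simp add: mult.assoc)
  show "0 \<le> inner u u"
    by transfer (simp add: self)
  show "inner u u = 0 \<longleftrightarrow> u = 0"
  proof transfer
    fix f :: "real^'a \<Rightarrow> complex"
    assume "L2_rel f f"
    then have f: "square_integrable f" "integrable lborel (\<lambda>x. (cmod (f x))\<^sup>2)"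
      by (auto simp: L2_rel_def square_integrable_def)
    have "Re (\<integral>x. f x * cnj (f x) \<partial>lborel) = 0 \<longleftrightarrow> (\<integral>x. (cmod (f x))\<^sup>2 \<partial>lborel) = 0"
      by (simp add: self)
    also have "\<dots> \<longleftrightarrow> (AE x in lborel. f x = 0)"
      using integral_nonneg_eq_0_iff_AE[OF f(2)] by simp
    also have "\<dots> \<longleftrightarrow> L2_rel f (\<lambda>x. 0)"
      by (simp add: L2_rel_def f square_integrable_0)
    finally show "Re (\<integral>x. f x * cnj (f x) \<partial>lborel) = 0 \<longleftrightarrow> L2_rel f (\<lambda>x. 0)" .
  qed
  show "norm u = sqrt (inner u u)"
    by (simp add: norm_L2_def)
  show "uniformity = (INF e\<in>{0<..}. principal {(u :: 'a L2, v). dist u v < e})"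
    by (rule uniformity_L2_def)
  show "open U \<longleftrightarrow> (\<forall>u\<in>U. eventually (\<lambda>(u', v). u' = u \<longrightarrow> v \<in> U) uniformity)"
    for U :: "'a L2 set"
    by (rule open_L2_def)
qed

end

lift_definition scaleC :: "complex \<Rightarrow> 'n::finite L2 \<Rightarrow> 'n L2" (infixr \<open>*\<^sub>C\<close> 75)
  is "\<lambda>c f x. c * f x"
  by (auto simp: L2_rel_def intro: square_integrable_cmult)

lift_definition cinner :: "'n::finite L2 \<Rightarrow> 'n L2 \<Rightarrow> complex"
  is "\<lambda>f g. \<integral>x. f x * cnj (g x) \<partial>lborel"
  unfolding L2_rel_def
  by (intro integral_cong_AE) (auto dest!: square_integrable_measurable)

text \<open>
  The library inner product on \<open>'n L2\<close> is the real one. It is embedded into the complex numbers,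
  so that the notions below can be instantiated with \<open>rinner\<close> (\<open>L\<^sup>2\<close> as a real Hilbert
  space) or with \<open>cinner\<close> (\<open>L\<^sup>2\<close> as a complex Hilbert space).
\<close>

definition rinner :: "'n::finite L2 \<Rightarrow> 'n L2 \<Rightarrow> complex" where
  "rinner u v = complex_of_real (inner u v)"

definition orthonormal_basis ::
    "('n::finite L2 \<Rightarrow> 'n L2 \<Rightarrow> complex) \<Rightarrow> (nat \<Rightarrow> 'n L2) \<Rightarrow> bool" where
  "orthonormal_basis ip e \<longleftrightarrow>
     (\<forall>i j. ip (e i) (e j) = (if i = j then 1 else 0)) \<and>
     (\<forall>u. (\<forall>j. ip u (e j) = 0) \<longrightarrow> u = 0)"

text \<open>
  An everywhere defined operator that is symmetric with respect to \<open>cinner\<close> is complex linear, so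
  only real linearity has to be required.
\<close>

definition nonneg_selfadjoint ::
    "('n::finite L2 \<Rightarrow> 'n L2 \<Rightarrow> complex) \<Rightarrow> ('n L2 \<Rightarrow> 'n L2) \<Rightarrow> bool" where
  "nonneg_selfadjoint ip A \<longleftrightarrow>
     bounded_linear A \<and> (\<forall>u v. ip (A u) v = ip u (A v)) \<and> (\<forall>u. 0 \<le> Re (ip (A u) u))"

definition is_op_sqrt ::
    "('n::finite L2 \<Rightarrow> 'n L2 \<Rightarrow> complex) \<Rightarrow> ('n L2 \<Rightarrow> 'n L2) \<Rightarrow> ('n L2 \<Rightarrow> 'n L2) \<Rightarrow> bool" where
  "is_op_sqrt ip A R \<longleftrightarrow> nonneg_selfadjoint ip R \<and> (\<forall>u. R (R u) = A u)"


section \<open>Weak derivatives and Sobolev spaces\<close>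

text \<open>
  \<open>smooth f\<close> says that \<open>f\<close> is \<open>C\<^sup>\<infinity>\<close>: the greatest predicate for which \<open>f\<close> is differentiable and
  all its partial derivatives again satisfy the predicate.
\<close>

definition partial_deriv :: "'n::finite \<Rightarrow> (real^'n \<Rightarrow> complex) \<Rightarrow> real^'n \<Rightarrow> complex" where
  "partial_deriv i f x = frechet_derivative f (at x) (axis i 1)"

coinductive smooth :: "(real^'n::finite \<Rightarrow> complex) \<Rightarrow> bool" where
  "(\<forall>x. f differentiable (at x)) \<Longrightarrow> (\<forall>i. smooth (partial_deriv i f)) \<Longrightarrow> smooth f"

lemma smooth_partial_deriv: "smooth f \<Longrightarrow> smooth (partial_deriv i f)"
  by (erule smooth.cases) blast

lemma smooth_measurable:
  assumes "smooth f" shows "f \<in> borel_measurable borel"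
proof -
  have "f differentiable (at x)" for x
    using assms by (rule smooth.cases) blast
  then have "continuous_on UNIV f"
    by (intro differentiable_imp_continuous_on) (simp add: differentiable_on_def)
  then show ?thesis
    by (rule borel_measurable_continuous_onI)
qed

definition test_function :: "(real^'n::finite \<Rightarrow> complex) \<Rightarrow> bool" where
  "test_function \<phi> \<longleftrightarrow> smooth \<phi> \<and> compact (closure {x. \<phi> x \<noteq> 0})"

lift_definition has_weak_partial :: "'n::finite \<Rightarrow> 'n L2 \<Rightarrow> 'n L2 \<Rightarrow> bool"
  is "\<lambda>i f g. \<forall>\<phi>. test_function \<phi> \<longrightarrow>
        (\<integral>x. f x * partial_deriv i \<phi> x \<partial>lborel) = - (\<integral>x. g x * \<phi> x \<partial>lborel)"
  subgoal premises prems for i f f' g g'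
  proof -
    have "(\<integral>x. f x * partial_deriv i \<phi> x \<partial>lborel) = (\<integral>x. f' x * partial_deriv i \<phi> x \<partial>lborel) \<and>
          (\<integral>x. g x * \<phi> x \<partial>lborel) = (\<integral>x. g' x * \<phi> x \<partial>lborel)"
      if \<phi>: "test_function \<phi>" for \<phi>
    proof -
      have [measurable]: "\<phi> \<in> borel_measurable borel" "partial_deriv i \<phi> \<in> borel_measurable borel"
        using \<phi> by (auto simp: test_function_def intro: smooth_measurable smooth_partial_deriv)
      show ?thesis
        using prems
        by (auto simp: L2_rel_def dest!: square_integrable_measurable intro!: integral_cong_AE)
    qed
    then show ?thesis by (intro all_cong1 imp_cong) auto
  qed
  done

definition H1 :: "'n::finite L2 set" where
  "H1 = {u. \<forall>i. \<exists>g. has_weak_partial i u g}"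

definition weak_partial :: "'n::finite \<Rightarrow> 'n L2 \<Rightarrow> 'n L2" where
  "weak_partial i u = (THE g. has_weak_partial i u g)"

definition H1_norm :: "'n::finite L2 \<Rightarrow> real" where
  "H1_norm u = sqrt ((norm u)\<^sup>2 + (\<Sum>i\<in>UNIV. (norm (weak_partial i u))\<^sup>2))"

definition H2 :: "'n::finite L2 set" where
  "H2 = {u \<in> H1. \<forall>i. weak_partial i u \<in> H1}"

definition laplacian :: "'n::finite L2 \<Rightarrow> 'n L2" where
  "laplacian u = (\<Sum>i\<in>UNIV. weak_partial i (weak_partial i u))"

text \<open>
  \<open>momentum_form u v\<close> is \<open>\<integral> (u \<cdot> cnj v - cnj u \<cdot> v) dx\<close>. In the momentum it is applied to
  \<open>v = \<partial>\<^sub>i u\<close>; the weak derivative of \<open>cnj u\<close> is \<open>cnj (\<partial>\<^sub>i u)\<close>. The momentum is a vector with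
  \<open>d\<close> components; they are real, but are kept in the complex numbers as in the defining formula.
\<close>

lift_definition momentum_form :: "'n::finite L2 \<Rightarrow> 'n L2 \<Rightarrow> complex"
  is "\<lambda>f g. \<integral>x. (f x * cnj (g x) - cnj (f x) * g x) \<partial>lborel"
  unfolding L2_rel_def
  by (intro integral_cong_AE) (auto dest!: square_integrable_measurable)

definition momentum :: "'n::finite L2 \<Rightarrow> complex^'n" where
  "momentum u = (\<chi> i. \<i> * momentum_form u (weak_partial i u))"


section \<open>Hilbert--Schmidt operators\<close>

text \<open>
  The Hilbert--Schmidt quantities are computed in a given orthonormal basis \<open>e\<close> of \<open>L\<^sup>2\<close>.
\<close>

definition hilbert_schmidt_H1 :: "(nat \<Rightarrow> 'n::finite L2) \<Rightarrow> ('n L2 \<Rightarrow> 'n L2) \<Rightarrow> bool" where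
  "hilbert_schmidt_H1 e T \<longleftrightarrow>
     linear T \<and> (\<forall>u. T u \<in> H1) \<and> (\<exists>C. \<forall>u. H1_norm (T u) \<le> C * norm u) \<and>
     summable (\<lambda>j. (H1_norm (T (e j)))\<^sup>2)"

definition hs_inner_L2 ::
    "(nat \<Rightarrow> 'n::finite L2) \<Rightarrow> ('n L2 \<Rightarrow> 'n L2) \<Rightarrow> ('n L2 \<Rightarrow> 'n L2) \<Rightarrow> complex" where
  "hs_inner_L2 e A B = (\<Sum>j. cinner (A (e j)) (B (e j)))"


section \<open>The free Schroedinger group\<close>

definition unitary_group :: "(real \<Rightarrow> 'n::finite L2 \<Rightarrow> 'n L2) \<Rightarrow> bool" where
  "unitary_group S \<longleftrightarrow>
     (\<forall>t u v. S t (u + v) = S t u + S t v) \<and> (\<forall>t c u. S t (c *\<^sub>C u) = c *\<^sub>C S t u) \<and>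
     (\<forall>t u v. cinner (S t u) (S t v) = cinner u v) \<and>
     (\<forall>u. S 0 u = u) \<and> (\<forall>s t u. S (s + t) u = S s (S t u)) \<and>
     (\<forall>u. continuous_on UNIV (\<lambda>t. S t u))"

definition group_generator ::
    "(real \<Rightarrow> 'n::finite L2 \<Rightarrow> 'n L2) \<Rightarrow> 'n L2 set \<Rightarrow> ('n L2 \<Rightarrow> 'n L2) \<Rightarrow> bool" where
  "group_generator S D A \<longleftrightarrow>
     (\<forall>u v. ((\<lambda>t. (S t u - u) /\<^sub>R t) \<longlongrightarrow> v) (at 0) \<longleftrightarrow> u \<in> D \<and> v = A u)"

text \<open>
  \<open>S(t) = exp(-i t \<Delta>)\<close>: the unitary group generated by \<open>-i \<Delta>\<close> with domain \<open>H\<^sup>2\<close>. A strongly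
  continuous group is determined by its generator, so at most one \<open>S\<close> satisfies this predicate.
\<close>

definition schrodinger_group :: "(real \<Rightarrow> 'n::finite L2 \<Rightarrow> 'n L2) \<Rightarrow> bool" where
  "schrodinger_group S \<longleftrightarrow>
     unitary_group S \<and> group_generator S H2 (\<lambda>u. (- \<i>) *\<^sub>C laplacian u)"


section \<open>Wiener processes\<close>

definition normal_filtration :: "'w measure \<Rightarrow> (real \<Rightarrow> 'w measure) \<Rightarrow> bool" where
  "normal_filtration M F \<longleftrightarrow>
     (\<forall>t\<ge>0. subalgebra M (F t)) \<and>
     (\<forall>s t. 0 \<le> s \<longrightarrow> s \<le> t \<longrightarrow> sets (F s) \<subseteq> sets (F t)) \<and>
     null_sets M \<subseteq> sets (F 0) \<and>
     (\<forall>t\<ge>0. sets (F t) = (\<Inter>s\<in>{t<..}. sets (F s)))"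

text \<open>
  Centred Gaussian laws are the laws of \<open>\<sigma> Z\<close> with \<open>Z\<close> standard normal; \<open>\<sigma> = 0\<close> is allowed.
\<close>

definition centred_gaussian :: "'w measure \<Rightarrow> ('w \<Rightarrow> real) \<Rightarrow> bool" where
  "centred_gaussian M X \<longleftrightarrow> X \<in> borel_measurable M \<and>
     (\<exists>\<sigma>. distr M borel X = distr std_normal_distribution borel (\<lambda>z. \<sigma> * z))"

text \<open>
  The covariance operator is understood with respect to the inner product \<open>ip\<close>. For \<open>ip = rinner\<close>
  the increment \<open>W(t) - W(s)\<close> has law \<open>N(0, (t - s) Q)\<close> on the real Hilbert space \<open>L\<^sup>2\<close>. For
  \<open>ip = cinner\<close> the Hermitian covariance is prescribed; this includes
  \<open>W(t) = (\<Sum>j. \<beta>\<^sub>j(t) Q\<^sup>1\<^sup>/\<^sup>2 e\<^sub>j)\<close> with real Brownian motions \<open>\<beta>\<^sub>j\<close> and a complex orthonormal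
  basis \<open>e\<close>.
\<close>

definition Q_wiener_process ::
    "('n::finite L2 \<Rightarrow> 'n L2 \<Rightarrow> complex) \<Rightarrow> 'w measure \<Rightarrow> (real \<Rightarrow> 'w measure) \<Rightarrow>
     ('n L2 \<Rightarrow> 'n L2) \<Rightarrow> (real \<Rightarrow> 'w \<Rightarrow> 'n L2) \<Rightarrow> bool" where
  "Q_wiener_process ip M F Q W \<longleftrightarrow>
     (AE \<omega> in M. W 0 \<omega> = 0) \<and>
     (AE \<omega> in M. continuous_on {0..} (\<lambda>t. W t \<omega>)) \<and>
     (\<forall>t\<ge>0. W t \<in> borel_measurable (F t)) \<and>
     (\<forall>t\<ge>0. integrable M (\<lambda>\<omega>. (norm (W t \<omega>))\<^sup>2)) \<and>
     (\<forall>s t. 0 \<le> s \<longrightarrow> s \<le> t \<longrightarrow>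
        prob_space.indep_set M (sets (F s))
          {(\<lambda>\<omega>. W t \<omega> - W s \<omega>) -` B \<inter> space M | B. B \<in> sets borel} \<and>
        (\<forall>h. centred_gaussian M (\<lambda>\<omega>. inner (W t \<omega> - W s \<omega>) h)) \<and>
        (\<forall>a b. (\<integral>\<omega>. ip (W t \<omega> - W s \<omega>) a * cnj (ip (W t \<omega> - W s \<omega>) b) \<partial>M)
                = complex_of_real (t - s) * ip (Q b) a))"


section \<open>The exponential integrator\<close>

primrec exp_integrator ::
    "(real \<Rightarrow> 'n::finite L2 \<Rightarrow> 'n L2) \<Rightarrow> (real \<Rightarrow> 'w \<Rightarrow> 'n L2) \<Rightarrow> real \<Rightarrow> ('w \<Rightarrow> 'n L2) \<Rightarrow>
     nat \<Rightarrow> 'w \<Rightarrow> 'n L2" where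
  "exp_integrator S W k u0 0 = u0"
| "exp_integrator S W k u0 (Suc n) =
     (\<lambda>\<omega>. S k (exp_integrator S W k u0 n \<omega>)
           - \<i> *\<^sub>C S k (W (real (Suc n) * k) \<omega> - W (real n * k) \<omega>))"

end

theory Submission
  imports Defs
begin

text \<open>
  All estimates are made for the difference quotients \<open>D\<^sub>h u = (u(\<cdot> + h e\<^sub>i) - u) / h\<close>, so no Fourier
  transform is needed. A function has the weak derivative \<open>g\<close> iff \<open>D\<^sub>h u \<rightarrow> g\<close> in \<open>L\<^sup>2\<close>. Conjugating \<open>S\<close>
  with a translation gives a unitary group with the same generator, hence the same group, so \<open>S\<close>
  commutes with \<open>D\<^sub>h\<close> and preserves \<open>H\<^sup>1\<close> and the momentum. For an increment \<open>\<Delta>\<close> of \<open>W\<close> over time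
  \<open>\<tau>\<close> and an operator \<open>A\<close> with an adjoint, Parseval's identity gives
  \<open>E \<parallel>A \<Delta>\<parallel>\<^sup>2 = \<tau> (\<Sum>l. \<parallel>A Q\<^sup>1\<^sup>/\<^sup>2 e\<^sub>l\<parallel>\<^sup>2)\<close>. With \<open>A = D\<^sub>h - D\<^sub>h'\<close> this shows \<open>\<Delta> \<in> H\<^sup>1\<close> almost surely; with
  \<open>A = D\<^sub>h \<plusminus> \<i>\<close>, polarization and \<open>h \<rightarrow> 0\<close> it gives the expected momentum of \<open>\<Delta>\<close>. In one step of
  the scheme the momentum changes by that of \<open>\<Delta>\<close> plus a cross term, whose expectation vanishes by
  independence if \<open>E \<parallel>u\<^sub>0\<parallel> < \<infinity>\<close>; in general \<open>u\<^sub>0\<close> is truncated on \<open>{\<parallel>u\<^sub>0\<parallel> \<le> m}\<close>, which replaces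
  the path \<open>u\<^sup>n\<close> by the one started at \<open>0\<close> outside this event.
\<close>

section \<open>Completeness of \<open>L\<^sup>2\<close>\<close>

text \<open>The weak derivative is unbounded and cannot be moved onto a fixed vector of
  \<open>L2\<close>. Its difference quotient is bounded with adjoint \<open>- diffq i (- h)\<close>,
  so measurability, means and covariances are first found for the quotient, and
  \<open>norm (diffq i h u) \<le> norm g\<close>, with \<open>g\<close> the weak derivative,
  controls the passage to the limit. For \<open>ip = cinner\<close> only the Hermitian covariance of
  the noise is given. It determines second moments of A \<Delta> for operators A with an
  \<open>ip\<close>-adjoint. The momentum is not of this form, but it is a difference of two such
  moments; each is a series of nonnegative terms, so sums and expectations can be exchanged in
  \<open>ennreal\<close>. Integrability of the momentum of \<open>u0\<close> does not bound the size
  of \<open>u0\<close>. Hence the cross term of a step may fail to be integrable even if the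
  momentum is; this is why a truncation is made, and the path started at zero supplies the
  integrable majorant on the event that is cut off.\<close>

lemma AE_summable_norm:
  fixes d :: "nat \<Rightarrow> 'a \<Rightarrow> 'b::real_normed_vector"
  assumes [measurable]: "\<And>n. (\<lambda>x. norm (d n x)) \<in> borel_measurable M"
    and bound: "\<And>n. (\<integral>\<^sup>+x. ennreal ((norm (d n x))\<^sup>2) \<partial>M) \<le> ennreal ((1/4) ^ n)"
  shows "AE x in M. summable (\<lambda>n. norm (d n x))"
proof -
  \<comment> \<open>With the weight 2^n the integrals are still summable, as 2^n (1/4)^n = (1/2)^n,
    and the weight pays for passing from squares to first powers below.\<close>
  have "(\<integral>\<^sup>+x. (\<Sum>n. ennreal (2 ^ n * (norm (d n x))\<^sup>2)) \<partial>M)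
      = (\<Sum>n. (\<integral>\<^sup>+x. ennreal (2 ^ n * (norm (d n x))\<^sup>2) \<partial>M))"
    by (rule nn_integral_suminf) measurable
  also have "\<dots> \<le> (\<Sum>n. ennreal ((1/2) ^ n))"
  proof (intro suminf_le summableI)
    fix n
    have "(\<integral>\<^sup>+x. ennreal (2 ^ n * (norm (d n x))\<^sup>2) \<partial>M)
        = ennreal (2 ^ n) * (\<integral>\<^sup>+x. ennreal ((norm (d n x))\<^sup>2) \<partial>M)"
      by (subst nn_integral_cmult[symmetric]) (auto simp: ennreal_mult)
    also have "\<dots> \<le> ennreal (2 ^ n) * ennreal ((1/4) ^ n)"
      by (intro mult_left_mono bound) auto
    also have "\<dots> = ennreal ((1/2) ^ n)"
      by (subst ennreal_mult[symmetric]) (auto simp: power_mult_distrib[symmetric])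
    finally show "(\<integral>\<^sup>+x. ennreal (2 ^ n * (norm (d n x))\<^sup>2) \<partial>M) \<le> ennreal ((1/2) ^ n)" .
  qed
  also have "\<dots> < \<infinity>"
    by (subst suminf_ennreal2) (auto intro!: summable_geometric)
  finally have "AE x in M. (\<Sum>n. ennreal (2 ^ n * (norm (d n x))\<^sup>2)) \<noteq> \<infinity>"
    by (intro nn_integral_PInf_AE) auto
  then show ?thesis
  proof eventually_elim
    case (elim x)
    then have "summable (\<lambda>n. 2 ^ n * (norm (d n x))\<^sup>2)"
      by (intro summable_suminf_not_top) auto
    then have "summable (\<lambda>n. 2 ^ n * (norm (d n x))\<^sup>2 + (1/2) ^ n)"
      by (intro summable_add summable_geometric) auto
    then show ?case
    proof (rule summable_comparison_test')
      fix n :: nat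
      define s where "s = (2::real) ^ n"
      have s: "s > 0" "(1/2) ^ n = 1 / s"
        by (auto simp: s_def power_divide)
      \<comment> \<open>This is t \<le> t^2 + 1 for t = s * norm (d n x); dividing by s bounds the
        norm by the weighted square plus 1/s.\<close>
      have "0 \<le> (s * norm (d n x) - 1/2)\<^sup>2 + 3/4"
        by simp
      then have "s * norm (d n x) \<le> s * (s * (norm (d n x))\<^sup>2 + 1 / s)"
        using s by (simp add: power2_eq_square algebra_simps)
      then show "norm (norm (d n x)) \<le> 2 ^ n * (norm (d n x))\<^sup>2 + (1/2) ^ n"
        using s(1) unfolding s(2) s_def[symmetric] by simp
    qed
  qed
qed

lemma rapid_subseq:
  assumes "\<And>n::nat. \<exists>N. \<forall>l\<ge>N. \<forall>m\<ge>N. P n l m"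
  obtains r :: "nat \<Rightarrow> nat" where "strict_mono r" "\<And>n. P n (r n) (r (Suc n))"
proof -
  from assms obtain N where N: "\<And>n l m. l \<ge> N n \<Longrightarrow> m \<ge> N n \<Longrightarrow> P n l m"
    by metis
  \<comment> \<open>The sum dominates \<open>N n\<close>; the added \<open>n\<close> makes the
    sequence strictly increasing even where the \<open>N i\<close> vanish.\<close>
  define r where "r n = (\<Sum>i\<le>n. N i) + n" for n
  have "strict_mono r"
    by (auto simp: strict_mono_Suc_iff r_def)
  moreover have "r n \<ge> N n" for n
    using member_le_sum[of n "{..n}" N] by (auto simp: r_def)
  moreover have "r n \<le> r (Suc n)" for n
    by (simp add: r_def)
  ultimately show ?thesis
    using that N by (meson le_trans)
qed

text \<open>The Riesz-Fischer argument. Only norms of differences are assumed measurable, so that it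
  serves both for functions on R^d and for random variables with values in
  \<open>L2\<close>.\<close>

lemma Cauchy_subseq_AE:
  fixes u :: "nat \<Rightarrow> 'a \<Rightarrow> 'b::real_normed_vector"
  assumes meas: "\<And>l m. (\<lambda>x. norm (u l x - u m x)) \<in> borel_measurable M"
    and bound: "\<And>e. e > 0 \<Longrightarrow> \<exists>N. \<forall>l\<ge>N. \<forall>m\<ge>N.
      (\<integral>\<^sup>+x. ennreal ((norm (u l x - u m x))\<^sup>2) \<partial>M) \<le> ennreal e"
  obtains r :: "nat \<Rightarrow> nat" where "strict_mono r" "AE x in M. Cauchy (\<lambda>n. u (r n) x)"
proof -
  obtain r where r: "strict_mono r"
    and b: "\<And>n. (\<integral>\<^sup>+x. ennreal ((norm (u (r n) x - u (r (Suc n)) x))\<^sup>2) \<partial>M) \<le> ennreal ((1/4) ^ n)"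
    using rapid_subseq[of "\<lambda>n l m. (\<integral>\<^sup>+x. ennreal ((norm (u l x - u m x))\<^sup>2) \<partial>M) \<le> ennreal ((1/4) ^ n)"]
      bound[of "(1/4) ^ _"] by auto
  have "AE x in M. summable (\<lambda>n. norm (u (r n) x - u (r (Suc n)) x))"
    using meas b by (rule AE_summable_norm)
  then have "AE x in M. Cauchy (\<lambda>n. u (r n) x)"
  proof eventually_elim
    case (elim x)
    show ?case
    proof (rule metric_CauchyI)
      fix e :: real assume "e > 0"
      then obtain N where N: "\<And>m n. m \<ge> N \<Longrightarrow>
          norm (\<Sum>i=m..<n. norm (u (r i) x - u (r (Suc i)) x)) < e"
        using elim unfolding summable_Cauchy by blast
      have *: "dist (u (r m) x) (u (r n) x) < e" if "m \<ge> N" "m \<le> n" for m n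
      proof -
        have "u (r m) x - u (r n) x = (\<Sum>i=m..<n. u (r i) x - u (r (Suc i)) x)"
          using sum_Suc_diff'[OF \<open>m \<le> n\<close>, of "\<lambda>i. - u (r i) x"] by (simp add: algebra_simps)
        then have "dist (u (r m) x) (u (r n) x) \<le> (\<Sum>i=m..<n. norm (u (r i) x - u (r (Suc i)) x))"
          by (simp add: dist_norm norm_sum)
        also have "\<dots> < e"
          using N[OF \<open>m \<ge> N\<close>, of n] by (simp add: sum_nonneg)
        finally show ?thesis .
      qed
      show "\<exists>N. \<forall>m\<ge>N. \<forall>n\<ge>N. dist (u (r m) x) (u (r n) x) < e"
        using * by (metis dist_commute nle_le)
    qed
  qed
  with r show ?thesis by (rule that)
qed

lemma L2_cases:
  obtains f where "square_integrable f" "u = abs_L2 f"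
proof -
  have "L2_rel (rep_L2 u) (rep_L2 u)"
    using Quotient_L2 by (rule Quotient_rep_reflp)
  moreover have "u = abs_L2 (rep_L2 u)"
    by (rule Quotient_abs_rep[OF Quotient_L2, symmetric])
  ultimately show ?thesis
    using that by (auto simp: L2_rel_def)
qed

lemma L2_rel_refl_iff [simp]: "L2_rel f f \<longleftrightarrow> square_integrable f"
  by (auto simp: L2_rel_def)

lemma abs_L2_diff:
  assumes "square_integrable f" "square_integrable g"
  shows "abs_L2 f - abs_L2 g = abs_L2 (\<lambda>x. f x - g x)"
  using assms by (simp add: minus_L2_def plus_L2.abs_eq uminus_L2.abs_eq square_integrable_uminus)

lemma square_integrable_diff:
  "square_integrable f \<Longrightarrow> square_integrable g \<Longrightarrow> square_integrable (\<lambda>x. f x - g x)"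
  using square_integrable_add[of f "\<lambda>x. - g x"] square_integrable_uminus[of g] by simp

lemma norm_abs_L2:
  assumes "square_integrable f"
  shows "(norm (abs_L2 f))\<^sup>2 = (\<integral>x. (cmod (f x))\<^sup>2 \<partial>lborel)"
proof -
  have "(\<integral>x. f x * cnj (f x) \<partial>lborel) = complex_of_real (\<integral>x. (cmod (f x))\<^sup>2 \<partial>lborel)"
    by (simp only: complex_norm_square[symmetric] integral_complex_of_real)
  then show ?thesis
    using assms by (simp add: power2_norm_eq_inner inner_L2.abs_eq)
qed

lemma nn_integral_abs_L2:
  assumes "square_integrable f"
  shows "(\<integral>\<^sup>+x. ennreal ((cmod (f x))\<^sup>2) \<partial>lborel) = ennreal ((norm (abs_L2 f))\<^sup>2)"
  using assms by (subst nn_integral_eq_integral) (auto simp: norm_abs_L2 square_integrable_def)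

lemma square_integrableI_nn:
  assumes "f \<in> borel_measurable borel" "(\<integral>\<^sup>+x. ennreal ((cmod (f x))\<^sup>2) \<partial>lborel) < \<infinity>"
  shows "square_integrable f"
  using assms by (auto simp: square_integrable_def intro!: integrableI_nonneg)

instance L2 :: (finite) complete_space
proof
  fix u :: "nat \<Rightarrow> 'a L2"
  assume "Cauchy u"
  have "\<forall>n. \<exists>f. square_integrable f \<and> u n = abs_L2 f"
    by (metis L2_cases)
  then obtain f where f: "\<And>n. square_integrable (f n)" "\<And>n. u n = abs_L2 (f n)"
    by metis
  have [measurable]: "f n \<in> borel_measurable borel" for n
    using f by (auto simp: square_integrable_def)
  have ff: "(\<integral>\<^sup>+x. ennreal ((norm (f l x - f m x))\<^sup>2) \<partial>lborel) = ennreal ((norm (u l - u m))\<^sup>2)" for l m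
    using f by (simp add: abs_L2_diff nn_integral_abs_L2 square_integrable_diff)
  have bound: "\<exists>N. \<forall>l\<ge>N. \<forall>m\<ge>N. (norm (u l - u m))\<^sup>2 \<le> e" if "e > 0" for e
  proof -
    obtain N where "\<forall>l\<ge>N. \<forall>m\<ge>N. norm (u l - u m) < sqrt e"
      using CauchyD[OF \<open>Cauchy u\<close>, of "sqrt e"] \<open>e > 0\<close> by (meson real_sqrt_gt_zero)
    then show ?thesis
      using that by (metis abs_norm_cancel less_eq_real_def norm_ge_zero real_sqrt_abs real_sqrt_le_iff)
  qed
  obtain r where r: "strict_mono r" "AE x in lborel. Cauchy (\<lambda>n. f (r n) x)"
  proof (rule Cauchy_subseq_AE[of f lborel])
    fix e :: real assume "e > 0"
    then show "\<exists>N. \<forall>l\<ge>N. \<forall>m\<ge>N. (\<integral>\<^sup>+x. ennreal ((norm (f l x - f m x))\<^sup>2) \<partial>lborel) \<le> ennreal e"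
      unfolding ff using bound by (meson ennreal_leI)
  qed auto
  define g where "g x = lim (\<lambda>n. f (r n) x)" for x
  have [measurable]: "g \<in> borel_measurable borel"
    unfolding g_def by measurable
  have conv: "AE x in lborel. (\<lambda>n. f (r n) x) \<longlonglongrightarrow> g x"
    using r(2) by eventually_elim (auto simp: g_def Cauchy_convergent_iff convergent_LIMSEQ_iff)
  \<comment> \<open>Fatou along the subsequence turns a Cauchy bound into a bound for the distance
    to the pointwise limit.\<close>
  have fat: "(\<integral>\<^sup>+x. ennreal ((cmod (f n x - g x))\<^sup>2) \<partial>lborel) \<le> ennreal e"
    if "\<And>m. m \<ge> N \<Longrightarrow> (norm (u n - u m))\<^sup>2 \<le> e" for N n e
  proof -
    have "(\<integral>\<^sup>+x. ennreal ((cmod (f n x - g x))\<^sup>2) \<partial>lborel)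
        = (\<integral>\<^sup>+x. liminf (\<lambda>m. ennreal ((cmod (f n x - f (r m) x))\<^sup>2)) \<partial>lborel)"
      using conv
      by (intro nn_integral_cong_AE, eventually_elim)
        (intro lim_imp_Liminf[symmetric] tendsto_intros, auto)
    also have "\<dots> \<le> liminf (\<lambda>m. \<integral>\<^sup>+x. ennreal ((cmod (f n x - f (r m) x))\<^sup>2) \<partial>lborel)"
      by (rule nn_integral_liminf) measurable
    also have "\<dots> \<le> ennreal e"
      unfolding ff
    proof (rule Liminf_le)
      show "\<forall>\<^sub>F m in sequentially. ennreal ((norm (u n - u (r m)))\<^sup>2) \<le> ennreal e"
        using eventually_ge_at_top[of N]
        by eventually_elim (metis that ennreal_leI le_trans r(1) seq_suble)
    qed simp
    finally show ?thesis .
  qed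
  have "square_integrable g"
  proof -
    obtain N where N: "\<And>l m. l \<ge> N \<Longrightarrow> m \<ge> N \<Longrightarrow> (norm (u l - u m))\<^sup>2 \<le> 1"
      using bound[of 1] by auto
    have "square_integrable (\<lambda>x. f N x - g x)"
      by (rule square_integrableI_nn)
        (use fat[of N N 1] N[of N] in \<open>auto intro: le_less_trans\<close>)
    with f(1)[of N] have "square_integrable (\<lambda>x. f N x - (f N x - g x))"
      by (rule square_integrable_diff)
    then show ?thesis by simp
  qed
  have "u \<longlonglongrightarrow> abs_L2 g"
  proof (rule metric_LIMSEQ_I)
    fix e :: real assume "e > 0"
    then obtain N where N: "\<And>l m. l \<ge> N \<Longrightarrow> m \<ge> N \<Longrightarrow> (norm (u l - u m))\<^sup>2 \<le> (e/2)\<^sup>2"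
      using bound[of "(e/2)\<^sup>2"] by auto
    have "dist (u n) (abs_L2 g) < e" if "n \<ge> N" for n
    proof -
      have "ennreal ((norm (u n - abs_L2 g))\<^sup>2) \<le> ennreal ((e/2)\<^sup>2)"
        using fat[of N n "(e/2)\<^sup>2"] N[OF that] f \<open>square_integrable g\<close>
        by (simp add: abs_L2_diff nn_integral_abs_L2 square_integrable_diff)
      then have "norm (u n - abs_L2 g) \<le> e/2"
        using \<open>e > 0\<close> by (simp add: ennreal_le_iff power2_le_iff_abs_le)
      then show ?thesis using \<open>e > 0\<close> by (simp add: dist_norm)
    qed
    then show "\<exists>N. \<forall>n\<ge>N. dist (u n) (abs_L2 g) < e" by blast
  qed
  then show "convergent u" by (rule convergentI)
qed

instance L2 :: (finite) banach ..

section \<open>Hilbert space structure and translations\<close>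

text \<open>Projection theorem: a sequence in \<open>V\<close> that minimizes the distance to
  \<open>x\<close> is Cauchy, and the residual of its limit is orthogonal to \<open>V\<close>, hence
  zero by totality.\<close>

lemma total_subspace_dense:
  fixes V :: "'a::{real_inner,banach} set"
  assumes V: "subspace V" and total: "\<And>w. (\<And>v. v \<in> V \<Longrightarrow> inner w v = 0) \<Longrightarrow> w = 0"
  shows "x \<in> closure V"
proof -
  define d where "d = infdist x V"
  have ne: "V \<noteq> {}"
    using subspace_0[OF V] by auto
  have d0: "d \<ge> 0"
    by (simp add: d_def infdist_nonneg)
  have dle: "d \<le> norm (x - v)" if "v \<in> V" for v
    using infdist_le[OF that, of x] by (simp add: d_def dist_norm)
  have "\<exists>v\<in>V. norm (x - v) < d + 1 / (real n + 1)" for n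
  proof (rule ccontr)
    assume "\<not> ?thesis"
    then have "d + 1 / (real n + 1) \<le> infdist x V"
      using ne by (subst infdist_notempty[OF ne]) (auto intro!: cINF_greatest simp: dist_norm not_less)
    then show False by (simp add: d_def)
  qed
  then obtain v where v: "\<And>n. v n \<in> V" "\<And>n. norm (x - v n) < d + 1 / (real n + 1)"
    by metis
  have nlim: "(\<lambda>n. norm (x - v n)) \<longlonglongrightarrow> d"
  proof (rule tendsto_sandwich[of "\<lambda>_. d" _ _ "\<lambda>n. d + 1 / (real n + 1)"])
    show "(\<lambda>n. d + 1 / (real n + 1)) \<longlonglongrightarrow> d"
      using LIMSEQ_inverse_real_of_nat_add[of d] by (simp add: field_simps)
    show "\<forall>\<^sub>F n in sequentially. norm (x - v n) \<le> d + 1 / (real n + 1)"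
      by (intro always_eventually allI less_imp_le v(2))
  qed (use v dle in auto)
  have par: "(norm (v m - v n))\<^sup>2 \<le> 2 * ((norm (x - v m))\<^sup>2 - d\<^sup>2) + 2 * ((norm (x - v n))\<^sup>2 - d\<^sup>2)"
    for m n
  proof -
    \<comment> \<open>The midpoint is again at distance at least \<open>d\<close> from
      \<open>x\<close>; the parallelogram identity then bounds the remaining diagonal.\<close>
    have "(1/2) *\<^sub>R (v m + v n) \<in> V"
      by (intro subspace_scale[OF V] subspace_add[OF V] v)
    from dle[OF this] have "d\<^sup>2 \<le> (norm (x - (1/2) *\<^sub>R (v m + v n)))\<^sup>2"
      using d0 by (rule power_mono)
    then show ?thesis
      by (simp add: power2_norm_eq_inner inner_simps inner_commute algebra_simps)
  qed
  have "Cauchy v"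
  proof (rule metric_CauchyI)
    fix e :: real assume e: "e > 0"
    have "(\<lambda>n. (norm (x - v n))\<^sup>2) \<longlonglongrightarrow> d\<^sup>2"
      by (intro tendsto_intros nlim)
    then have "\<forall>\<^sub>F n in sequentially. (norm (x - v n))\<^sup>2 < d\<^sup>2 + e\<^sup>2 / 4"
      by (rule order_tendstoD) (use e in auto)
    then obtain N where N: "\<And>n. n \<ge> N \<Longrightarrow> (norm (x - v n))\<^sup>2 < d\<^sup>2 + e\<^sup>2 / 4"
      by (auto simp: eventually_sequentially)
    have "dist (v m) (v n) < e" if "m \<ge> N" "n \<ge> N" for m n
    proof -
      have "(norm (v m - v n))\<^sup>2 < e\<^sup>2"
        using par[of m n] N[OF that(1)] N[OF that(2)] by argo
      then show ?thesis
        using e power2_less_imp_less[of "norm (v m - v n)" e] by (simp add: dist_norm)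
    qed
    then show "\<exists>N. \<forall>m\<ge>N. \<forall>n\<ge>N. dist (v m) (v n) < e" by blast
  qed
  then obtain y where y: "v \<longlonglongrightarrow> y"
    using Cauchy_convergent_iff convergent_def by blast
  have ny: "norm (x - y) = d"
    by (rule LIMSEQ_unique[OF _ nlim]) (intro tendsto_intros y)
  have "inner (x - y) w = 0" if w: "w \<in> V" for w
  proof (rule ccontr)
    assume nz: "inner (x - y) w \<noteq> 0"
    then have w0: "inner w w > 0" by auto
    \<comment> \<open>The minimizer along the direction \<open>w\<close>: it would lower the squared
      distance by the square of \<open>inner (x - y) w\<close> divided by
      \<open>inner w w\<close>.\<close>
    define t where "t = inner (x - y) w / inner w w"
    have "d \<le> norm (x - (y + t *\<^sub>R w))"
    proof (rule LIMSEQ_le_const)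
      show "(\<lambda>n. norm (x - (v n + t *\<^sub>R w))) \<longlonglongrightarrow> norm (x - (y + t *\<^sub>R w))"
        by (intro tendsto_intros y)
      show "\<exists>N. \<forall>n\<ge>N. d \<le> norm (x - (v n + t *\<^sub>R w))"
        using dle v(1) w V by (auto intro!: subspace_add subspace_scale)
    qed
    then have "(norm (x - y))\<^sup>2 \<le> (norm ((x - y) - t *\<^sub>R w))\<^sup>2"
      using d0 ny by (simp add: diff_diff_eq power_mono)
    also have "\<dots> = (norm (x - y))\<^sup>2 - 2 * t * inner (x - y) w + t\<^sup>2 * inner w w"
      unfolding power2_norm_eq_inner
      by (simp add: inner_diff_left inner_diff_right inner_commute power2_eq_square algebra_simps)
    also have "\<dots> = (norm (x - y))\<^sup>2 - (inner (x - y) w)\<^sup>2 / inner w w"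
      using w0 by (simp add: t_def power2_eq_square field_simps)
    finally show False
      using nz w0 by (simp add: divide_le_0_iff)
  qed
  then have "x - y = 0"
    by (rule total)
  then show ?thesis
    using y v(1) by (auto simp: closure_sequential)
qed

section \<open>Complex scalars and the Hermitian inner product on \<open>L2\<close>\<close>

lemma scaleC_add_right: "c *\<^sub>C (u + v) = c *\<^sub>C u + c *\<^sub>C v"
  by transfer (auto simp: L2_rel_def distrib_left intro!: square_integrable_add square_integrable_cmult)

lemma scaleC_scaleC: "c *\<^sub>C d *\<^sub>C u = (c * d) *\<^sub>C u"
  by transfer (auto simp: L2_rel_def mult.assoc intro!: square_integrable_cmult)

lemma scaleC_of_real: "complex_of_real r *\<^sub>C u = r *\<^sub>R u"
  by transfer (auto simp: L2_rel_def intro!: square_integrable_cmult)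

lemma scaleC_scaleR: "c *\<^sub>C r *\<^sub>R u = r *\<^sub>R c *\<^sub>C u"
  by (simp flip: scaleC_of_real add: scaleC_scaleC mult.commute)

lemma scaleC_minus_left: "(- c) *\<^sub>C u = - (c *\<^sub>C u)"
  by transfer (auto simp: L2_rel_def intro!: square_integrable_uminus square_integrable_cmult)

lemma scaleC_1 [simp]: "1 *\<^sub>C u = u"
  using scaleC_of_real[of 1 u] by simp

lemma linear_scaleC: "linear (scaleC c)"
  by (rule linearI) (auto simp: scaleC_add_right scaleC_scaleR)

lemma Re_cinner [simp]: "Re (cinner u v) = inner u v"
  by transfer simp

lemma cinner_scaleC_left: "cinner (c *\<^sub>C u) v = c * cinner u v"
  by transfer (simp add: mult.assoc)

lemma cinner_commute: "cinner v u = cnj (cinner u v)"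
proof transfer
  fix f g :: "real^'a \<Rightarrow> complex"
  assume "L2_rel f f" "L2_rel g g"
  then have "integrable lborel (\<lambda>x. f x * cnj (g x))"
    by (simp add: square_integrable_prod)
  then have "(\<integral>x. cnj (f x * cnj (g x)) \<partial>lborel) = cnj (\<integral>x. f x * cnj (g x) \<partial>lborel)"
    by (rule integral_bounded_linear[OF bounded_linear_cnj])
  then show "(\<integral>x. g x * cnj (f x) \<partial>lborel) = cnj (\<integral>x. f x * cnj (g x) \<partial>lborel)"
    by (simp add: mult.commute)
qed

lemma cinner_scaleC_right: "cinner u (c *\<^sub>C v) = cnj c * cinner u v"
  by (metis cinner_commute cinner_scaleC_left complex_cnj_mult)

lemma inner_scaleC_left: "inner (c *\<^sub>C u) v = inner u (cnj c *\<^sub>C v)"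
  by (metis Re_cinner cinner_scaleC_left cinner_scaleC_right complex_cnj_cnj)

lemma Im_cinner: "Im (cinner u v) = inner u (\<i> *\<^sub>C v)"
  using Re_cinner[of u "\<i> *\<^sub>C v"] by (simp add: cinner_scaleC_right del: Re_cinner)

lemma norm_scaleC: "norm (c *\<^sub>C u) = cmod c * norm u"
proof -
  have "cnj c *\<^sub>C c *\<^sub>C u = (cmod c)\<^sup>2 *\<^sub>R u"
    using scaleC_of_real[of "(cmod c)\<^sup>2" u] complex_norm_square[of c]
    by (simp add: scaleC_scaleC mult.commute del: of_real_power)
  then have "(norm (c *\<^sub>C u))\<^sup>2 = (cmod c * norm u)\<^sup>2"
    by (simp add: power2_norm_eq_inner inner_scaleC_left power_mult_distrib)
  then show ?thesis
    by (simp add: power2_eq_iff_nonneg)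
qed

lemma bounded_linear_scaleC: "bounded_linear (scaleC c)"
  using linear_scaleC
  by (auto simp: bounded_linear_def bounded_linear_axioms_def norm_scaleC mult.commute
      intro!: exI[of _ "cmod c"])

lemma cinner_add_left: "cinner (u + v) w = cinner u w + cinner v w"
  by (simp add: complex_eq_iff Im_cinner inner_add_left)

lemma cinner_scaleR_left: "cinner (r *\<^sub>R u) v = r * cinner u v"
  by (simp add: complex_eq_iff Im_cinner)

lemma cinner_self: "cinner u u = (norm u)\<^sup>2"
proof -
  have "cnj (cinner u u) = cinner u u"
    by (simp flip: cinner_commute)
  then show ?thesis
    by (simp add: complex_eq_iff power2_norm_eq_inner)
qed

lemma cmod_cinner_le: "cmod (cinner u v) \<le> norm u * norm v"
proof -
  \<comment> \<open>Rotating the phase of \<open>u\<close> makes the pairing real and nonnegative,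
    so the real Cauchy-Schwarz inequality applies.\<close>
  define c where "c = cnj (sgn (cinner u v))"
  have "cinner (c *\<^sub>C u) v = cmod (cinner u v)"
    using complex_norm_square[of "cinner u v"]
    by (cases "cinner u v = 0")
      (auto simp: cinner_scaleC_left c_def sgn_div_norm power2_eq_square scaleR_conv_of_real field_simps)
  then have "cmod (cinner u v) = inner (c *\<^sub>C u) v"
    by (metis Re_cinner Re_complex_of_real)
  also have "\<dots> \<le> norm (c *\<^sub>C u) * norm v"
    by (rule norm_cauchy_schwarz)
  also have "norm (c *\<^sub>C u) \<le> norm u"
    by (simp add: norm_scaleC c_def norm_sgn)
  finally show ?thesis
    by (simp add: mult_right_mono)
qed

text \<open>The noise may be described by its real or by its Hermitian covariance. The arguments on
  the covariance rest on what both pairings share: the real part \<open>inner\<close>, Hermitian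
  symmetry, real linearity, and the adjoint \<open>cnj c\<close> of a scalar
  \<open>c\<close>.\<close>

locale L2_form =
  fixes ip :: "'n::finite L2 \<Rightarrow> 'n L2 \<Rightarrow> complex"
  assumes ip_cases: "ip = rinner \<or> ip = cinner"
begin

lemma Re_ip [simp]: "Re (ip u v) = inner u v"
  using ip_cases by (auto simp: rinner_def)

lemma ip_add_left: "ip (u + v) w = ip u w + ip v w"
  using ip_cases by (auto simp: rinner_def cinner_add_left inner_add_left)

lemma ip_scaleR_left: "ip (r *\<^sub>R u) w = r * ip u w"
  using ip_cases by (auto simp: rinner_def cinner_scaleR_left)

lemma ip_minus_left: "ip (- u) w = - ip u w"
  using ip_scaleR_left[of "-1"] by simp

lemma ip_diff_left: "ip (u - v) w = ip u w - ip v w"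
  using ip_add_left[of u "- v" w] by (simp add: ip_minus_left)

lemma ip_commute: "ip v u = cnj (ip u v)"
  using ip_cases cinner_commute[of v u] by (auto simp: rinner_def inner_commute)

lemma ip_self: "ip u u = (norm u)\<^sup>2"
  using ip_cases by (auto simp: rinner_def cinner_self power2_norm_eq_inner)

lemma cmod_ip_le: "cmod (ip u v) \<le> norm u * norm v"
  using ip_cases by (auto simp: rinner_def cmod_cinner_le Cauchy_Schwarz_ineq2)

text \<open>A general complex scalar does not factor out of \<open>rinner\<close>. Fourier
  coefficients do, since they are real in that case, and this is what partial sums of an expansion
  require.\<close>

lemma ip_scale_left: "ip (ip a b *\<^sub>C u) v = ip a b * ip u v"
  using ip_cases by (auto simp: rinner_def cinner_scaleC_left scaleC_of_real)

lemma ip_scaleC_adjoint: "ip (c *\<^sub>C u) v = ip u (cnj c *\<^sub>C v)"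
  using ip_cases
  by (auto simp: rinner_def cinner_scaleC_left cinner_scaleC_right inner_scaleC_left)

lemma bounded_linear_ip: "bounded_linear (\<lambda>u. ip u v)"
  by (rule bounded_linear_intro[of _ "norm v"])
    (auto simp: ip_add_left ip_scaleR_left scaleR_conv_of_real cmod_ip_le)

context
  fixes e :: "nat \<Rightarrow> 'n L2"
  assumes e: "orthonormal_basis ip e"
begin

text \<open>The residuals \<open>d N\<close> are orthogonal to the partial sums, so their squared
  norms decrease and differ by the squared distances: the residuals form a Cauchy sequence. Their
  limit has all coefficients zero, and the second clause of \<open>orthonormal_basis\<close> makes
  it vanish.\<close>

lemma parseval: "(\<lambda>j. (cmod (ip u (e j)))\<^sup>2) sums (norm u)\<^sup>2"
proof -
  have orth: "ip (e i) (e j) = (if i = j then 1 else 0)" for i j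
    using e by (auto simp: orthonormal_basis_def)
  define s where "s N = (\<Sum>j<N. ip u (e j) *\<^sub>C e j)" for N
  define d where "d N = u - s N" for N
  have s_e: "ip (s N) (e j) = (if j < N then ip u (e j) else 0)" for N j
  proof (induction N)
    case 0
    show ?case using ip_scaleR_left[of 0] by (simp add: s_def)
  next
    case (Suc N)
    then show ?case
      by (auto simp: s_def ip_add_left ip_scale_left orth less_Suc_eq)
  qed
  have sd: "inner (s M) (d N) = 0" if "M \<le> N" for M N
    using that
  proof (induction M)
    case (Suc M)
    have "ip (e M) (d N) = 0"
      using Suc.prems by (subst ip_commute) (simp add: d_def ip_diff_left s_e)
    then have "inner (ip u (e M) *\<^sub>C e M) (d N) = 0"
      using Re_ip[of "ip u (e M) *\<^sub>C e M" "d N"] by (simp add: ip_scale_left del: Re_ip)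
    with Suc show ?case
      by (simp add: s_def inner_add_left)
  qed (simp add: s_def)
  have pyth: "(norm (d M))\<^sup>2 = (norm (d M - d N))\<^sup>2 + (norm (d N))\<^sup>2" if "M \<le> N" for M N
  proof -
    have "d M - d N = s N - s M"
      by (simp add: d_def)
    then have "inner (d M - d N) (d N) = 0"
      using sd[of M N] sd[of N N] that by (simp add: inner_diff_left)
    then show ?thesis
      by (simp add: power2_norm_eq_inner inner_diff_left inner_diff_right inner_commute)
  qed
  have part: "(norm (d N))\<^sup>2 = (norm u)\<^sup>2 - (\<Sum>j<N. (cmod (ip u (e j)))\<^sup>2)" for N
  proof (induction N)
    case (Suc N)
    have "d N - d (Suc N) = ip u (e N) *\<^sub>C e N"
      by (simp add: d_def s_def)
    moreover have "norm (e N) = 1"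
      using orth[of N N] norm_ge_zero[of "e N"]
      by (auto simp: ip_self power2_eq_1_iff simp del: of_real_power norm_ge_zero)
    ultimately have "(norm (d N - d (Suc N)))\<^sup>2 = (cmod (ip u (e N)))\<^sup>2"
      by (simp add: norm_scaleC)
    with pyth[of N "Suc N"] Suc show ?case by simp
  qed (simp add: d_def s_def)
  have "decseq (\<lambda>N. (norm (d N))\<^sup>2)"
  proof (rule decseq_SucI)
    show "(norm (d (Suc n)))\<^sup>2 \<le> (norm (d n))\<^sup>2" for n
      using pyth[of n "Suc n"] zero_le_power2[of "norm (d n - d (Suc n))"] by linarith
  qed
  then have "convergent (\<lambda>N. (norm (d N))\<^sup>2)"
    by (intro Bseq_monoseq_convergent decseq_imp_monoseq decseq_bounded[of _ 0]) auto
  then have cN: "Cauchy (\<lambda>N. (norm (d N))\<^sup>2)"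
    by (simp add: Cauchy_convergent_iff)
  have "Cauchy d"
  proof (rule metric_CauchyI)
    fix r :: real assume r: "r > 0"
    then obtain N where N: "\<forall>m\<ge>N. \<forall>n\<ge>N. norm ((norm (d m))\<^sup>2 - (norm (d n))\<^sup>2) < r\<^sup>2"
      using CauchyD[OF cN, of "r\<^sup>2"] by auto
    have *: "dist (d m) (d n) < r" if "N \<le> m" "m \<le> n" for m n
    proof -
      have "norm ((norm (d m))\<^sup>2 - (norm (d n))\<^sup>2) < r\<^sup>2"
        using N that by auto
      then have "(norm (d m - d n))\<^sup>2 < r\<^sup>2"
        using pyth[OF that(2)] by simp
      then show ?thesis
        using r power2_less_imp_less[of "norm (d m - d n)" r] by (simp add: dist_norm)
    qed
    show "\<exists>N. \<forall>m\<ge>N. \<forall>n\<ge>N. dist (d m) (d n) < r"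
      using * by (metis dist_commute nle_le)
  qed
  then obtain x where x: "d \<longlonglongrightarrow> x"
    using Cauchy_convergent_iff convergent_def by blast
  have "ip x (e j) = 0" for j
  proof (rule LIMSEQ_unique)
    show "(\<lambda>N. ip (d N) (e j)) \<longlonglongrightarrow> ip x (e j)"
      by (rule bounded_linear.tendsto[OF bounded_linear_ip x])
    show "(\<lambda>N. ip (d N) (e j)) \<longlonglongrightarrow> 0"
      by (rule tendsto_eventually, rule eventually_mono[OF eventually_gt_at_top[of j]])
        (simp add: d_def ip_diff_left s_e)
  qed
  then have "x = 0"
    using e by (auto simp: orthonormal_basis_def)
  with x have "(\<lambda>N. (norm u)\<^sup>2 - (norm (d N))\<^sup>2) \<longlonglongrightarrow> (norm u)\<^sup>2 - (norm (0 :: 'n L2))\<^sup>2"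
    by (intro tendsto_intros) simp
  then show ?thesis
    by (simp add: part sums_def)
qed

lemma parseval_inner: "(\<lambda>j. Re (ip u (e j) * cnj (ip v (e j)))) sums inner u v"
proof -
  have polar: "((cmod (a + b))\<^sup>2 - (cmod (a - b))\<^sup>2) / 4 = Re (a * cnj b)" for a b
    by (simp add: cmod_power2) (simp add: power2_eq_square algebra_simps)
  have "(\<lambda>j. ((cmod (ip (u + v) (e j)))\<^sup>2 - (cmod (ip (u - v) (e j)))\<^sup>2) / 4)
      sums (((norm (u + v))\<^sup>2 - (norm (u - v))\<^sup>2) / 4)"
    by (intro sums_divide sums_diff parseval)
  also have "((norm (u + v))\<^sup>2 - (norm (u - v))\<^sup>2) / 4 = inner u v"
    by (simp add: power2_norm_eq_inner inner_simps inner_commute)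
  also have "(\<lambda>j. ((cmod (ip (u + v) (e j)))\<^sup>2 - (cmod (ip (u - v) (e j)))\<^sup>2) / 4)
      = (\<lambda>j. Re (ip u (e j) * cnj (ip v (e j))))"
    by (simp only: ip_add_left ip_diff_left polar)
  finally show ?thesis .
qed

end

end

section \<open>Translations and difference quotients\<close>

lemma integral_lborel_translate:
  fixes f :: "'a::euclidean_space \<Rightarrow> 'b::{banach,second_countable_topology}"
  assumes [measurable]: "f \<in> borel_measurable borel"
  shows "(\<integral>x. f (x + h) \<partial>lborel) = (\<integral>x. f x \<partial>lborel)"
  by (subst (2) lborel_distr_plus[of h, symmetric], subst integral_distr) (auto simp: add.commute)

lemma integrable_lborel_translate:
  fixes f :: "'a::euclidean_space \<Rightarrow> 'b::{banach,second_countable_topology}"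
  assumes [measurable]: "integrable lborel f"
  shows "integrable lborel (\<lambda>x. f (x + h))"
proof -
  have "integrable (distr lborel borel ((+) h)) f"
    using assms by (simp add: lborel_distr_plus)
  then show ?thesis
    by (subst (asm) integrable_distr_eq) (auto simp: add.commute)
qed

lemma square_integrable_translate:
  assumes "square_integrable f" shows "square_integrable (\<lambda>x. f (x + h))"
  using assms integrable_lborel_translate[of "\<lambda>x. (cmod (f x))\<^sup>2" h]
  by (auto simp: square_integrable_def)

lemma AE_lborel_translate:
  fixes h :: "'a::euclidean_space"
  assumes "AE x in lborel. P x" shows "AE x in lborel. P (x + h)"
proof -
  obtain N where N: "{x. \<not> P x} \<subseteq> N" "N \<in> null_sets lborel"
    using assms by (auto elim!: AE_E simp: null_sets_def)
  have "AE x in distr lborel borel ((+) h). x \<notin> N"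
    using N(2) by (simp add: lborel_distr_plus AE_not_in)
  then have "AE x in lborel. h + x \<notin> N"
    using N(2) by (subst (asm) AE_distr_iff) auto
  then show ?thesis
    by eventually_elim (use N(1) in \<open>auto simp: add.commute\<close>)
qed

lift_definition translate :: "real^'n \<Rightarrow> 'n::finite L2 \<Rightarrow> 'n L2"
  is "\<lambda>h f x. f (x + h)"
  subgoal for h f g
    using AE_lborel_translate[of "\<lambda>x. f x = g x" h]
    by (simp add: L2_rel_def square_integrable_translate)
  done

lemma translate_add: "translate h (u + v) = translate h u + translate h v"
  by transfer (auto simp: intro!: square_integrable_add square_integrable_translate)

lemma translate_scaleC: "translate h (c *\<^sub>C u) = c *\<^sub>C translate h u"
  by transfer (auto simp: intro!: square_integrable_cmult square_integrable_translate)

lemma translate_scaleR: "translate h (c *\<^sub>R u) = c *\<^sub>R translate h u"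
  by (simp add: translate_scaleC flip: scaleC_of_real)

lemma translate_translate: "translate h (translate k u) = translate (h + k) u"
  by transfer (auto simp: add.assoc intro!: square_integrable_translate)

lemma translate_0 [simp]: "translate 0 u = u"
  by transfer auto

lemma cinner_translate: "cinner (translate h u) (translate h v) = cinner u v"
  by transfer (auto simp: square_integrable_def intro!: integral_lborel_translate[where f="\<lambda>x. _ x * cnj (_ x)"])

lemma cinner_translate_left: "cinner (translate h u) v = cinner u (translate (- h) v)"
  using cinner_translate[of "- h" "translate h u" v] by (simp add: translate_translate)

lemma inner_translate_left: "inner (translate h u) v = inner u (translate (- h) v)"
  by (metis Re_cinner cinner_translate_left)

lemma norm_translate [simp]: "norm (translate h u) = norm u"
  by (simp add: norm_eq_sqrt_inner inner_translate_left translate_translate)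

lemma linear_translate: "linear (translate h)"
  by (rule linearI) (auto simp: translate_add translate_scaleR)

lemma bounded_linear_translate: "bounded_linear (translate h)"
  using linear_translate by (auto simp: bounded_linear_def bounded_linear_axioms_def intro: exI[of _ 1])

lemma translate_diff: "translate h (u - v) = translate h u - translate h v"
  by (rule linear_diff[OF linear_translate])

text \<open>At \<open>h = 0\<close> the value is zero, so the formula for the translate and the
  bound by the weak derivative hold for every \<open>h\<close>.\<close>

definition diffq :: "'n::finite \<Rightarrow> real \<Rightarrow> 'n L2 \<Rightarrow> 'n L2" where
  "diffq i h u = (translate (axis i h) u - u) /\<^sub>R h"

lemma axis_minus: "axis i (- h) = - (axis i h :: real^'n)"
  by (simp add: axis_def vec_eq_iff)

lemma bounded_linear_diffq: "bounded_linear (diffq i h)"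
proof -
  have "bounded_linear (\<lambda>u. (translate (axis i h) u - u) /\<^sub>R h)"
    by (intro bounded_linear_const_scaleR bounded_linear_sub bounded_linear_translate bounded_linear_ident)
  then show ?thesis
    by (simp add: diffq_def[abs_def])
qed

text \<open>Integration by parts in discrete form. The real part is invariance of the integral under
  translation; testing with \<i> v gives the imaginary part.\<close>

lemma cinner_diffq_left: "cinner (diffq i h u) v = cinner u (- diffq i (- h) v)"
proof -
  have "inner (diffq i h u) w = inner u (- diffq i (- h) w)" for w
    by (simp add: diffq_def inner_diff_left inner_diff_right inner_translate_left axis_minus)
  moreover have "\<i> *\<^sub>C - diffq i (- h) v = - diffq i (- h) (\<i> *\<^sub>C v)"
    by (simp add: diffq_def linear_simps[OF bounded_linear_scaleC] translate_scaleC)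
  ultimately show ?thesis
    by (simp add: complex_eq_iff Im_cinner)
qed

lemma inner_diffq_left: "inner (diffq i h u) v = - inner u (diffq i (- h) v)"
  using arg_cong[OF cinner_diffq_left, of Re] by simp

section \<open>Test functions\<close>

text \<open>A single term of the exponential series is at most its sum: (c r)^n / n! \<le> exp (c
  r).\<close>

lemma power_exp_bound:
  fixes c r :: real
  assumes "c > 0" "r \<ge> 0"
  shows "r ^ n * exp (- c * r) \<le> fact n / c ^ n"
proof -
  have "(c * r) ^ n / fact n \<le> (\<Sum>k\<le>n. (c * r) ^ k / fact k)"
    using assms by (intro member_le_sum[where f="\<lambda>k. (c * r) ^ k / fact k"]) auto
  also have "\<dots> \<le> exp (c * r)"
  proof -
    have s: "(\<lambda>k. (c * r) ^ k / fact k) sums exp (c * r)"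
      using exp_converges[of "c * r"] by (simp add: field_simps)
    show ?thesis
      using sum_le_suminf[OF sums_summable[OF s], of "{..n}"] assms sums_unique[OF s] by auto
  qed
  finally show ?thesis
    using assms by (simp add: exp_minus field_simps power_mult_distrib)
qed

text \<open>
  With \<open>q > 0\<close> exactly on an interval and \<open>p = 1\<close>, \<open>m = 0\<close> this is the standard bump on that
  interval; the polynomial \<open>p\<close> and the power \<open>m\<close> make the family closed under differentiation, and
  \<open>c \<rightarrow> 0\<close> turns the bump into the indicator.
\<close>

definition bump :: "real \<Rightarrow> real poly \<Rightarrow> real poly \<Rightarrow> nat \<Rightarrow> real \<Rightarrow> real" where
  "bump c q p m x =
     (if 0 < poly q x then poly p x * inverse (poly q x) ^ m * exp (- c * inverse (poly q x)) else 0)"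

text \<open>Numerator of the derivative over the denominator q^(m + 2). The three summands come from
  differentiating \<open>p\<close>, the power of 1/q and the exponential, in this order.\<close>

definition bump_deriv_poly :: "real \<Rightarrow> real poly \<Rightarrow> real poly \<Rightarrow> nat \<Rightarrow> real poly" where
  "bump_deriv_poly c q p m =
     pderiv p * q\<^sup>2 - smult (real m) (p * pderiv q * q) + smult c (p * pderiv q)"

text \<open>The exponential absorbs two powers of 1/q more than occur. The bump therefore vanishes
  quadratically at a simple zero of \<open>q\<close>, which yields differentiability with derivative
  zero at the ends of the interval.\<close>

lemma bump_bound:
  assumes "c > 0"
  shows "\<bar>bump c q p m x\<bar> \<le> \<bar>poly p x\<bar> * (fact (m + 2) / c ^ (m + 2)) * (poly q x)\<^sup>2"
proof (cases "0 < poly q x")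
  case True
  define r where "r = inverse (poly q x)"
  have r: "r > 0" "poly q x = inverse r"
    using True by (auto simp: r_def)
  have "\<bar>bump c q p m x\<bar> = \<bar>poly p x\<bar> * (r ^ (m + 2) * exp (- c * r)) * (poly q x)\<^sup>2"
    using True r(1) unfolding bump_def r_def[symmetric]
    by (simp add: abs_mult power_add r(2) power2_eq_square field_simps)
  also have "\<dots> \<le> \<bar>poly p x\<bar> * (fact (m + 2) / c ^ (m + 2)) * (poly q x)\<^sup>2"
    using assms r by (intro mult_right_mono mult_left_mono power_exp_bound) auto
  finally show ?thesis .
qed (use assms in \<open>auto simp: bump_def\<close>)

lemma DERIV_bump:
  assumes c: "c > 0"
  shows "(bump c q p m has_real_derivative bump c q (bump_deriv_poly c q p m) (m + 2) x) (at x)"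
proof (cases "0 < poly q x" "poly q x = 0" rule: bool.exhaust[case_product bool.exhaust])
  case True_True
  then show ?thesis by simp
next
  case True_False
  then have q: "0 < poly q x" by simp
  have "((\<lambda>x. poly p x * inverse (poly q x) ^ m * exp (- c * inverse (poly q x)))
      has_real_derivative bump c q (bump_deriv_poly c q p m) (m + 2) x) (at x)"
    using q
    apply (auto intro!: derivative_eq_intros)
    \<comment> \<open>The power rule produces the exponent m - 1, which is truncated at m =
      0.\<close>
    apply (cases m)
     apply (auto simp: bump_def bump_deriv_poly_def power2_eq_square field_simps)
    done
  moreover have "\<forall>\<^sub>F y in nhds x. 0 < poly q y"
    by (rule order_tendstoD[OF _ q]) (auto intro!: tendsto_intros filterlim_ident simp: poly_altdef)
  then have "\<forall>\<^sub>F y in nhds x. bump c q p m y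
      = poly p y * inverse (poly q y) ^ m * exp (- c * inverse (poly q y))"
    by eventually_elim (simp add: bump_def)
  ultimately show ?thesis
    by (subst DERIV_cong_ev[OF refl _ refl]) auto
next
  case False_True
  \<comment> \<open>A polynomial majorant with a zero of order at least two at \<open>x\<close>; its
    difference quotient at \<open>x\<close> tends to zero and dominates that of the bump.\<close>
  define H where "H y = poly (p * smult (fact (m + 2) / c ^ (m + 2)) (q\<^sup>2)) y" for y
  have H: "\<bar>bump c q p m y\<bar> \<le> \<bar>H y\<bar>" for y
    using bump_bound[OF c, of q p m y] c unfolding H_def
    by (simp add: abs_mult mult_ac del: fact_Suc power_Suc power_add add_2_eq_Suc')
  have H0: "H x = 0"
    using False_True by (simp add: H_def)
  have "(H has_real_derivative 0) (at x)"
    unfolding H_def using False_True c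
    by (auto intro!: derivative_eq_intros simp: pderiv_mult pderiv_smult pderiv_power)
  then have "((\<lambda>y. H y / (y - x)) \<longlongrightarrow> 0) (at x)"
    by (simp add: has_field_derivative_iff H0)
  then have "((\<lambda>y. bump c q p m y / (y - x)) \<longlongrightarrow> 0) (at x)"
    by (rule Lim_null_comparison[rotated, OF tendsto_norm_zero])
      (auto simp: divide_right_mono H)
  then show ?thesis
    using False_True by (simp add: has_field_derivative_iff bump_def)
next
  case False_False
  then have q: "poly q x < 0" by simp
  have "\<forall>\<^sub>F y in nhds x. poly q y < 0"
    by (rule order_tendstoD[OF _ q]) (auto intro!: tendsto_intros filterlim_ident simp: poly_altdef)
  then have "\<forall>\<^sub>F y in nhds x. bump c q p m y = 0"
    by eventually_elim (simp add: bump_def)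
  then show ?thesis
    using q by (subst DERIV_cong_ev[OF refl _ refl, where g="\<lambda>_. 0"]) (auto simp: bump_def)
qed

definition box_bump :: "real \<Rightarrow> ('n::finite \<Rightarrow> real poly) \<Rightarrow> ('n \<Rightarrow> real poly) \<Rightarrow> ('n \<Rightarrow> nat) \<Rightarrow>
    real^'n \<Rightarrow> complex" where
  "box_bump c q p m x = complex_of_real (\<Prod>i\<in>UNIV. bump c (q i) (p i) (m i) (x $ i))"

lemma has_derivative_box_bump:
  assumes c: "c > 0"
  shows "(box_bump c q p m has_derivative
     (\<lambda>h. complex_of_real (\<Sum>i\<in>UNIV. h $ i * bump c (q i) (bump_deriv_poly c (q i) (p i) (m i)) (m i + 2) (x $ i)
        * (\<Prod>j\<in>UNIV - {i}. bump c (q j) (p j) (m j) (x $ j))))) (at x)"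
proof -
  have "((\<lambda>x. bump c (q i) (p i) (m i) (x $ i)) has_derivative
      (\<lambda>h. h $ i * bump c (q i) (bump_deriv_poly c (q i) (p i) (m i)) (m i + 2) (x $ i))) (at x)" for i
    using has_derivative_compose[OF bounded_linear.has_derivative[OF bounded_linear_vec_nth has_derivative_ident]
        DERIV_bump[OF c, THEN has_field_derivative_imp_has_derivative]]
    by (simp add: mult.commute)
  then show ?thesis
    unfolding box_bump_def[abs_def]
    by (intro bounded_linear.has_derivative[OF bounded_linear_of_real] has_derivative_prod) auto
qed

lemma partial_deriv_eqI:
  "(f has_derivative f') (at x) \<Longrightarrow> partial_deriv i f x = f' (axis i 1)"
  unfolding partial_deriv_def by (metis frechet_derivative_at)

lemma partial_deriv_box_bump:
  assumes c: "c > 0"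
  shows "partial_deriv i (box_bump c q p m)
    = box_bump c q (p(i := bump_deriv_poly c (q i) (p i) (m i))) (m(i := m i + 2))"
proof
  fix x :: "real^'a"
  let ?B = "\<lambda>j. bump c (q j) (p j) (m j) (x $ j)"
  let ?B' = "\<lambda>j. bump c (q j) (bump_deriv_poly c (q j) (p j) (m j)) (m j + 2) (x $ j)"
  have "(\<Sum>j\<in>UNIV. axis i 1 $ j * ?B' j * (\<Prod>k\<in>UNIV - {j}. ?B k))
      = ?B' i * (\<Prod>k\<in>UNIV - {i}. ?B k)"
    by (subst sum.remove[of _ i]) (auto simp: axis_def)
  also have "\<dots> = (\<Prod>j\<in>UNIV. bump c (q j) ((p(i := bump_deriv_poly c (q i) (p i) (m i))) j)
      ((m(i := m i + 2)) j) (x $ j))"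
    by (subst (2) prod.remove[of _ i]) (auto intro!: prod.cong)
  finally show "partial_deriv i (box_bump c q p m) x
      = box_bump c q (p(i := bump_deriv_poly c (q i) (p i) (m i))) (m(i := m i + 2)) x"
    by (simp only: partial_deriv_eqI[OF has_derivative_box_bump[OF c]] box_bump_def)
qed

lemma smooth_box_bump:
  assumes c: "c > 0"
  shows "smooth (box_bump c q p m)"
proof (coinduction arbitrary: p m)
  case smooth
  show ?case
    by (intro exI[of _ "box_bump c q p m"] conjI refl allI)
      (auto simp: partial_deriv_box_bump[OF c] differentiable_def intro: has_derivative_box_bump[OF c])
qed

definition interval_poly :: "real \<Rightarrow> real \<Rightarrow> real poly" where
  "interval_poly a b = [:- a, 1:] * [:b, -1:]"

lemma interval_poly_pos_iff: "a < b \<Longrightarrow> 0 < poly (interval_poly a b) x \<longleftrightarrow> a < x \<and> x < b"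
  unfolding interval_poly_def poly_mult by (auto simp: zero_less_mult_iff)

lemma test_function_box_bump:
  fixes a b :: "real^'n::finite"
  assumes c: "c > 0" and ab: "\<And>i. a $ i < b $ i"
  shows "test_function (box_bump c (\<lambda>i. interval_poly (a $ i) (b $ i)) p m)"
proof -
  have "{x. box_bump c (\<lambda>i. interval_poly (a $ i) (b $ i)) p m x \<noteq> 0} \<subseteq> cbox a b"
    using ab by (auto simp: box_bump_def bump_def interval_poly_pos_iff mem_box_cart
      split: if_splits) (meson less_imp_le)+
  then have "compact (closure {x. box_bump c (\<lambda>i. interval_poly (a $ i) (b $ i)) p m x \<noteq> 0})"
    by (meson bounded_cbox bounded_subset compact_closure)
  then show ?thesis
    by (simp add: test_function_def smooth_box_bump[OF c])
qed

text \<open>The positive and negative parts of \<open>g\<close> are densities of two measures that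
  agree and are finite on boxes. Boxes form an intersection-stable generator, so the measures
  coincide, and so do the densities almost everywhere.\<close>

lemma AE_zero_box:
  fixes g :: "'a::euclidean_space \<Rightarrow> real"
  assumes g [measurable]: "g \<in> borel_measurable borel"
    and int: "\<And>a b. integrable lborel (\<lambda>x. indicator (box a b) x * g x)"
    and zero: "\<And>a b. (\<integral>x. indicator (box a b) x * g x \<partial>lborel) = 0"
  shows "AE x in lborel. g x = 0"
proof -
  \<comment> \<open>\<open>ennreal\<close> cuts off negative values, so \<open>M\<close> and
    \<open>N\<close> carry the positive and the negative part.\<close>
  define M where "M = density lborel (\<lambda>x. ennreal (g x))"
  define N where "N = density lborel (\<lambda>x. ennreal (- g x))"
  have pos: "integrable lborel (\<lambda>x. max 0 (indicator (box a b) x * g x))"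
    and neg: "integrable lborel (\<lambda>x. max 0 (- (indicator (box a b) x * g x)))" for a b
    by (intro integrable_max Bochner_Integration.integrable_minus int integrable_zero)+
  have eM: "emeasure M (box a b) = ennreal (\<integral>x. max 0 (indicator (box a b) x * g x) \<partial>lborel)" for a b
  proof -
    have "emeasure M (box a b) = (\<integral>\<^sup>+x. ennreal (max 0 (indicator (box a b) x * g x)) \<partial>lborel)"
      by (auto simp: M_def emeasure_density indicator_def ennreal_neg max_def intro!: nn_integral_cong)
    also have "\<dots> = ennreal (\<integral>x. max 0 (indicator (box a b) x * g x) \<partial>lborel)"
      by (rule nn_integral_eq_integral[OF pos]) simp
    finally show ?thesis .
  qed
  have eN: "emeasure N (box a b) = ennreal (\<integral>x. max 0 (- (indicator (box a b) x * g x)) \<partial>lborel)" for a b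
  proof -
    have "emeasure N (box a b) = (\<integral>\<^sup>+x. ennreal (max 0 (- (indicator (box a b) x * g x))) \<partial>lborel)"
      by (auto simp: N_def emeasure_density indicator_def ennreal_neg max_def intro!: nn_integral_cong)
    also have "\<dots> = ennreal (\<integral>x. max 0 (- (indicator (box a b) x * g x)) \<partial>lborel)"
      by (rule nn_integral_eq_integral[OF neg]) simp
    finally show ?thesis .
  qed
  have eq: "emeasure M (box a b) = emeasure N (box a b)" for a b
  proof -
    have "(\<integral>x. max 0 (indicator (box a b) x * g x) - max 0 (- (indicator (box a b) x * g x)) \<partial>lborel)
        = (\<integral>x. indicator (box a b) x * g x \<partial>lborel)"
      by (intro Bochner_Integration.integral_cong) (auto simp: max_def)
    then have "(\<integral>x. max 0 (indicator (box a b) x * g x) \<partial>lborel)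
        = (\<integral>x. max 0 (- (indicator (box a b) x * g x)) \<partial>lborel)"
      using zero[of a b] by (simp add: Bochner_Integration.integral_diff[OF pos neg])
    then show ?thesis by (simp add: eM eN)
  qed
  have "M = N"
  proof (rule measure_eqI_generator_eq)
    let ?E = "range (\<lambda>(a, b). box a b :: 'a set)"
    show "Int_stable ?E"
      by (auto simp: Int_stable_def box_Int_box)
    show "?E \<subseteq> Pow UNIV" "sets M = sigma_sets UNIV ?E" "sets N = sigma_sets UNIV ?E"
      by (simp_all add: borel_eq_box M_def N_def)
    let ?A = "\<lambda>n::nat. box (- (real n *\<^sub>R One)) (real n *\<^sub>R One) :: 'a set"
    show "range ?A \<subseteq> ?E" "(\<Union>i. ?A i) = UNIV"
      unfolding UN_box_eq_UNIV by auto
    show "emeasure M (?A i) \<noteq> \<infinity>" for i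
      by (simp add: eM)
    show "emeasure M X = emeasure N X" if "X \<in> ?E" for X
      using that eq by auto
  qed
  then have "AE x in lborel. ennreal (g x) = ennreal (- g x)"
    unfolding M_def N_def by (intro sigma_finite_measure.density_unique[OF lborel.sigma_finite_measure_axioms]) auto
  then show ?thesis
    by eventually_elim (metis ennreal_eq_zero_iff ennreal_neg le_cases neg_0_le_iff_le neg_le_0_iff_le order_antisym_conv)
qed

lemma integrable_box_square_integrable:
  assumes "square_integrable f"
  shows "integrable lborel (\<lambda>x. indicator (box a b) x * f x)"
proof -
  have [measurable]: "f \<in> borel_measurable borel"
    using assms by (rule square_integrable_measurable)
  have "integrable lborel (\<lambda>x. (cmod (f x))\<^sup>2 + indicator (box a b) x)"
    using assms by (auto simp: square_integrable_def emeasure_lborel_box_eq)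
  then show ?thesis
  proof (rule Bochner_Integration.integrable_bound)
    have "t \<le> t\<^sup>2 + 1" for t :: real
      using zero_le_power2[of "t - 1/2"] by (simp add: power2_eq_square algebra_simps)
    then show "AE x in lborel. norm (indicator (box a b) x * f x) \<le> norm ((cmod (f x))\<^sup>2 + indicator (box a b) x)"
      by (auto simp: norm_mult indicator_def)
  qed measurable
qed

text \<open>Bumps supported on a box increase to its indicator as their parameter tends to zero, and
  dominated convergence reduces the claim to vanishing integrals over boxes, for the real and the
  imaginary part separately.\<close>

lemma AE_zero_test:
  fixes f :: "real^'n::finite \<Rightarrow> complex"
  assumes f: "square_integrable f"
    and zero: "\<And>\<phi>. test_function \<phi> \<Longrightarrow> (\<integral>x. f x * \<phi> x \<partial>lborel) = 0"
  shows "AE x in lborel. f x = 0"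
proof -
  have [measurable]: "f \<in> borel_measurable borel"
    using f by (rule square_integrable_measurable)
  have box0: "(\<integral>x. indicator (box a b) x * f x \<partial>lborel) = 0" for a b
  proof (cases "\<forall>i. a $ i < b $ i")
    case False
    then have "box a b = {}"
      by (auto simp: set_eq_iff mem_box_cart) (meson less_trans)
    then show ?thesis by simp
  next
    case True
    let ?q = "\<lambda>i. interval_poly (a $ i) (b $ i)"
    define \<phi> where "\<phi> n = box_bump (1 / (real n + 1)) ?q (\<lambda>_. 1) (\<lambda>_. 0)" for n
    have test: "test_function (\<phi> n)" for n
      unfolding \<phi>_def using True by (intro test_function_box_bump) auto
    have [measurable]: "\<phi> n \<in> borel_measurable borel" for n
      using test by (auto simp: test_function_def intro: smooth_measurable)
    have out: "\<phi> n x = 0" if "x \<notin> box a b" for n x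
      using that True by (auto simp: \<phi>_def box_bump_def bump_def interval_poly_pos_iff mem_box_cart)
    have ins: "\<phi> n x = complex_of_real (\<Prod>i\<in>UNIV. exp (- (1 / (real n + 1)) * inverse (poly (?q i) (x $ i))))"
      if "x \<in> box a b" for n x
      using that True by (auto simp: \<phi>_def box_bump_def bump_def interval_poly_pos_iff mem_box_cart)
    have le1: "cmod (\<phi> n x) \<le> indicator (box a b) x" for n x
    proof (cases "x \<in> box a b")
      case x: True
      have "(\<Prod>i\<in>UNIV. exp (- (1 / (real n + 1)) * inverse (poly (?q i) (x $ i)))) \<le> 1"
        using x True
        by (intro prod_le_1) (auto simp: interval_poly_pos_iff mem_box_cart less_imp_le)
      then show ?thesis
        using x by (simp add: ins prod_nonneg abs_prod flip: of_real_prod)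
    qed (simp add: out)
    have lim: "(\<lambda>n. \<phi> n x) \<longlonglongrightarrow> indicator (box a b) x" for x
    proof (cases "x \<in> box a b")
      case x: True
      have "(\<lambda>n. complex_of_real (\<Prod>i\<in>UNIV. exp (- (1 / (real n + 1)) * inverse (poly (?q i) (x $ i)))))
          \<longlonglongrightarrow> complex_of_real (\<Prod>i\<in>(UNIV::'n set). exp (- 0 * inverse (poly (?q i) (x $ i))))"
        using LIMSEQ_inverse_real_of_nat
        by (intro tendsto_intros) (simp add: inverse_eq_divide add.commute)
      then show ?thesis
        using x by (simp add: ins)
    qed (simp add: out)
    have "(\<lambda>n. \<integral>x. f x * \<phi> n x \<partial>lborel) \<longlonglongrightarrow> (\<integral>x. f x * indicator (box a b) x \<partial>lborel)"
    proof (rule integral_dominated_convergence)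
      show "integrable lborel (\<lambda>x. norm (indicator (box a b) x * f x))"
        by (intro integrable_norm integrable_box_square_integrable f)
      show "AE x in lborel. (\<lambda>n. f x * \<phi> n x) \<longlonglongrightarrow> f x * indicator (box a b) x"
        by (intro AE_I2 tendsto_intros lim)
      show "AE x in lborel. norm (f x * \<phi> n x) \<le> norm (indicator (box a b) x * f x)" for n
      proof (rule AE_I2)
        fix x
        have "cmod (\<phi> n x) \<le> cmod (indicator (box a b) x)"
          using le1[of n x] by (cases "x \<in> box a b") auto
        then show "norm (f x * \<phi> n x) \<le> norm (indicator (box a b) x * f x)"
          by (simp add: norm_mult mult.commute mult_left_mono)
      qed
    qed measurable
    then show ?thesis
      by (simp add: zero[OF test] LIMSEQ_const_iff mult.commute)
  qed
  have "AE x in lborel. Re (f x) = 0"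
  proof (rule AE_zero_box)
    have eq: "indicator (box a b) x * Re (f x) = Re (indicator (box a b) x * f x)" for a b x
      by (auto simp: indicator_def)
    show "integrable lborel (\<lambda>x. indicator (box a b) x * Re (f x))" for a b
      unfolding eq by (intro integrable_Re integrable_box_square_integrable f)
    show "(\<integral>x. indicator (box a b) x * Re (f x) \<partial>lborel) = 0" for a b
      unfolding eq using box0[of a b]
      by (subst integral_Re) (auto intro: integrable_box_square_integrable f)
  qed measurable
  moreover have "AE x in lborel. Im (f x) = 0"
  proof (rule AE_zero_box)
    have eq: "indicator (box a b) x * Im (f x) = Im (indicator (box a b) x * f x)" for a b x
      by (auto simp: indicator_def)
    show "integrable lborel (\<lambda>x. indicator (box a b) x * Im (f x))" for a b
      unfolding eq by (intro integrable_Im integrable_box_square_integrable f)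
    show "(\<integral>x. indicator (box a b) x * Im (f x) \<partial>lborel) = 0" for a b
      unfolding eq using box0[of a b]
      by (subst integral_Im) (auto intro: integrable_box_square_integrable f)
  qed measurable
  ultimately show ?thesis
    by eventually_elim (simp add: complex_eq_iff)
qed

section \<open>Stability of test functions and their difference quotients\<close>

lemma smooth_differentiable: "smooth f \<Longrightarrow> f differentiable (at x)"
  by (erule smooth.cases) blast

text \<open>\<open>L\<close> is only real linear, so that conjugation is covered; with the shift
  \<open>h\<close> this treats conjugates, complex multiples and translates at once.\<close>

lemma has_derivative_image:
  assumes L: "bounded_linear L" and f: "f differentiable (at (x + h))"
  shows "((\<lambda>x. L (f (x + h))) has_derivative (\<lambda>k. L (frechet_derivative f (at (x + h)) k))) (at x)"
proof -
  have "((\<lambda>x. x + h) has_derivative (\<lambda>k. k)) (at x)"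
    by (auto intro!: derivative_eq_intros)
  from has_derivative_compose[OF this f[unfolded frechet_derivative_works]]
  show ?thesis
    by (rule bounded_linear.has_derivative[OF L])
qed

lemma partial_deriv_image:
  assumes "bounded_linear L" "smooth f"
  shows "partial_deriv i (\<lambda>x. L (f (x + h))) = (\<lambda>x. L (partial_deriv i f (x + h)))"
  by (rule ext, subst partial_deriv_eqI[OF has_derivative_image])
    (auto simp: assms smooth_differentiable partial_deriv_def)

lemma smooth_image:
  assumes L: "bounded_linear L" and f: "smooth f"
  shows "smooth (\<lambda>x. L (f (x + h)))"
  using f
proof (coinduction arbitrary: f)
  case (smooth f)
  have "(\<lambda>x. L (f (x + h))) differentiable (at x)" for x
    using has_derivative_image[OF L smooth_differentiable[OF smooth]] unfolding differentiable_def by blast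
  then show ?case
    using smooth_partial_deriv[OF smooth]
    by (intro exI[of _ "\<lambda>x. L (f (x + h))"]) (auto simp: partial_deriv_image[OF L smooth])
qed

lemma test_function_image:
  assumes L: "bounded_linear L" and \<phi>: "test_function \<phi>"
  shows "test_function (\<lambda>x. L (\<phi> (x + h)))"
proof -
  have "bounded ((+) (- h) ` {x. \<phi> x \<noteq> 0})"
    using \<phi> by (intro bounded_translation) (simp add: test_function_def)
  moreover have "{x. L (\<phi> (x + h)) \<noteq> 0} \<subseteq> (+) (- h) ` {x. \<phi> x \<noteq> 0}"
  proof
    fix x assume "x \<in> {x. L (\<phi> (x + h)) \<noteq> 0}"
    then have "\<phi> (x + h) \<noteq> 0"
      using linear_simps(3)[OF L] by auto
    then show "x \<in> (+) (- h) ` {x. \<phi> x \<noteq> 0}"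
      by (intro image_eqI[of _ _ "x + h"]) auto
  qed
  ultimately show ?thesis
    using \<phi> by (auto simp: test_function_def intro: bounded_subset smooth_image[OF L])
qed

lemma smooth_continuous: "smooth f \<Longrightarrow> continuous_on S f"
  by (intro differentiable_imp_continuous_on)
    (simp add: differentiable_on_def differentiable_at_withinI smooth_differentiable)

lemma partial_deriv_outside:
  assumes "x \<notin> closure {x. \<phi> x \<noteq> 0}"
  shows "partial_deriv i \<phi> x = 0"
proof -
  have "(\<phi> has_derivative (\<lambda>h. 0)) (at x)"
    by (rule has_derivative_transform_within_open[of "\<lambda>_. 0" _ _ _ "- closure {x. \<phi> x \<noteq> 0}"])
      (use assms closure_subset[of "{x. \<phi> x \<noteq> 0}"] in auto)
  then show ?thesis
    by (simp add: partial_deriv_eqI)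
qed

lemma test_function_partial_deriv:
  assumes "test_function \<phi>" shows "test_function (partial_deriv i \<phi>)"
proof -
  have "{x. partial_deriv i \<phi> x \<noteq> 0} \<subseteq> closure {x. \<phi> x \<noteq> 0}"
    using partial_deriv_outside by auto
  then show ?thesis
    using assms
    by (auto simp: test_function_def smooth_partial_deriv intro: bounded_subset[OF bounded_closure])
qed

lemma test_function_bounded:
  assumes "test_function \<phi>"
  shows "\<exists>B R. (\<forall>x. cmod (\<phi> x) \<le> B) \<and> (\<forall>x. R < norm x \<longrightarrow> \<phi> x = 0) \<and> 0 \<le> B"
proof -
  let ?K = "closure {x. \<phi> x \<noteq> 0}"
  have K: "compact ?K"
    using assms by (simp add: test_function_def)
  then have "bounded (\<phi> ` ?K)"
    using assms by (intro compact_imp_bounded compact_continuous_image smooth_continuous)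
      (simp add: test_function_def)
  then obtain B where B: "\<And>x. x \<in> ?K \<Longrightarrow> cmod (\<phi> x) \<le> B" "B > 0"
    unfolding bounded_pos by auto
  obtain R where R: "\<And>x. x \<in> ?K \<Longrightarrow> norm x \<le> R"
    using compact_imp_bounded[OF K] unfolding bounded_iff by auto
  have 0: "x \<notin> ?K \<Longrightarrow> \<phi> x = 0" for x
    using closure_subset[of "{x. \<phi> x \<noteq> 0}"] by blast
  show ?thesis
  proof (intro exI conjI allI impI)
    show "cmod (\<phi> x) \<le> B" for x
      using B 0[of x] by (cases "x \<in> ?K") auto
    show "\<phi> x = 0" if "R < norm x" for x
      using R[of x] 0[of x] that by fastforce
  qed (use B in simp)
qed

lemma integrable_indicator_cball:
  "integrable lborel (\<lambda>x. c * indicator (cball a r) (x :: 'a::euclidean_space) :: real)"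
  using emeasure_lborel_cball_finite by (intro integrable_mult_right integrable_real_indicator) auto

lemma test_function_square_integrable:
  assumes "test_function \<phi>" shows "square_integrable \<phi>"
proof -
  obtain R B where RB: "\<And>x. cmod (\<phi> x) \<le> B" "\<And>x. R < norm x \<Longrightarrow> \<phi> x = 0" "0 \<le> B"
    using test_function_bounded[OF assms] by auto
  have [measurable]: "\<phi> \<in> borel_measurable borel"
    using assms by (auto simp: test_function_def smooth_measurable)
  have "integrable lborel (\<lambda>x. (cmod (\<phi> x))\<^sup>2)"
  proof (rule Bochner_Integration.integrable_bound[OF integrable_indicator_cball[of "B\<^sup>2" 0 R]])
    show "AE x in lborel. norm ((cmod (\<phi> x))\<^sup>2) \<le> norm (B\<^sup>2 * indicator (cball 0 R) x)"
      using RB by (auto simp: indicator_def power_mono)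
  qed measurable
  then show ?thesis
    by (simp add: square_integrable_def)
qed

lemma vector_derivative_bound:
  fixes f :: "real \<Rightarrow> 'b::real_normed_vector"
  assumes "\<And>t. (f has_vector_derivative f' t) (at t)" "\<And>t. norm (f' t) \<le> B"
  shows "norm (f x - f y) \<le> B * norm (x - y)"
proof (rule differentiable_bound[of UNIV f "\<lambda>t h. h *\<^sub>R f' t"])
  show "onorm (\<lambda>h. h *\<^sub>R f' t) \<le> B" for t
    using assms(2)[of t] order_trans[OF norm_ge_zero assms(2)]
    by (intro onorm_le) (metis mult.commute mult_right_mono norm_ge_zero norm_scaleR real_norm_def)
qed (use assms(1) in \<open>auto simp: has_vector_derivative_def\<close>)

lemma scaleR_axis: "h *\<^sub>R axis i (1 :: real) = axis i h"
  by (simp add: axis_def vec_eq_iff)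

lemma has_vector_derivative_line:
  assumes "smooth f"
  shows "((\<lambda>s. f (x + axis i s)) has_vector_derivative partial_deriv i f (x + axis i t)) (at t)"
proof -
  have "((\<lambda>s. x + s *\<^sub>R axis i 1) has_derivative (\<lambda>s. s *\<^sub>R axis i 1)) (at t)"
    by (auto intro!: derivative_eq_intros)
  then have "((\<lambda>s. x + axis i s) has_derivative axis i) (at t)"
    by (simp add: scaleR_axis)
  moreover have "(f has_derivative frechet_derivative f (at (x + axis i t))) (at (x + axis i t))"
    using smooth_differentiable[OF assms] by (simp add: frechet_derivative_works)
  ultimately have "((\<lambda>s. f (x + axis i s)) has_derivative
      (\<lambda>s. frechet_derivative f (at (x + axis i t)) (axis i s))) (at t)"
    by (rule has_derivative_compose)
  moreover have "frechet_derivative f (at (x + axis i t)) (axis i s) = s *\<^sub>R partial_deriv i f (x + axis i t)" for s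
    unfolding partial_deriv_def
    by (subst linear_cmul[symmetric], rule linear_frechet_derivative, rule smooth_differentiable[OF assms])
      (simp add: scaleR_axis)
  ultimately show ?thesis
    by (simp add: has_vector_derivative_def)
qed

lemma norm_axis: "norm (axis i (h :: real) :: real^'n::finite) = \<bar>h\<bar>"
  using norm_scaleR[of h "axis i 1 :: real^'n"] by (simp add: scaleR_axis norm_axis_1 del: norm_scaleR)

lemma axis_0 [simp]: "axis i (0 :: real) = 0"
  by (simp add: axis_def vec_eq_iff)

lemma diffq_abs_L2:
  assumes "square_integrable f"
  shows "diffq i h (abs_L2 f) = abs_L2 (\<lambda>x. (f (x + axis i h) - f x) /\<^sub>R h)"
  using assms
  by (simp add: diffq_def translate.abs_eq abs_L2_diff square_integrable_translate scaleR_L2.abs_eq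
      square_integrable_diff scaleR_conv_of_real)

lemma square_integrable_diffq:
  "square_integrable f \<Longrightarrow> square_integrable (\<lambda>x. (f (x + axis i h) - f x) /\<^sub>R h)"
  unfolding scaleR_conv_of_real
  by (intro square_integrable_cmult square_integrable_diff square_integrable_translate)

text \<open>The quotients converge pointwise, are bounded by the supremum of the derivative through
  the mean value inequality, and for a bounded set of steps live on one common ball; dominated
  convergence gives the limit in \<open>L2\<close>.\<close>

lemma diffq_test_function:
  assumes \<phi>: "test_function \<phi>"
  shows "((\<lambda>h. diffq i h (abs_L2 \<phi>)) \<longlongrightarrow> abs_L2 (partial_deriv i \<phi>)) (at 0)"
  unfolding tendsto_at_iff_sequentially comp_def
proof (intro allI impI)
  fix X :: "nat \<Rightarrow> real" assume X: "\<forall>n. X n \<in> UNIV - {0}" "X \<longlonglongrightarrow> 0"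
  let ?d = "\<lambda>n x. (\<phi> (x + axis i (X n)) - \<phi> x) /\<^sub>R X n - partial_deriv i \<phi> x"
  note \<phi>' = test_function_partial_deriv[OF \<phi>, of i]
  have sm: "smooth \<phi>"
    using \<phi> by (simp add: test_function_def)
  note [measurable] = smooth_measurable[OF sm] smooth_measurable[OF smooth_partial_deriv[OF sm]]
  obtain R B\<^sub>0 where "\<And>x. cmod (\<phi> x) \<le> B\<^sub>0" and R: "\<And>x. R < norm x \<Longrightarrow> \<phi> x = 0" and "0 \<le> B\<^sub>0"
    using test_function_bounded[OF \<phi>] by auto
  obtain R' B where B: "\<And>x. cmod (partial_deriv i \<phi> x) \<le> B"
    and R': "\<And>x. R' < norm x \<Longrightarrow> partial_deriv i \<phi> x = 0" and "0 \<le> B"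
    using test_function_bounded[OF \<phi>'] by auto
  obtain K where K: "\<And>n. \<bar>X n\<bar> \<le> K"
    using convergent_imp_Bseq[OF convergentI[OF X(2)]] by (metis BseqE real_norm_def)
  \<comment> \<open>\<open>R + K\<close> bounds the supports of the shifted functions, as all steps
    are at most \<open>K\<close>, and \<open>R'\<close> bounds that of the derivative.\<close>
  define r where "r = max (R + K) R'"
  have out: "?d n x = 0" if "r < norm x" for n x
  proof -
    have "norm x - K \<le> norm (x + axis i (X n))"
      using norm_triangle_ineq4[of "x + axis i (X n)" "axis i (X n)"] K[of n] by (simp add: norm_axis)
    with that have "\<phi> (x + axis i (X n)) = 0"
      by (intro R) (simp add: r_def)
    moreover have "0 \<le> K"
      using K[of 0] by linarith
    ultimately show ?thesis
      using that R[of x] R'[of x] by (simp add: r_def)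
  qed
  have bd: "cmod (?d n x) \<le> 2 * B" for n x
  proof -
    have "cmod (\<phi> (x + axis i (X n)) - \<phi> (x + axis i 0)) \<le> B * norm (X n - 0)"
      by (rule vector_derivative_bound[OF has_vector_derivative_line[OF sm] B])
    then have "cmod (\<phi> (x + axis i (X n)) - \<phi> x) / \<bar>X n\<bar> \<le> B"
      using X(1)[rule_format, of n] by (simp add: divide_le_eq)
    moreover have "cmod (?d n x) \<le> cmod (\<phi> (x + axis i (X n)) - \<phi> x) / \<bar>X n\<bar> + cmod (partial_deriv i \<phi> x)"
      by (rule order_trans[OF norm_triangle_ineq4]) (simp add: divide_inverse mult.commute)
    ultimately show ?thesis
      using B[of x] by linarith
  qed
  have lim: "(\<lambda>n. ?d n x) \<longlonglongrightarrow> 0" for x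
  proof -
    have "((\<lambda>h. norm (\<phi> (x + axis i h) - \<phi> x - h *\<^sub>R partial_deriv i \<phi> x) / norm h) \<longlongrightarrow> 0) (at 0)"
      using has_vector_derivative_line[OF sm, of x i 0]
      by (simp add: has_vector_derivative_def has_derivative_at)
    moreover have "\<forall>\<^sub>F h in at 0. norm (\<phi> (x + axis i h) - \<phi> x - h *\<^sub>R partial_deriv i \<phi> x) / norm h
        = norm ((\<phi> (x + axis i h) - \<phi> x) /\<^sub>R h - partial_deriv i \<phi> x)"
    proof (rule eventually_at_filter[THEN iffD2, OF always_eventually], intro allI impI)
      fix h :: real assume "h \<noteq> 0"
      then have "(\<phi> (x + axis i h) - \<phi> x) /\<^sub>R h - partial_deriv i \<phi> x
          = (\<phi> (x + axis i h) - \<phi> x - h *\<^sub>R partial_deriv i \<phi> x) /\<^sub>R h"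
        by (simp add: scaleR_diff_right)
      then show "norm (\<phi> (x + axis i h) - \<phi> x - h *\<^sub>R partial_deriv i \<phi> x) / norm h
        = norm ((\<phi> (x + axis i h) - \<phi> x) /\<^sub>R h - partial_deriv i \<phi> x)"
        by (simp add: divide_inverse mult.commute)
    qed
    ultimately have "((\<lambda>h. (\<phi> (x + axis i h) - \<phi> x) /\<^sub>R h) \<longlongrightarrow> partial_deriv i \<phi> x) (at 0)"
      by (subst (asm) filterlim_cong[OF refl refl]) (auto simp: tendsto_norm_zero_iff LIM_zero_iff)
    then have "(\<lambda>n. (\<phi> (x + axis i (X n)) - \<phi> x) /\<^sub>R X n) \<longlonglongrightarrow> partial_deriv i \<phi> x"
      using X unfolding tendsto_at_iff_sequentially comp_def by simp
    then show ?thesis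
      by (simp add: LIM_zero_iff)
  qed
  have "(\<lambda>n. \<integral>x. (cmod (?d n x))\<^sup>2 \<partial>lborel) \<longlonglongrightarrow> (\<integral>x. (0::real) \<partial>(lborel :: (real^'a) measure))"
  proof (rule integral_dominated_convergence[where w="\<lambda>x. (2 * B)\<^sup>2 * indicator (cball 0 r) x"])
    show "AE x in lborel. (\<lambda>n. (cmod (?d n x))\<^sup>2) \<longlonglongrightarrow> 0"
      using tendsto_norm_zero[OF lim] by (intro AE_I2) simp
    show "AE x in lborel. norm ((cmod (?d n x))\<^sup>2) \<le> (2 * B)\<^sup>2 * indicator (cball 0 r) x" for n
      using out[of _ n] power_mono[OF bd[of n] norm_ge_zero, of _ 2] by (auto simp: indicator_def)
  qed (use integrable_indicator_cball in auto)
  moreover have "(\<integral>x. (cmod (?d n x))\<^sup>2 \<partial>lborel)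
      = (norm (diffq i (X n) (abs_L2 \<phi>) - abs_L2 (partial_deriv i \<phi>)))\<^sup>2" for n
    using test_function_square_integrable[OF \<phi>] test_function_square_integrable[OF \<phi>']
    by (simp add: diffq_abs_L2 abs_L2_diff square_integrable_diffq norm_abs_L2 square_integrable_diff)
  ultimately have "(\<lambda>n. (norm (diffq i (X n) (abs_L2 \<phi>) - abs_L2 (partial_deriv i \<phi>)))\<^sup>2) \<longlonglongrightarrow> 0"
    by simp
  from tendsto_real_sqrt[OF this]
  have "(\<lambda>n. norm (diffq i (X n) (abs_L2 \<phi>) - abs_L2 (partial_deriv i \<phi>))) \<longlonglongrightarrow> 0"
    by simp
  then show "(\<lambda>n. diffq i (X n) (abs_L2 \<phi>)) \<longlonglongrightarrow> abs_L2 (partial_deriv i \<phi>)"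
    by (simp add: tendsto_norm_zero_iff LIM_zero_iff)
qed

section \<open>Density of test functions and the weak derivative as a pairing\<close>

definition test_L2 :: "'n::finite L2 set" where
  "test_L2 = {abs_L2 \<phi> | \<phi>. test_function \<phi>}"

lemma inner_abs_L2:
  "square_integrable f \<Longrightarrow> square_integrable g \<Longrightarrow>
    inner (abs_L2 f) (abs_L2 g) = Re (\<integral>x. f x * cnj (g x) \<partial>lborel)"
  by (simp add: inner_L2.abs_eq)

lemma bounded_linear_cnj_mult: "bounded_linear (\<lambda>z. cnj (c * z))"
  by (intro bounded_linear_compose[OF bounded_linear_cnj] bounded_linear_mult_right)

lemma test_L2_total:
  assumes "\<And>v. v \<in> test_L2 \<Longrightarrow> inner w v = 0"
  shows "w = 0"
proof -
  obtain f where f: "square_integrable f" "w = abs_L2 f"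
    by (rule L2_cases)
  have "AE x in lborel. f x = 0"
  proof (rule AE_zero_test[OF f(1)])
    fix \<phi> :: "real^'a \<Rightarrow> complex" assume \<phi>: "test_function \<phi>"
    have *: "Re (c * (\<integral>x. f x * \<phi> x \<partial>lborel)) = 0" for c
    proof -
      let ?\<psi> = "\<lambda>x. cnj (c * \<phi> (x + 0))"
      have "test_function ?\<psi>"
        by (rule test_function_image[OF bounded_linear_cnj_mult \<phi>])
      then have "inner w (abs_L2 ?\<psi>) = 0" "square_integrable ?\<psi>"
        using assms by (auto simp: test_L2_def intro: test_function_square_integrable)
      then show ?thesis
        using f by (simp add: inner_abs_L2 mult.left_commute)
    qed
    show "(\<integral>x. f x * \<phi> x \<partial>lborel) = 0"
      \<comment> \<open>The factor 1 gives the real part of the integral and the factor - \<i> its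
        imaginary part.\<close>
      using *[of 1] *[of "- \<i>"] by (simp add: complex_eq_iff)
  qed
  then have "L2_rel f (\<lambda>x. 0)"
    using f by (auto simp: L2_rel_def square_integrable_0)
  then have "abs_L2 f = abs_L2 (\<lambda>x. 0)"
    by (rule Quotient_rel_abs[OF Quotient_L2])
  then show ?thesis
    by (simp add: f zero_L2_def)
qed

lemma span_test_L2_dense: "u \<in> closure (span test_L2)"
  by (rule total_subspace_dense) (auto intro: test_L2_total span_base)

text \<open>The definition uses a bilinear complex pairing. Test functions are stable under \<phi>
  \<mapsto> cnj (c * \<phi>); the conjugation turns the pairing into the inner product, and the real
  parts for c = 1 and c = - \<i> recover the complex identity.\<close>

lemma has_weak_partial_iff_inner:
  "has_weak_partial i u g \<longleftrightarrow>
    (\<forall>\<phi>. test_function \<phi> \<longrightarrow> inner u (abs_L2 (partial_deriv i \<phi>)) = - inner g (abs_L2 \<phi>))"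
proof -
  obtain f where f: "square_integrable f" "u = abs_L2 f"
    by (rule L2_cases)
  obtain f' where f': "square_integrable f'" "g = abs_L2 f'"
    by (rule L2_cases)
  have weak: "has_weak_partial i u g \<longleftrightarrow> (\<forall>\<phi>. test_function \<phi> \<longrightarrow>
        (\<integral>x. f x * partial_deriv i \<phi> x \<partial>lborel) = - (\<integral>x. f' x * \<phi> x \<partial>lborel))"
    using f f' by (simp add: has_weak_partial.abs_eq)
  have conj: "test_function (\<lambda>x. cnj (c * \<phi> (x + 0)))"
      "inner u (abs_L2 (partial_deriv i (\<lambda>x. cnj (c * \<phi> (x + 0))))) = Re (c * (\<integral>x. f x * partial_deriv i \<phi> x \<partial>lborel))"
      "inner g (abs_L2 (\<lambda>x. cnj (c * \<phi> (x + 0)))) = Re (c * (\<integral>x. f' x * \<phi> x \<partial>lborel))"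
    if \<phi>: "test_function \<phi>" for \<phi> c
  proof -
    show test: "test_function (\<lambda>x. cnj (c * \<phi> (x + 0)))"
      by (rule test_function_image[OF bounded_linear_cnj_mult \<phi>])
    have "smooth \<phi>"
      using \<phi> by (simp add: test_function_def)
    note eq = partial_deriv_image[OF bounded_linear_cnj_mult this, of i c 0]
    show "inner u (abs_L2 (partial_deriv i (\<lambda>x. cnj (c * \<phi> (x + 0))))) = Re (c * (\<integral>x. f x * partial_deriv i \<phi> x \<partial>lborel))"
      using test_function_square_integrable[OF test_function_partial_deriv[OF test, of i]] f unfolding eq
      by (simp add: inner_abs_L2 mult.left_commute)
    show "inner g (abs_L2 (\<lambda>x. cnj (c * \<phi> (x + 0)))) = Re (c * (\<integral>x. f' x * \<phi> x \<partial>lborel))"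
      using test_function_square_integrable[OF test] f'
      by (simp add: inner_abs_L2 mult.left_commute)
  qed
  show ?thesis
  proof (intro iffI allI impI)
    fix \<phi> :: "real^'a \<Rightarrow> complex"
    assume L: "has_weak_partial i u g" and \<phi>: "test_function \<phi>"
    have \<psi>: "test_function (\<lambda>x. cnj (1 * \<phi> (x + 0)))"
      by (rule conj(1)[OF \<phi>])
    have "(\<lambda>x. cnj (1 * cnj (1 * \<phi> (x + 0 + 0)))) = \<phi>"
      by simp
    then show "inner u (abs_L2 (partial_deriv i \<phi>)) = - inner g (abs_L2 \<phi>)"
      using conj(2,3)[OF \<psi>, of 1] L[unfolded weak, rule_format, OF \<psi>] by simp
  next
    assume R: "\<forall>\<phi>. test_function \<phi> \<longrightarrow> inner u (abs_L2 (partial_deriv i \<phi>)) = - inner g (abs_L2 \<phi>)"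
    have "Re (c * (\<integral>x. f x * partial_deriv i \<phi> x \<partial>lborel)) = - Re (c * (\<integral>x. f' x * \<phi> x \<partial>lborel))"
      if "test_function \<phi>" for \<phi> c
      using R[rule_format, OF conj(1)[OF that, of c]] by (simp only: conj(2,3)[OF that])
    from this[where c=1] this[where c="- \<i>"] show "has_weak_partial i u g"
      unfolding weak by (auto simp: complex_eq_iff)
  qed
qed

section \<open>Weak derivatives as limits of difference quotients\<close>

lemma filterlim_uminus_at_0: "filterlim uminus (at (0::real)) (at 0)"
  by (auto simp: filterlim_at eventually_at_filter intro!: tendsto_eq_intros)

lemma translate_conv_diffq: "translate (axis i h) u = u + h *\<^sub>R diffq i h u"
  by (cases "h = 0") (auto simp: diffq_def)

lemma translate_abs_L2:
  "square_integrable f \<Longrightarrow> translate h (abs_L2 f) = abs_L2 (\<lambda>x. f (x + h))"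
  by (simp add: translate.abs_eq)

text \<open>Since translations are isometries, the vectors with this property form a closed
  subspace. It contains the test functions, whose translate is v + h D v with a convergent
  difference quotient D v.\<close>

lemma tendsto_translate: "((\<lambda>s. translate (axis i s) u) \<longlongrightarrow> u) (at 0)"
proof -
  let ?C = "{u. ((\<lambda>s. translate (axis i s) u) \<longlongrightarrow> u) (at 0)}"
  have "test_L2 \<subseteq> ?C"
  proof
    fix v :: "'a L2" assume "v \<in> test_L2"
    then obtain \<phi> where \<phi>: "test_function \<phi>" "v = abs_L2 \<phi>"
      by (auto simp: test_L2_def)
    have "((\<lambda>h. v + h *\<^sub>R diffq i h v) \<longlongrightarrow> v + 0 *\<^sub>R abs_L2 (partial_deriv i \<phi>)) (at 0)"
      unfolding \<phi>(2) by (intro tendsto_intros diffq_test_function \<phi>)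
    then show "v \<in> ?C"
      by (simp add: translate_conv_diffq)
  qed
  moreover have "subspace ?C"
    by (auto simp: subspace_def translate_add translate_scaleR linear_0[OF linear_translate]
        intro: tendsto_intros)
  ultimately have "span test_L2 \<subseteq> ?C"
    by (rule span_minimal)
  moreover have "closed ?C"
  proof (rule closed_sequential_limits[THEN iffD2], intro allI impI, elim conjE)
    fix v :: "nat \<Rightarrow> 'a L2" and w assume v: "\<forall>n. v n \<in> ?C" and lim: "v \<longlonglongrightarrow> w"
    have "((\<lambda>s. translate (axis i s) w) \<longlongrightarrow> w) (at 0)"
    proof (rule tendstoI)
      fix e :: real assume e: "e > 0"
      then obtain n where n: "dist (v n) w < e / 3"
        using metric_LIMSEQ_D[OF lim, of "e / 3"] by auto
      have "\<forall>\<^sub>F s in at 0. dist (translate (axis i s) (v n)) (v n) < e / 3"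
        using v e by (intro tendstoD) auto
      then show "\<forall>\<^sub>F s in at 0. dist (translate (axis i s) w) w < e"
      proof eventually_elim
        case (elim s)
        have "norm (translate (axis i s) (w - v n)) = norm (v n - w)"
          by (simp add: norm_minus_commute)
        then have "dist (translate (axis i s) w) (translate (axis i s) (v n)) < e / 3"
          using n by (simp add: dist_norm translate_diff)
        with n elim show ?case
          using dist_triangle[of "translate (axis i s) w" w "translate (axis i s) (v n)"]
            dist_triangle[of "translate (axis i s) (v n)" w "v n"] by linarith
      qed
    qed
    then show "w \<in> ?C" by simp
  qed
  ultimately have "closure (span test_L2) \<subseteq> ?C"
    by (rule closure_minimal)
  with span_test_L2_dense[of u] show ?thesis
    by blast
qed

text \<open>For a test function the increment is moved onto it by discrete integration by parts,
  where the quotient converges; the weak derivative is then tested with the function shifted by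
  \<open>- s\<close>. The result is a real function along a line, to which the mean value inequality
  applies.\<close>

lemma DERIV_inner_translate:
  assumes weak: "has_weak_partial i u g" and \<psi>: "\<psi> \<in> span test_L2"
  shows "((\<lambda>s. inner (translate (axis i s) u) \<psi>) has_real_derivative
           inner (translate (axis i s) g) \<psi>) (at s)"
proof -
  let ?C = "{\<psi>. \<forall>s. ((\<lambda>s. inner (translate (axis i s) u) \<psi>) has_real_derivative
           inner (translate (axis i s) g) \<psi>) (at s)}"
  have "test_L2 \<subseteq> ?C"
  proof (intro subsetI CollectI allI)
    fix v :: "'a L2" and s assume "v \<in> test_L2"
    then obtain \<phi> where \<phi>: "test_function \<phi>" "v = abs_L2 \<phi>"
      by (auto simp: test_L2_def)
    let ?\<chi> = "\<lambda>x. \<phi> (x + axis i (- s))"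
    have \<chi>: "test_function ?\<chi>"
      using test_function_image[OF bounded_linear_ident \<phi>(1)] by simp
    have \<chi>': "partial_deriv i ?\<chi> = (\<lambda>x. partial_deriv i \<phi> (x + axis i (- s)))"
      using \<phi>(1) partial_deriv_image[OF bounded_linear_ident, of \<phi> i "axis i (- s)"]
      by (simp add: test_function_def)
    let ?u = "translate (axis i s) u"
    have "((\<lambda>h. - inner ?u (diffq i (- h) v)) \<longlongrightarrow> - inner ?u (abs_L2 (partial_deriv i \<phi>))) (at 0)"
      using filterlim_compose[OF diffq_test_function[OF \<phi>(1)] filterlim_uminus_at_0]
      unfolding \<phi>(2) by (intro tendsto_intros)
    also have "inner ?u (abs_L2 (partial_deriv i \<phi>)) = inner u (abs_L2 (partial_deriv i ?\<chi>))"
      using test_function_square_integrable[OF test_function_partial_deriv[OF \<phi>(1)]]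
      unfolding \<chi>' by (simp add: inner_translate_left translate_abs_L2 axis_minus)
    also have "\<dots> = - inner g (abs_L2 ?\<chi>)"
      using weak \<chi> by (simp add: has_weak_partial_iff_inner)
    also have "inner g (abs_L2 ?\<chi>) = inner (translate (axis i s) g) v"
      using test_function_square_integrable[OF \<phi>(1)] \<phi>(2)
      by (simp add: inner_translate_left translate_abs_L2 axis_minus)
    also have "(\<lambda>h. - inner ?u (diffq i (- h) v))
        = (\<lambda>h. (inner (translate (axis i (s + h)) u) v - inner ?u v) / h)"
    proof
      fix h
      have "axis i (s + h) = axis i h + axis i s"
        by (simp add: axis_def vec_eq_iff)
      then show "- inner ?u (diffq i (- h) v)
          = (inner (translate (axis i (s + h)) u) v - inner ?u v) / h"
        unfolding inner_diffq_left[symmetric]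
        by (simp add: diffq_def translate_translate inner_diff_left divide_inverse mult.commute)
    qed
    finally show "((\<lambda>s. inner (translate (axis i s) u) v) has_real_derivative
           inner (translate (axis i s) g) v) (at s)"
      by (simp add: DERIV_def)
  qed
  moreover have "subspace ?C"
    by (auto simp: subspace_def inner_add_right intro!: derivative_eq_intros)
  ultimately have "span test_L2 \<subseteq> ?C"
    by (rule span_minimal)
  with \<psi> show ?thesis by auto
qed

text \<open>The difference quotient is morally the average of the translates of \<open>g\<close>;
  the mean value inequality for pairings replaces that integral. The choice \<open>w = 0\<close>
  gives the uniform bound by \<open>norm g\<close>, and \<open>w = g\<close> gives
  convergence.\<close>

lemma diffq_bound:
  assumes weak: "has_weak_partial i u g" and h: "h \<noteq> 0"
    and B: "\<And>s. \<bar>s\<bar> \<le> \<bar>h\<bar> \<Longrightarrow> norm (translate (axis i s) g - w) \<le> B"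
  shows "norm (diffq i h u - w) \<le> B"
proof -
  let ?v = "diffq i h u - w"
  have test: "inner ?v \<psi> \<le> B * norm \<psi>" if \<psi>: "\<psi> \<in> span test_L2" for \<psi>
  proof -
    \<comment> \<open>The linear term subtracts \<open>w\<close> from the derivative of the
      pairing.\<close>
    define G where "G s = inner (translate (axis i s) u) \<psi> - s * inner w \<psi>" for s
    have "norm (G h - G 0) \<le> (B * norm \<psi>) * norm (h - 0)"
    proof (rule field_differentiable_bound)
      show "convex {- \<bar>h\<bar>..\<bar>h\<bar>}"
        by (rule convex_real_interval)
      show "(G has_field_derivative inner (translate (axis i s) g - w) \<psi>) (at s within {- \<bar>h\<bar>..\<bar>h\<bar>})" for s
        using DERIV_diff[OF DERIV_inner_translate[OF weak \<psi>, of s]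
            DERIV_cmult_right[OF DERIV_ident[of "at s"], of "inner w \<psi>"]]
        unfolding G_def inner_diff_left by (simp add: has_field_derivative_at_within)
      show "norm (inner (translate (axis i s) g - w) \<psi>) \<le> B * norm \<psi>" if "s \<in> {- \<bar>h\<bar>..\<bar>h\<bar>}" for s
        unfolding real_norm_def using that
        by (intro order_trans[OF Cauchy_Schwarz_ineq2] mult_right_mono B) auto
    qed auto
    moreover have "inner (diffq i h u) \<psi> = (inner (translate (axis i h) u) \<psi> - inner u \<psi>) / h"
      by (simp add: diffq_def inner_diff_left divide_inverse mult.commute)
    then have "G h - G 0 = h * inner ?v \<psi>"
      using h by (simp add: G_def inner_diff_left right_diff_distrib diff_divide_distrib)
    ultimately have "\<bar>h\<bar> * \<bar>inner ?v \<psi>\<bar> \<le> \<bar>h\<bar> * (B * norm \<psi>)"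
      by (simp add: abs_mult mult.commute)
    then show ?thesis
      using h by simp
  qed
  obtain \<psi> where \<psi>: "\<And>n. \<psi> n \<in> span test_L2" "\<psi> \<longlonglongrightarrow> ?v"
    using span_test_L2_dense[of ?v] by (auto simp: closure_sequential)
  \<comment> \<open>By density the bound for pairings may be tested with \<open>?v\<close>
    itself.\<close>
  have "inner ?v ?v \<le> B * norm ?v"
  proof (rule LIMSEQ_le)
    show "(\<lambda>n. inner ?v (\<psi> n)) \<longlonglongrightarrow> inner ?v ?v" "(\<lambda>n. B * norm (\<psi> n)) \<longlonglongrightarrow> B * norm ?v"
      by (intro tendsto_intros \<psi>(2))+
    show "\<exists>N. \<forall>n\<ge>N. inner ?v (\<psi> n) \<le> B * norm (\<psi> n)"
      using test[OF \<psi>(1)] by blast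
  qed
  then have "norm ?v * norm ?v \<le> B * norm ?v"
    by (metis power2_norm_eq_inner power2_eq_square)
  moreover have "0 \<le> B"
    using order_trans[OF norm_ge_zero B[of 0]] by simp
  ultimately show ?thesis
    by (cases "norm ?v = 0") (auto simp: mult_le_cancel_right)
qed

lemma norm_diffq_le:
  assumes "has_weak_partial i u g"
  shows "norm (diffq i h u) \<le> norm g"
  using diffq_bound[OF assms, of h 0 "norm g"] by (cases "h = 0") (auto simp: diffq_def)

lemma tendsto_diffq:
  assumes weak: "has_weak_partial i u g"
  shows "((\<lambda>h. diffq i h u) \<longlongrightarrow> g) (at 0)"
proof (rule tendstoI)
  fix e :: real assume e: "e > 0"
  then have "\<forall>\<^sub>F s in at 0. dist (translate (axis i s) g) g < e / 2"
    by (intro tendstoD[OF tendsto_translate]) simp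
  then obtain d where d: "d > 0" "\<And>s. s \<noteq> 0 \<Longrightarrow> \<bar>s\<bar> < d \<Longrightarrow> dist (translate (axis i s) g) g < e / 2"
    by (auto simp: eventually_at)
  have "\<forall>\<^sub>F h in at (0::real). h \<noteq> 0 \<and> \<bar>h\<bar> < d"
    using d(1) by (auto simp: eventually_at)
  then show "\<forall>\<^sub>F h in at 0. dist (diffq i h u) g < e"
  proof eventually_elim
    case (elim h)
    have "norm (translate (axis i s) g - g) \<le> e / 2" if "\<bar>s\<bar> \<le> \<bar>h\<bar>" for s
      using d(2)[of s] that elim e by (cases "s = 0") (auto simp: dist_norm)
    then have "norm (diffq i h u - g) \<le> e / 2"
      using elim by (intro diffq_bound[OF weak]) auto
    then show ?case
      using e by (simp add: dist_norm)
  qed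
qed

text \<open>One null sequence of steps is enough: discrete integration by parts passes to the limit
  along it. This matters for the noise, where almost sure convergence is first known only along a
  subsequence.\<close>

lemma has_weak_partialI:
  assumes X: "X \<longlonglongrightarrow> 0" "\<And>n. X n \<noteq> 0" and lim: "(\<lambda>n. diffq i (X n) u) \<longlonglongrightarrow> g"
  shows "has_weak_partial i u g"
  unfolding has_weak_partial_iff_inner
proof (intro allI impI)
  fix \<phi> :: "real^'a \<Rightarrow> complex" assume \<phi>: "test_function \<phi>"
  have "filterlim X (at 0) sequentially"
    using X by (auto simp: filterlim_at)
  from filterlim_compose[OF diffq_test_function[OF \<phi>]
      filterlim_compose[OF filterlim_uminus_at_0 this], of i]
  have "(\<lambda>n. - inner u (diffq i (- X n) (abs_L2 \<phi>))) \<longlonglongrightarrow> - inner u (abs_L2 (partial_deriv i \<phi>))"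
    by (intro tendsto_intros)
  moreover have "(\<lambda>n. inner (diffq i (X n) u) (abs_L2 \<phi>)) \<longlonglongrightarrow> inner g (abs_L2 \<phi>)"
    by (intro tendsto_intros lim)
  ultimately have "- inner u (abs_L2 (partial_deriv i \<phi>)) = inner g (abs_L2 \<phi>)"
    unfolding inner_diffq_left by (rule LIMSEQ_unique)
  then show "inner u (abs_L2 (partial_deriv i \<phi>)) = - inner g (abs_L2 \<phi>)"
    by simp
qed

lemma has_weak_partial_iff_tendsto:
  "has_weak_partial i u g \<longleftrightarrow> ((\<lambda>h. diffq i h u) \<longlongrightarrow> g) (at 0)"
proof
  assume lim: "((\<lambda>h. diffq i h u) \<longlongrightarrow> g) (at 0)"
  let ?X = "\<lambda>n. inverse (real (Suc n))"
  have X: "?X \<longlonglongrightarrow> 0" "?X n \<noteq> 0" for n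
    by (rule LIMSEQ_inverse_real_of_nat) simp
  then have "filterlim ?X (at 0) sequentially"
    by (auto simp: filterlim_at)
  from filterlim_compose[OF lim this] show "has_weak_partial i u g"
    by (rule has_weak_partialI[OF X])
qed (rule tendsto_diffq)

lemma has_weak_partial_unique:
  "has_weak_partial i u g \<Longrightarrow> has_weak_partial i u g' \<Longrightarrow> g = g'"
  unfolding has_weak_partial_iff_tendsto by (rule tendsto_unique[rotated]) auto

lemma weak_partial_eqI: "has_weak_partial i u g \<Longrightarrow> weak_partial i u = g"
  unfolding weak_partial_def by (rule the_equality) (auto intro: has_weak_partial_unique)

lemma has_weak_partial_weak_partial:
  assumes "u \<in> H1" shows "has_weak_partial i u (weak_partial i u)"
proof -
  obtain g where "has_weak_partial i u g"
    using assms by (auto simp: H1_def)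
  then show ?thesis
    by (simp add: weak_partial_eqI)
qed

lemma has_weak_partial_H1I: "(\<And>i. has_weak_partial i u (g i)) \<Longrightarrow> u \<in> H1"
  by (auto simp: H1_def)

lemma has_weak_partial_test_function:
  "test_function \<phi> \<Longrightarrow> has_weak_partial i (abs_L2 \<phi>) (abs_L2 (partial_deriv i \<phi>))"
  by (simp add: has_weak_partial_iff_tendsto diffq_test_function)

lemma test_L2_subset_H2: "test_L2 \<subseteq> H2"
proof
  fix v :: "'a L2" assume "v \<in> test_L2"
  then obtain \<phi> where \<phi>: "test_function \<phi>" "v = abs_L2 \<phi>"
    by (auto simp: test_L2_def)
  have "v \<in> H1" if "test_function \<phi>" "v = abs_L2 \<phi>" for \<phi> and v :: "'a L2"
    using has_weak_partial_test_function[OF that(1)] that(2) by (auto simp: H1_def)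
  with \<phi> show "v \<in> H2"
    using weak_partial_eqI[OF has_weak_partial_test_function[OF \<phi>(1)]]
    by (auto simp: H2_def test_function_partial_deriv)
qed

lemma has_weak_partial_add:
  "has_weak_partial i u g \<Longrightarrow> has_weak_partial i v h \<Longrightarrow> has_weak_partial i (u + v) (g + h)"
  unfolding has_weak_partial_iff_tendsto
  by (simp add: linear_simps[OF bounded_linear_diffq] tendsto_add)

lemma has_weak_partial_commute:
  assumes A: "bounded_linear A" and comm: "\<And>h u. A (translate h u) = translate h (A u)"
    and weak: "has_weak_partial i u g"
  shows "has_weak_partial i (A u) (A g)"
proof -
  have "diffq i h (A u) = A (diffq i h u)" for h
    by (simp add: diffq_def linear_simps[OF A] comm)
  then show ?thesis
    using weak bounded_linear.tendsto[OF A] by (simp add: has_weak_partial_iff_tendsto)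
qed

lemma has_weak_partial_scaleC:
  "has_weak_partial i u g \<Longrightarrow> has_weak_partial i (c *\<^sub>C u) (c *\<^sub>C g)"
  by (rule has_weak_partial_commute[OF bounded_linear_scaleC]) (simp_all add: translate_scaleC)

lemma inner_weak_partial:
  assumes "has_weak_partial i u g" "has_weak_partial i v h"
  shows "inner g v = - inner u h"
proof (rule tendsto_unique)
  show "((\<lambda>t. inner (diffq i t u) v) \<longlongrightarrow> inner g v) (at 0)"
    by (intro tendsto_intros tendsto_diffq assms)
  show "((\<lambda>t. inner (diffq i t u) v) \<longlongrightarrow> - inner u h) (at 0)"
    unfolding inner_diffq_left
    by (intro tendsto_intros filterlim_compose[OF tendsto_diffq[OF assms(2)] filterlim_uminus_at_0])
qed simp

section \<open>Translation invariance of the Schroedinger group\<close>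

text \<open>An operator that commutes with translations commutes with difference quotients, hence
  with their limits. Applied to the translations themselves and, once they are known to commute with
  it, to the group \<open>S\<close>.\<close>

lemma has_weak_partial_H2_commute:
  assumes A: "bounded_linear A" and comm: "\<And>h u. A (translate h u) = translate h (A u)"
  shows weak_partial_commute: "u \<in> H1 \<Longrightarrow> weak_partial i (A u) = A (weak_partial i u)"
    and H1_commute: "u \<in> H1 \<Longrightarrow> A u \<in> H1"
    and H2_commute: "u \<in> H2 \<Longrightarrow> A u \<in> H2"
    and laplacian_commute: "u \<in> H2 \<Longrightarrow> laplacian (A u) = A (laplacian u)"
proof -
  have wp: "has_weak_partial i (A u) (A (weak_partial i u))" if "u \<in> H1" for u i
    by (intro has_weak_partial_commute[OF A comm] has_weak_partial_weak_partial that)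
  then show eq: "u \<in> H1 \<Longrightarrow> weak_partial i (A u) = A (weak_partial i u)" for u i
    by (rule weak_partial_eqI)
  show H1: "u \<in> H1 \<Longrightarrow> A u \<in> H1" for u
    using wp by (rule has_weak_partial_H1I)
  show "u \<in> H2 \<Longrightarrow> A u \<in> H2"
    by (auto simp: H2_def H1 eq)
  show "u \<in> H2 \<Longrightarrow> laplacian (A u) = A (laplacian u)"
    by (simp add: H2_def laplacian_def eq linear_sum[OF bounded_linear.linear[OF A]])
qed

section \<open>Unitary groups and uniqueness from the generator\<close>

context
  fixes U :: "real \<Rightarrow> 'n::finite L2 \<Rightarrow> 'n L2"
  assumes U: "unitary_group U"
begin

lemma unitary_group_add: "U s (U t u) = U (s + t) u"
  and unitary_group_0: "U 0 u = u"
  and unitary_group_scaleC: "U t (c *\<^sub>C u) = c *\<^sub>C U t u"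
  using U by (auto simp: unitary_group_def)

lemma linear_unitary_group: "linear (U t)"
proof (rule linearI)
  show "U t (u + v) = U t u + U t v" for u v
    using U by (simp add: unitary_group_def)
  show "U t (r *\<^sub>R u) = r *\<^sub>R U t u" for r u
    using unitary_group_scaleC[of t "complex_of_real r" u] by (simp add: scaleC_of_real)
qed

lemma cinner_unitary_group: "cinner (U t u) (U t v) = cinner u v"
  using U by (simp add: unitary_group_def)

lemma inner_unitary_group: "inner (U t u) (U t v) = inner u v"
  by (metis Re_cinner cinner_unitary_group)

lemma inner_unitary_group_left: "inner (U t u) v = inner u (U (- t) v)"
  using inner_unitary_group[of "- t" "U t u" v] by (simp add: unitary_group_add unitary_group_0)

lemma norm_unitary_group [simp]: "norm (U t u) = norm u"
  by (simp add: norm_eq_sqrt_inner inner_unitary_group)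

lemma bounded_linear_unitary_group: "bounded_linear (U t)"
  using linear_unitary_group[of t]
  by (auto simp: bounded_linear_def bounded_linear_axioms_def intro: exI[of _ 1])

context
  fixes D A
  assumes gen: "group_generator U D A"
begin

lemma generator_invariant:
  assumes u: "u \<in> D"
  shows "U t u \<in> D" "A (U t u) = U t (A u)"
    and generator_vector_derivative: "((\<lambda>t. U t u) has_vector_derivative U t (A u)) (at t)"
proof -
  have "((\<lambda>h. (U h u - u) /\<^sub>R h) \<longlongrightarrow> A u) (at 0)"
    using gen u by (simp add: group_generator_def)
  from bounded_linear.tendsto[OF bounded_linear_unitary_group this, of t]
  have lim: "((\<lambda>h. (U (t + h) u - U t u) /\<^sub>R h) \<longlongrightarrow> U t (A u)) (at 0)"
    by (simp add: linear_simps[OF bounded_linear_unitary_group] unitary_group_add)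
  \<comment> \<open>Read this way, the limit just found is the generator quotient at
    \<open>U t u\<close>; the converse direction in \<open>group_generator\<close> puts this vector
    into \<open>D\<close>.\<close>
  moreover have "U (t + h) u = U h (U t u)" for h
    by (simp add: unitary_group_add add.commute)
  ultimately have "U t u \<in> D \<and> U t (A u) = A (U t u)"
    using gen by (simp add: group_generator_def)
  then show "U t u \<in> D" "A (U t u) = U t (A u)"
    by auto
  have lim_norm: "((\<lambda>h. norm ((U (t + h) u - U t u) /\<^sub>R h - U t (A u))) \<longlongrightarrow> 0) (at 0)"
    using lim by (simp add: tendsto_norm_zero_iff LIM_zero_iff)
  have norm_eq: "norm ((U (t + h) u - U t u) /\<^sub>R h - U t (A u))
      = norm (U (t + h) u - U t u - h *\<^sub>R U t (A u)) / norm h" if "h \<noteq> 0" for h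
  proof -
    have "(U (t + h) u - U t u) /\<^sub>R h - U t (A u) = (U (t + h) u - U t u - h *\<^sub>R U t (A u)) /\<^sub>R h"
      using that by (simp add: scaleR_diff_right)
    then show ?thesis
      by (simp add: divide_inverse mult.commute)
  qed
  have "((\<lambda>h. norm (U (t + h) u - U t u - h *\<^sub>R U t (A u)) / norm h) \<longlongrightarrow> 0) (at 0)"
    by (rule Lim_transform_eventually[OF lim_norm]) (auto simp: eventually_at_filter norm_eq)
  then show "((\<lambda>t. U t u) has_vector_derivative U t (A u)) (at t)"
    by (simp add: has_vector_derivative_def has_derivative_at bounded_linear_scaleR_left)
qed

text \<open>The pairing \<open>inner (U t u) (U t v)\<close> is constant in \<open>t\<close>; the
  product rule at \<open>t = 0\<close> gives the identity.\<close>

lemma generator_skew: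
  assumes "u \<in> D" "v \<in> D"
  shows "inner (A u) v = - inner u (A v)"
proof -
  have "((\<lambda>t. inner (U t u) (U t v)) has_vector_derivative
      inner (U 0 u) (U 0 (A v)) + inner (U 0 (A u)) (U 0 v)) (at 0)"
    by (intro bounded_bilinear.has_vector_derivative[OF bounded_bilinear_inner]
        generator_vector_derivative assms)
  moreover have "((\<lambda>t. inner (U t u) (U t v)) has_vector_derivative 0) (at 0)"
    by (simp add: inner_unitary_group)
  ultimately have "inner (U 0 u) (U 0 (A v)) + inner (U 0 (A u)) (U 0 v) = 0"
    by (rule vector_derivative_unique_at)
  then show ?thesis
    by (simp add: unitary_group_0)
qed

end

end

text \<open>The mixed pairing \<open>inner (U t u) (V t v)\<close> is constant for vectors of the
  common domain, because the common generator is skew. Thus \<open>V (- t) (U t u)\<close> and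
  \<open>u\<close> have the same pairings with a total set.\<close>

lemma unitary_group_unique:
  assumes U: "unitary_group U" and V: "unitary_group V"
    and gU: "group_generator U D A" and gV: "group_generator V D A"
    and total: "\<And>w. (\<And>v. v \<in> D \<Longrightarrow> inner w v = 0) \<Longrightarrow> w = 0"
  shows "U t u = V t u"
proof -
  have const: "inner (U t u) (V t v) = inner u v" if uv: "u \<in> D" "v \<in> D" for t u v
  proof -
    have "((\<lambda>t. inner (U t u) (V t v)) has_vector_derivative 0) (at s)" for s
    proof -
      have "((\<lambda>t. inner (U t u) (V t v)) has_vector_derivative
          inner (U s u) (V s (A v)) + inner (U s (A u)) (V s v)) (at s)"
        by (intro bounded_bilinear.has_vector_derivative[OF bounded_bilinear_inner]
            generator_vector_derivative[OF U gU] generator_vector_derivative[OF V gV] uv)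
      \<comment> \<open>Both vectors stay in \<open>D\<close>, so skewness applies to
        \<open>U s u\<close> and \<open>V s v\<close> and the two terms of the product rule
        cancel.\<close>
      moreover have "inner (U s (A u)) (V s v) = - inner (U s u) (V s (A v))"
        using generator_skew[OF U gU generator_invariant(1)[OF U gU uv(1)]
            generator_invariant(1)[OF V gV uv(2)], of s s]
        by (simp add: generator_invariant(2)[OF U gU uv(1)] generator_invariant(2)[OF V gV uv(2)])
      ultimately show ?thesis by simp
    qed
    then have "inner (U t u) (V t v) = inner (U 0 u) (V 0 v)"
      by (intro DERIV_isconst_all)
        (auto simp: has_real_derivative_iff_has_vector_derivative)
    then show ?thesis
      by (simp add: unitary_group_0[OF U] unitary_group_0[OF V])
  qed
  have eq: "U t u = V t u" if u: "u \<in> D" for t u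
  proof -
    have "V (- t) (U t u) - u = 0"
    proof (rule total)
      fix v assume v: "v \<in> D"
      show "inner (V (- t) (U t u) - u) v = 0"
        using const[OF u v, of t] by (simp add: inner_diff_left inner_unitary_group_left[OF V])
    qed
    then have "V t (V (- t) (U t u)) = V t u"
      by simp
    then show ?thesis
      by (simp add: unitary_group_add[OF V] unitary_group_0[OF V])
  qed
  \<comment> \<open>For a general \<open>u\<close> the groups are moved onto the test vector in
    \<open>D\<close>, where they are already known to agree.\<close>
  have "U t u - V t u = 0"
  proof (rule total)
    fix v assume "v \<in> D"
    then show "inner (U t u - V t u) v = 0"
      by (simp add: inner_diff_left inner_unitary_group_left[OF U] inner_unitary_group_left[OF V] eq)
  qed
  then show ?thesis by simp
qed

lemma schrodinger_translate:
  assumes S: "schrodinger_group S"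
  shows "S t (translate h u) = translate h (S t u)"
proof -
  note uS = S[unfolded schrodinger_group_def, THEN conjunct1]
  note gS = S[unfolded schrodinger_group_def, THEN conjunct2]
  let ?A = "\<lambda>u. (- \<i>) *\<^sub>C laplacian u"
  define U where "U t u = translate (- h) (S t (translate h u))" for t u
  have uU: "unitary_group U"
    unfolding unitary_group_def
  proof (intro conjI allI)
    show "continuous_on UNIV (\<lambda>t. U t u)" for u
      unfolding U_def using uS
      by (intro bounded_linear.continuous_on[OF bounded_linear_translate]) (simp add: unitary_group_def)
  qed (simp_all add: U_def translate_add translate_scaleC translate_translate cinner_translate
      linear_add[OF linear_unitary_group[OF uS]] unitary_group_scaleC[OF uS] cinner_unitary_group[OF uS]
      unitary_group_0[OF uS] unitary_group_add[OF uS])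
  \<comment> \<open>\<open>group_generator\<close> fixes the domain exactly, so invariance of
    \<open>H2\<close> is required in both directions; the inverse translation provides the
    second.\<close>
  have H2_iff: "translate h u \<in> H2 \<longleftrightarrow> u \<in> H2" for u :: "'a L2" and h
    using H2_commute[OF bounded_linear_translate, of h u]
      H2_commute[OF bounded_linear_translate, of "- h" "translate h u"]
    by (auto simp: translate_translate add.commute)
  have lap: "?A (translate h u) = translate h (?A u)" if "u \<in> H2" for u :: "'a L2"
    using laplacian_commute[OF bounded_linear_translate, of h u] that
    by (simp add: translate_translate add.commute translate_scaleC)
  have gU: "group_generator U H2 ?A"
    unfolding group_generator_def
  proof (intro allI)
    fix u v
    have eq: "(U t u - u) /\<^sub>R t = translate (- h) ((S t (translate h u) - translate h u) /\<^sub>R t)" for t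
      by (simp add: U_def translate_diff translate_scaleR translate_translate)
    have "((\<lambda>t. (U t u - u) /\<^sub>R t) \<longlongrightarrow> v) (at 0) \<longleftrightarrow>
        ((\<lambda>t. (S t (translate h u) - translate h u) /\<^sub>R t) \<longlongrightarrow> translate h v) (at 0)"
    proof
      assume "((\<lambda>t. (U t u - u) /\<^sub>R t) \<longlongrightarrow> v) (at 0)"
      from bounded_linear.tendsto[OF bounded_linear_translate this, of h]
      show "((\<lambda>t. (S t (translate h u) - translate h u) /\<^sub>R t) \<longlongrightarrow> translate h v) (at 0)"
        by (simp add: eq translate_translate)
    next
      assume "((\<lambda>t. (S t (translate h u) - translate h u) /\<^sub>R t) \<longlongrightarrow> translate h v) (at 0)"
      from bounded_linear.tendsto[OF bounded_linear_translate this, of "- h"]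
      show "((\<lambda>t. (U t u - u) /\<^sub>R t) \<longlongrightarrow> v) (at 0)"
        by (simp add: eq translate_translate)
    qed
    also have "\<dots> \<longleftrightarrow> translate h u \<in> H2 \<and> translate h v = ?A (translate h u)"
      using gS by (simp add: group_generator_def)
    also have "\<dots> \<longleftrightarrow> u \<in> H2 \<and> v = ?A u"
    proof -
      have "translate h v = translate h w \<longleftrightarrow> v = w" for w
        by (metis translate_translate translate_0 add.left_inverse)
      then show ?thesis
        using H2_iff[of h u] lap[of u] by metis
    qed
    finally show "((\<lambda>t. (U t u - u) /\<^sub>R t) \<longlongrightarrow> v) (at 0) \<longleftrightarrow> u \<in> H2 \<and> v = ?A u" .
  qed
  have "S t u = U t u"
    by (rule unitary_group_unique[OF uS uU gS gU]) (use test_L2_subset_H2 test_L2_total in blast)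
  then have "translate h (S t u) = translate h (U t u)"
    by simp
  then show ?thesis
    by (simp add: U_def translate_translate)
qed

section \<open>Weak measurability and independence\<close>

text \<open>Tested against fixed vectors, measurability passes to sums and to operators with an
  adjoint without considering pairs of random vectors; norms and inner products are recovered from
  countably many coordinates by Parseval's identity.\<close>

definition weakly_measurable :: "'w measure \<Rightarrow> ('w \<Rightarrow> 'n::finite L2) \<Rightarrow> bool" where
  "weakly_measurable M X \<longleftrightarrow> (\<forall>h. (\<lambda>\<omega>. inner (X \<omega>) h) \<in> borel_measurable M)"

lemma weakly_measurableD [measurable_dest]:
  "weakly_measurable M X \<Longrightarrow> (\<lambda>\<omega>. inner (X \<omega>) h) \<in> borel_measurable M"
  by (simp add: weakly_measurable_def)

lemma weakly_measurable_borel: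
  assumes "X \<in> borel_measurable M" shows "weakly_measurable M X"
  unfolding weakly_measurable_def
  by (intro allI borel_measurable_continuous_on[OF _ assms] continuous_intros)

lemma weakly_measurable_subalgebra:
  "subalgebra M G \<Longrightarrow> weakly_measurable G X \<Longrightarrow> weakly_measurable M X"
  unfolding weakly_measurable_def by (auto intro: measurable_from_subalg)

lemma weakly_measurable_add:
  "weakly_measurable M X \<Longrightarrow> weakly_measurable M Y \<Longrightarrow> weakly_measurable M (\<lambda>\<omega>. X \<omega> + Y \<omega>)"
  by (auto simp: weakly_measurable_def inner_add_left intro!: borel_measurable_add)

lemma weakly_measurable_diff:
  "weakly_measurable M X \<Longrightarrow> weakly_measurable M Y \<Longrightarrow> weakly_measurable M (\<lambda>\<omega>. X \<omega> - Y \<omega>)"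
  by (auto simp: weakly_measurable_def inner_diff_left intro!: borel_measurable_diff)

lemma weakly_measurable_scale:
  assumes [measurable]: "f \<in> borel_measurable M" and "weakly_measurable M X"
  shows "weakly_measurable M (\<lambda>\<omega>. f \<omega> *\<^sub>R X \<omega>)"
  using assms by (auto simp: weakly_measurable_def intro!: borel_measurable_times)

lemma weakly_measurable_adjoint:
  assumes "weakly_measurable M X" "\<And>u v. inner (A u) v = inner u (B v)"
  shows "weakly_measurable M (\<lambda>\<omega>. A (X \<omega>))"
  using assms unfolding weakly_measurable_def by simp

lemma weakly_measurable_diffq:
  "weakly_measurable M X \<Longrightarrow> weakly_measurable M (\<lambda>\<omega>. diffq i h (X \<omega>))"
  unfolding weakly_measurable_def by (simp add: inner_diffq_left)

lemma weakly_measurable_scaleC: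
  "weakly_measurable M X \<Longrightarrow> weakly_measurable M (\<lambda>\<omega>. c *\<^sub>C X \<omega>)"
  by (erule weakly_measurable_adjoint) (rule inner_scaleC_left)

lemma scaleC_0 [simp]: "0 *\<^sub>C u = 0"
  using scaleC_of_real[of 0 u] by simp

lemma filterlim_inverse_Suc: "filterlim (\<lambda>n. inverse (real (Suc n))) (at 0) sequentially"
  using LIMSEQ_inverse_real_of_nat by (auto simp: filterlim_at)

context L2_form
begin

text \<open>With \<i> for the Hermitian and 0 for the real pairing, Parseval's identity takes one
  real form, in which all coordinates are values of \<open>inner\<close>.\<close>

definition J :: complex where
  "J = (if ip = cinner then \<i> else 0)"

lemma Im_ip: "Im (ip u v) = inner u (J *\<^sub>C v)"
  using ip_cases by (auto simp: J_def Im_cinner rinner_def)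

context
  fixes e :: "nat \<Rightarrow> 'n L2"
  assumes e: "orthonormal_basis ip e"
begin

lemma parseval_inner_real:
  "(\<lambda>j. inner u (e j) * inner v (e j) + inner u (J *\<^sub>C e j) * inner v (J *\<^sub>C e j)) sums inner u v"
  using parseval_inner[OF e, of u v] by (simp add: Im_ip)

lemma borel_measurable_inner_weak:
  fixes X Y :: "'w \<Rightarrow> 'n L2"
  assumes [measurable]: "weakly_measurable M X" "weakly_measurable M Y"
  shows "(\<lambda>\<omega>. inner (X \<omega>) (Y \<omega>)) \<in> borel_measurable M"
proof -
  have "(\<lambda>\<omega>. inner (X \<omega>) (Y \<omega>)) = (\<lambda>\<omega>. \<Sum>j. inner (X \<omega>) (e j) * inner (Y \<omega>) (e j)
      + inner (X \<omega>) (J *\<^sub>C e j) * inner (Y \<omega>) (J *\<^sub>C e j))"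
    by (intro ext sums_unique parseval_inner_real)
  then show ?thesis by simp
qed

lemma borel_measurable_norm_weak:
  fixes X :: "'w \<Rightarrow> 'n L2"
  assumes "weakly_measurable M X"
  shows "(\<lambda>\<omega>. norm (X \<omega>)) \<in> borel_measurable M"
  using borel_measurable_inner_weak[OF assms assms] by (simp add: norm_eq_sqrt_inner)

text \<open>
  Where no weak derivative exists, \<open>weak_partial\<close> takes one fixed junk value, because \<open>THE\<close> is applied
  to the same empty predicate; so no completeness of the measure is needed.
\<close>

lemma weakly_measurable_weak_partial:
  fixes X :: "'w \<Rightarrow> 'n L2"
  assumes X: "weakly_measurable M X"
  shows "weakly_measurable M (\<lambda>\<omega>. weak_partial i (X \<omega>))"
  unfolding weakly_measurable_def
proof
  fix h
  let ?D = "\<lambda>n \<omega>. diffq i (inverse (real (Suc n))) (X \<omega>)"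
  note D = weakly_measurable_diffq[OF X]
  \<comment> \<open>The Cauchy property with countable quantifiers, hence a measurable condition; by
    completeness it means that the weak derivative exists.\<close>
  let ?C = "\<lambda>\<omega>. \<forall>k. \<exists>N. \<forall>m\<ge>N. \<forall>n\<ge>N. norm (?D m \<omega> - ?D n \<omega>) < inverse (real (Suc k))"
  have [measurable]: "(\<lambda>\<omega>. norm (?D m \<omega> - ?D n \<omega>)) \<in> borel_measurable M" for m n
    by (intro borel_measurable_norm_weak weakly_measurable_diff D)
  have [measurable]: "(\<lambda>\<omega>. inner (?D n \<omega>) h) \<in> borel_measurable M" for n
    using D by (simp add: weakly_measurable_def)
  define c :: "'n L2" where "c = (THE g. False)"
  have "inner (weak_partial i (X \<omega>)) h
      = (if ?C \<omega> then lim (\<lambda>n. inner (?D n \<omega>) h) else inner c h)" for \<omega>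
  proof -
    have lim0: "(\<lambda>n. inverse (real (Suc n))) \<longlonglongrightarrow> 0"
      by (rule LIMSEQ_inverse_real_of_nat)
    have "?C \<omega> \<longleftrightarrow> Cauchy (\<lambda>n. ?D n \<omega>)"
    proof
      assume C: "?C \<omega>"
      show "Cauchy (\<lambda>n. ?D n \<omega>)"
        unfolding Cauchy_def dist_norm using C reals_Archimedean by (meson less_trans)
    next
      assume C: "Cauchy (\<lambda>n. ?D n \<omega>)"
      show "?C \<omega>"
        using CauchyD[OF C, of "inverse (real (Suc _))"] by simp
    qed
    also have "\<dots> \<longleftrightarrow> (\<exists>g. has_weak_partial i (X \<omega>) g)"
    proof
      assume "Cauchy (\<lambda>n. ?D n \<omega>)"
      then obtain g where "(\<lambda>n. ?D n \<omega>) \<longlonglongrightarrow> g"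
        by (auto simp: Cauchy_convergent_iff convergent_def)
      then show "\<exists>g. has_weak_partial i (X \<omega>) g"
        using has_weak_partialI[OF lim0] by auto
    next
      assume "\<exists>g. has_weak_partial i (X \<omega>) g"
      then obtain g where g: "has_weak_partial i (X \<omega>) g" ..
      have "(\<lambda>n. ?D n \<omega>) \<longlonglongrightarrow> g"
        by (rule filterlim_compose[OF tendsto_diffq[OF g] filterlim_inverse_Suc])
      then show "Cauchy (\<lambda>n. ?D n \<omega>)"
        by (rule LIMSEQ_imp_Cauchy)
    qed
    finally have iff: "?C \<omega> \<longleftrightarrow> (\<exists>g. has_weak_partial i (X \<omega>) g)" .
    show ?thesis
    proof (cases "\<exists>g. has_weak_partial i (X \<omega>) g")
      case True
      then obtain g where g: "has_weak_partial i (X \<omega>) g" ..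
      have "(\<lambda>n. ?D n \<omega>) \<longlonglongrightarrow> g"
        by (rule filterlim_compose[OF tendsto_diffq[OF g] filterlim_inverse_Suc])
      then have "(\<lambda>n. inner (?D n \<omega>) h) \<longlonglongrightarrow> inner g h"
        by (intro tendsto_intros)
      then show ?thesis
        using iff True by (simp add: weak_partial_eqI[OF g] limI)
    next
      case False
      then have c: "weak_partial i (X \<omega>) = c"
        by (simp add: weak_partial_def c_def)
      have "\<not> ?C \<omega>"
        using False by (subst iff)
      from if_not_P[OF this] show ?thesis
        by (subst c) (rule sym)
    qed
  qed
  then have eq: "(\<lambda>\<omega>. inner (weak_partial i (X \<omega>)) h)
      = (\<lambda>\<omega>. if ?C \<omega> then lim (\<lambda>n. inner (?D n \<omega>) h) else inner c h)"
    by (rule ext)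
  show "(\<lambda>\<omega>. inner (weak_partial i (X \<omega>)) h) \<in> borel_measurable M"
    unfolding eq by measurable
qed

lemma parseval_ennreal: "(\<Sum>j. ennreal ((cmod (ip u (e j)))\<^sup>2)) = ennreal ((norm u)\<^sup>2)"
  by (rule suminf_ennreal_eq[OF _ parseval[OF e]]) simp

text \<open>Cauchy-Schwarz in the coordinates followed by Bessel's inequality. The bound is uniform
  in \<open>N\<close> and so dominates the partial sums of the expansion of an expected inner
  product.\<close>

lemma bessel_inner:
  "\<bar>\<Sum>j<N. inner u (e j) * inner v (e j) + inner u (J *\<^sub>C e j) * inner v (J *\<^sub>C e j)\<bar> \<le> norm u * norm v"
proof -
  have bessel: "L2_set (\<lambda>j. cmod (ip u (e j))) {..<N} \<le> norm u" for u
  proof -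
    have "(\<Sum>j<N. (cmod (ip u (e j)))\<^sup>2) \<le> (norm u)\<^sup>2"
      using sum_le_suminf[OF sums_summable[OF parseval[OF e]], of "{..<N}" u]
        sums_unique[OF parseval[OF e, of u]] by simp
    then show ?thesis
      by (simp add: L2_set_def real_le_lsqrt)
  qed
  have "\<bar>\<Sum>j<N. inner u (e j) * inner v (e j) + inner u (J *\<^sub>C e j) * inner v (J *\<^sub>C e j)\<bar>
      = \<bar>\<Sum>j<N. Re (ip u (e j) * cnj (ip v (e j)))\<bar>"
    by (simp add: Im_ip)
  also have "\<dots> \<le> (\<Sum>j<N. \<bar>cmod (ip u (e j))\<bar> * \<bar>cmod (ip v (e j))\<bar>)"
    by (rule order_trans[OF sum_abs], intro sum_mono)
      (rule order_trans[OF abs_Re_le_cmod], simp add: norm_mult)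
  also have "\<dots> \<le> L2_set (\<lambda>j. cmod (ip u (e j))) {..<N} * L2_set (\<lambda>j. cmod (ip v (e j))) {..<N}"
    by (rule L2_set_mult_ineq)
  also have "\<dots> \<le> norm u * norm v"
    by (intro mult_mono bessel) auto
  finally show ?thesis .
qed

text \<open>
  The expectation is computed coordinatewise, because Borel measurability of sums and pairs of
  random variables is not available without separability of \<open>'n L2\<close>.
\<close>

lemma indep_inner_integral_zero:
  fixes X Y :: "'w \<Rightarrow> 'n L2"
  assumes "prob_space M"
    and G: "subalgebra M G" and H: "subalgebra M H"
    and indep: "prob_space.indep_set M (sets G) (sets H)"
    and X: "weakly_measurable G X" and Y: "weakly_measurable H Y"
    and intX: "integrable M (\<lambda>\<omega>. norm (X \<omega>))" and intY: "integrable M (\<lambda>\<omega>. norm (Y \<omega>))"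
    and mean: "\<And>h. (\<integral>\<omega>. inner (Y \<omega>) h \<partial>M) = 0"
  shows "integrable M (\<lambda>\<omega>. inner (X \<omega>) (Y \<omega>))" "(\<integral>\<omega>. inner (X \<omega>) (Y \<omega>) \<partial>M) = 0"
proof -
  interpret prob_space M by fact
  note XM = weakly_measurable_subalgebra[OF G X] and YM = weakly_measurable_subalgebra[OF H Y]
  note [measurable] = weakly_measurableD[OF XM] weakly_measurableD[OF YM]
    borel_measurable_norm_weak[OF XM] borel_measurable_norm_weak[OF YM]
    borel_measurable_inner_weak[OF XM YM]
  have indep_var: "indep_var borel f borel g"
    if "f \<in> borel_measurable G" "g \<in> borel_measurable H" for f g :: "_ \<Rightarrow> real"
  proof -
    have sub: "{f -` A \<inter> space M |A. A \<in> sets borel} \<subseteq> sets G"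
        "{g -` A \<inter> space M |A. A \<in> sets borel} \<subseteq> sets H"
      using that G H by (auto simp: subalgebra_def dest: measurable_sets)
    have "sigma_sets (space M) {f -` A \<inter> space M |A. A \<in> sets borel} \<subseteq> sets G"
        "sigma_sets (space M) {g -` A \<inter> space M |A. A \<in> sets borel} \<subseteq> sets H"
      using sets.sigma_sets_subset[OF sub(1)] sets.sigma_sets_subset[OF sub(2)] G H
      by (simp_all add: subalgebra_def)
    then have "indep_set (sigma_sets (space M) {f -` A \<inter> space M |A. A \<in> sets borel})
        (sigma_sets (space M) {g -` A \<inter> space M |A. A \<in> sets borel})"
      using indep unfolding indep_sets2_eq by blast
    then show ?thesis
      using measurable_from_subalg[OF G that(1)] measurable_from_subalg[OF H that(2)]
      by (simp add: indep_var_eq)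
  qed
  \<comment> \<open>The two norms are independent real random variables, so first moments of
    \<open>X\<close> and \<open>Y\<close> suffice for an integrable majorant.\<close>
  have prod: "integrable M (\<lambda>\<omega>. norm (X \<omega>) * norm (Y \<omega>))"
    by (intro indep_var_integrable indep_var intX intY borel_measurable_norm_weak X Y)
  have int_inner: "integrable M (\<lambda>\<omega>. inner (Z \<omega>) h)"
    if "weakly_measurable M Z" "integrable M (\<lambda>\<omega>. norm (Z \<omega>))" for Z and h :: "'n L2"
    by (rule Bochner_Integration.integrable_bound[OF integrable_mult_left[OF that(2), of "norm h"]])
      (use that(1) Cauchy_Schwarz_ineq2 in \<open>auto simp: weakly_measurable_def\<close>)
  have coord: "integrable M (\<lambda>\<omega>. inner (X \<omega>) h * inner (Y \<omega>) h)"
      "(\<integral>\<omega>. inner (X \<omega>) h * inner (Y \<omega>) h \<partial>M) = 0" for h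
  proof -
    have iv: "indep_var borel (\<lambda>\<omega>. inner (X \<omega>) h) borel (\<lambda>\<omega>. inner (Y \<omega>) h)"
      using X Y by (intro indep_var) (auto simp: weakly_measurable_def)
    show "integrable M (\<lambda>\<omega>. inner (X \<omega>) h * inner (Y \<omega>) h)"
      by (rule indep_var_integrable[OF iv int_inner[OF XM intX] int_inner[OF YM intY]])
    show "(\<integral>\<omega>. inner (X \<omega>) h * inner (Y \<omega>) h \<partial>M) = 0"
      using indep_var_lebesgue_integral[OF iv int_inner[OF XM intX] int_inner[OF YM intY]]
      by (simp add: mean)
  qed
  show int: "integrable M (\<lambda>\<omega>. inner (X \<omega>) (Y \<omega>))"
    by (rule Bochner_Integration.integrable_bound[OF prod]) (auto intro: Cauchy_Schwarz_ineq2)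
  have "(\<lambda>N. \<integral>\<omega>. (\<Sum>j<N. inner (X \<omega>) (e j) * inner (Y \<omega>) (e j)
      + inner (X \<omega>) (J *\<^sub>C e j) * inner (Y \<omega>) (J *\<^sub>C e j)) \<partial>M) \<longlonglongrightarrow> (\<integral>\<omega>. inner (X \<omega>) (Y \<omega>) \<partial>M)"
  proof (rule integral_dominated_convergence[OF _ _ prod])
    show "AE \<omega> in M. (\<lambda>N. \<Sum>j<N. inner (X \<omega>) (e j) * inner (Y \<omega>) (e j)
      + inner (X \<omega>) (J *\<^sub>C e j) * inner (Y \<omega>) (J *\<^sub>C e j)) \<longlonglongrightarrow> inner (X \<omega>) (Y \<omega>)"
      using parseval_inner_real by (simp add: sums_def)
    show "AE \<omega> in M. norm (\<Sum>j<N. inner (X \<omega>) (e j) * inner (Y \<omega>) (e j)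
      + inner (X \<omega>) (J *\<^sub>C e j) * inner (Y \<omega>) (J *\<^sub>C e j)) \<le> norm (X \<omega>) * norm (Y \<omega>)" for N
      using bessel_inner by simp
  qed measurable
  then show "(\<integral>\<omega>. inner (X \<omega>) (Y \<omega>) \<partial>M) = 0"
    by (simp add: coord LIMSEQ_const_iff Bochner_Integration.integral_add[OF coord(1) coord(1)])
qed

end

end

section \<open>Second moments of a Wiener increment\<close>

lemma suminf_ennreal_swap:
  fixes f :: "nat \<Rightarrow> nat \<Rightarrow> ennreal"
  shows "(\<Sum>i. \<Sum>j. f i j) = (\<Sum>j. \<Sum>i. f i j)"
  using nn_integral_suminf[of "\<lambda>j i. f i j" "count_space (UNIV :: nat set)"]
  by (simp add: nn_integral_count_space_nat)

lemma tendsto_suminf_dominated: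
  fixes a :: "nat \<Rightarrow> nat \<Rightarrow> real"
  assumes "\<And>l. (\<lambda>n. a l n) \<longlonglongrightarrow> b l" "\<And>l n. \<bar>a l n\<bar> \<le> C l" "summable C"
  shows "(\<lambda>n. \<Sum>l. a l n) \<longlonglongrightarrow> (\<Sum>l. b l)"
proof -
  have "\<forall>\<^sub>F (l, n) in sequentially \<times>\<^sub>F sequentially. norm (a l n) \<le> C l"
    by (rule always_eventually) (use assms(2) in auto)
  from tannerys_theorem[OF assms(1) this assms(3)] show ?thesis by simp
qed

lemma norm_add_power2_le:
  fixes u v :: "'a::real_normed_vector"
  shows "(norm (u + v))\<^sup>2 \<le> 2 * (norm u)\<^sup>2 + 2 * (norm v)\<^sup>2"
proof -
  have "(norm (u + v))\<^sup>2 \<le> (norm u + norm v)\<^sup>2"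
    by (intro power_mono norm_triangle_ineq) auto
  also have "\<dots> \<le> 2 * (norm u)\<^sup>2 + 2 * (norm v)\<^sup>2"
    using zero_le_power2[of "norm u - norm v"] by (simp add: power2_eq_square algebra_simps)
  finally show ?thesis .
qed

lemma norm_diff_power2_le:
  fixes u v :: "'a::real_normed_vector"
  shows "(norm (u - v))\<^sup>2 \<le> 2 * (norm u)\<^sup>2 + 2 * (norm v)\<^sup>2"
  using norm_add_power2_le[of u "- v"] by simp

context L2_form
begin

lemma ip_add_right: "ip u (v + w) = ip u v + ip u w"
  by (subst (1 2 3) ip_commute) (simp add: ip_add_left)

lemma ip_diff_right: "ip u (v - w) = ip u v - ip u w"
  by (subst (1 2 3) ip_commute) (simp add: ip_diff_left)

lemma ip_diffq_left: "ip (diffq i h u) v = ip u (- diffq i (- h) v)"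
  using ip_cases by (auto simp: rinner_def cinner_diffq_left inner_diffq_left)

end

text \<open>One increment of the noise over a time \<tau>, seen only through its mean and
  covariance; independence of the past enters later, for the cross term.\<close>

locale covariance_increment = prob_space M + L2_form ip
  for M :: "'w measure" and ip :: "'n::finite L2 \<Rightarrow> 'n L2 \<Rightarrow> complex" +
  fixes e :: "nat \<Rightarrow> 'n L2" and Q R :: "'n L2 \<Rightarrow> 'n L2" and \<Delta> :: "'w \<Rightarrow> 'n L2" and \<tau> :: real
  assumes e: "orthonormal_basis ip e"
    and R: "is_op_sqrt ip Q R"
    and R_HS: "hilbert_schmidt_H1 e R"
    and \<tau>: "0 \<le> \<tau>"
    and \<Delta>_borel [measurable]: "\<Delta> \<in> borel_measurable M"
    and \<Delta>_square: "integrable M (\<lambda>\<omega>. (norm (\<Delta> \<omega>))\<^sup>2)"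
    and \<Delta>_mean: "\<And>h. (\<integral>\<omega>. inner (\<Delta> \<omega>) h \<partial>M) = 0"
    and \<Delta>_cov: "\<And>a b. (\<integral>\<omega>. ip (\<Delta> \<omega>) a * cnj (ip (\<Delta> \<omega>) b) \<partial>M) = complex_of_real \<tau> * ip (Q b) a"
begin

lemma ip_R: "ip (R u) v = ip u (R v)"
  using R by (simp add: is_op_sqrt_def nonneg_selfadjoint_def)

lemma weakly_measurable_increment: "weakly_measurable M \<Delta>"
  by (rule weakly_measurable_borel) measurable

lemma nn_integral_ip_increment:
  "(\<integral>\<^sup>+\<omega>. ennreal ((cmod (ip (\<Delta> \<omega>) a))\<^sup>2) \<partial>M) = ennreal (\<tau> * (norm (R a))\<^sup>2)"
proof -
  have [measurable]: "(\<lambda>\<omega>. ip (\<Delta> \<omega>) a) \<in> borel_measurable M"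
    by (rule borel_measurable_continuous_on[OF linear_continuous_on[OF bounded_linear_ip] \<Delta>_borel])
  have int: "integrable M (\<lambda>\<omega>. (cmod (ip (\<Delta> \<omega>) a))\<^sup>2)"
  proof (rule Bochner_Integration.integrable_bound[OF integrable_mult_left[OF \<Delta>_square, of "(norm a)\<^sup>2"]])
    have "(cmod (ip u a))\<^sup>2 \<le> (norm u)\<^sup>2 * (norm a)\<^sup>2" for u
      unfolding power_mult_distrib[symmetric] by (intro power_mono cmod_ip_le) auto
    then show "AE \<omega> in M. norm ((cmod (ip (\<Delta> \<omega>) a))\<^sup>2) \<le> norm ((norm (\<Delta> \<omega>))\<^sup>2 * (norm a)\<^sup>2)"
      by simp
  qed measurable
  have "complex_of_real (\<integral>\<omega>. (cmod (ip (\<Delta> \<omega>) a))\<^sup>2 \<partial>M) = (\<integral>\<omega>. ip (\<Delta> \<omega>) a * cnj (ip (\<Delta> \<omega>) a) \<partial>M)"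
    by (simp only: complex_norm_square[symmetric] integral_complex_of_real)
  also have "\<dots> = complex_of_real \<tau> * ip (R (R a)) a"
    using R by (simp add: \<Delta>_cov is_op_sqrt_def)
  also have "ip (R (R a)) a = ip (R a) (R a)"
    by (rule ip_R)
  also have "complex_of_real \<tau> * ip (R a) (R a) = complex_of_real (\<tau> * (norm (R a))\<^sup>2)"
    by (simp add: ip_self)
  finally show ?thesis
    using int by (subst nn_integral_eq_integral) (simp_all only: of_real_eq_iff zero_le_power2 AE_I2)
qed

text \<open>The trace of the covariance of A \<Delta>, computed twice: Parseval turns the norm into
  coordinates tested with \<open>B (e j)\<close>, and a second expansion of
  \<open>R (B (e j))\<close> with exchanged sums moves the operators onto \<open>R (e l)\<close>.
  Working in \<open>ennreal\<close> includes the infinite case.\<close>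

lemma nn_integral_op_increment:
  assumes adj: "\<And>u v. ip (A u) v = ip u (B v)"
  shows "(\<integral>\<^sup>+\<omega>. ennreal ((norm (A (\<Delta> \<omega>)))\<^sup>2) \<partial>M) = (\<Sum>l. ennreal (\<tau> * (norm (A (R (e l))))\<^sup>2))"
proof -
  have [measurable]: "(\<lambda>\<omega>. ip (\<Delta> \<omega>) a) \<in> borel_measurable M" for a
    by (rule borel_measurable_continuous_on[OF linear_continuous_on[OF bounded_linear_ip] \<Delta>_borel])
  have swap: "cmod (ip (R (B (e j))) (e l)) = cmod (ip (A (R (e l))) (e j))" for j l
  proof -
    have "ip (R (B (e j))) (e l) = ip (B (e j)) (R (e l))"
      by (rule ip_R)
    also have "\<dots> = cnj (ip (A (R (e l))) (e j))"
      unfolding adj by (rule ip_commute)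
    finally show ?thesis by simp
  qed
  have "(\<integral>\<^sup>+\<omega>. ennreal ((norm (A (\<Delta> \<omega>)))\<^sup>2) \<partial>M)
      = (\<integral>\<^sup>+\<omega>. (\<Sum>j. ennreal ((cmod (ip (\<Delta> \<omega>) (B (e j))))\<^sup>2)) \<partial>M)"
    by (simp add: parseval_ennreal[OF e, symmetric] adj)
  also have "\<dots> = (\<Sum>j. \<integral>\<^sup>+\<omega>. ennreal ((cmod (ip (\<Delta> \<omega>) (B (e j))))\<^sup>2) \<partial>M)"
    by (rule nn_integral_suminf) measurable
  also have "\<dots> = (\<Sum>j. ennreal \<tau> * ennreal ((norm (R (B (e j))))\<^sup>2))"
    using \<tau> by (simp add: nn_integral_ip_increment ennreal_mult)
  also have "\<dots> = (\<Sum>j. \<Sum>l. ennreal \<tau> * ennreal ((cmod (ip (A (R (e l))) (e j)))\<^sup>2))"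
    by (simp add: parseval_ennreal[OF e, symmetric] ennreal_suminf_cmult swap)
  also have "\<dots> = (\<Sum>l. \<Sum>j. ennreal \<tau> * ennreal ((cmod (ip (A (R (e l))) (e j)))\<^sup>2))"
    by (rule suminf_ennreal_swap)
  also have "\<dots> = (\<Sum>l. ennreal (\<tau> * (norm (A (R (e l))))\<^sup>2))"
    using \<tau> by (simp add: ennreal_suminf_cmult parseval_ennreal[OF e] ennreal_mult)
  finally show ?thesis .
qed

lemma has_weak_partial_R: "has_weak_partial i (R u) (weak_partial i (R u))"
  using R_HS by (intro has_weak_partial_weak_partial) (simp add: hilbert_schmidt_H1_def)

lemma H1_norm_power2: "(H1_norm u)\<^sup>2 = (norm u)\<^sup>2 + (\<Sum>i\<in>UNIV. (norm (weak_partial i u))\<^sup>2)"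
  unfolding H1_norm_def by (intro real_sqrt_pow2 add_nonneg_nonneg sum_nonneg) auto

lemma summable_R: "summable (\<lambda>l. (norm (R (e l)))\<^sup>2)"
  and summable_weak_partial_R: "summable (\<lambda>l. (norm (weak_partial i (R (e l))))\<^sup>2)"
proof -
  have sm: "summable (\<lambda>l. (H1_norm (R (e l)))\<^sup>2)"
    using R_HS by (simp add: hilbert_schmidt_H1_def)
  have "(norm u)\<^sup>2 \<le> (H1_norm u)\<^sup>2" "(norm (weak_partial i u))\<^sup>2 \<le> (H1_norm u)\<^sup>2" for u :: "'n L2" and i
  proof -
    show "(norm u)\<^sup>2 \<le> (H1_norm u)\<^sup>2"
      unfolding H1_norm_power2 by (simp add: sum_nonneg)
    have "(norm (weak_partial i u))\<^sup>2 \<le> (\<Sum>i\<in>UNIV. (norm (weak_partial i u))\<^sup>2)"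
      by (intro member_le_sum) auto
    then show "(norm (weak_partial i u))\<^sup>2 \<le> (H1_norm u)\<^sup>2"
      unfolding H1_norm_power2 by (simp add: add_increasing)
  qed
  then show "summable (\<lambda>l. (norm (R (e l)))\<^sup>2)" "summable (\<lambda>l. (norm (weak_partial i (R (e l))))\<^sup>2)"
    by (auto intro!: summable_comparison_test'[OF sm])
qed

abbreviation D :: "'n \<Rightarrow> nat \<Rightarrow> 'n L2 \<Rightarrow> 'n L2" where
  "D i n \<equiv> diffq i (inverse (real (Suc n)))"

lemma tendsto_D: "has_weak_partial i u g \<Longrightarrow> (\<lambda>n. D i n u) \<longlonglongrightarrow> g"
  by (rule filterlim_compose[OF tendsto_diffq filterlim_inverse_Suc])

text \<open>The quotients of \<Delta> are Cauchy in mean square because those of the vectors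
  \<open>R (e l)\<close> converge in a summably dominated way. A subsequence is then almost surely
  Cauchy in \<open>L2\<close>, and its limit is the weak derivative.\<close>

lemma AE_has_weak_partial: "AE \<omega> in M. has_weak_partial i (\<Delta> \<omega>) (weak_partial i (\<Delta> \<omega>))"
proof -
  let ?g = "\<lambda>l. weak_partial i (R (e l))"
  \<comment> \<open>Squared Hilbert-Schmidt distance between the n-th quotient of \<open>R\<close>
    and its weak derivative.\<close>
  define c where "c n = (\<Sum>l. (norm (D i n (R (e l)) - ?g l))\<^sup>2)" for n
  \<comment> \<open>The 4 is 2 + 2: the quotient is at most \<open>?g l\<close> in norm, and the
    square of a difference is at most twice the sum of the squares.\<close>
  have bd: "\<bar>(norm (D i n (R (e l)) - ?g l))\<^sup>2\<bar> \<le> 4 * (norm (?g l))\<^sup>2" for l n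
  proof -
    have "(norm (D i n (R (e l))))\<^sup>2 \<le> (norm (?g l))\<^sup>2"
      by (intro power_mono norm_diffq_le[OF has_weak_partial_R] norm_ge_zero)
    then show ?thesis
      using norm_diff_power2_le[of "D i n (R (e l))" "?g l"] unfolding abs_power2 by linarith
  qed
  note sm = summable_comparison_test'[OF summable_mult[OF summable_weak_partial_R[of i], of 4], of 0]
  have smc: "summable (\<lambda>l. (norm (D i n (R (e l)) - ?g l))\<^sup>2)" for n
    by (rule sm) (use bd in simp)
  have "c \<longlonglongrightarrow> (\<Sum>l. 0)"
    unfolding c_def[abs_def]
  proof (rule tendsto_suminf_dominated[OF _ bd summable_mult[OF summable_weak_partial_R]])
    fix l
    have "(\<lambda>n. D i n (R (e l)) - ?g l) \<longlonglongrightarrow> 0"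
      using tendsto_D[OF has_weak_partial_R] by (simp add: LIM_zero_iff)
    from tendsto_power[OF tendsto_norm_zero[OF this], of 2]
    show "(\<lambda>n. (norm (D i n (R (e l)) - ?g l))\<^sup>2) \<longlonglongrightarrow> 0"
      by simp
  qed
  then have c0: "c \<longlonglongrightarrow> 0" by simp
  have nn: "(\<integral>\<^sup>+\<omega>. ennreal ((norm (D i m (\<Delta> \<omega>) - D i n (\<Delta> \<omega>)))\<^sup>2) \<partial>M)
      \<le> ennreal (\<tau> * (2 * c m + 2 * c n))" for m n
  proof -
    have "(\<integral>\<^sup>+\<omega>. ennreal ((norm (D i m (\<Delta> \<omega>) - D i n (\<Delta> \<omega>)))\<^sup>2) \<partial>M)
        = (\<Sum>l. ennreal (\<tau> * (norm (D i m (R (e l)) - D i n (R (e l))))\<^sup>2))"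
      by (rule nn_integral_op_increment[where A="\<lambda>u. D i m u - D i n u"
            and B="\<lambda>v. - diffq i (- inverse (real (Suc m))) v - - diffq i (- inverse (real (Suc n))) v"])
        (simp only: ip_diff_left ip_diff_right ip_diffq_left)
    also have "\<dots> \<le> (\<Sum>l. ennreal (\<tau> * (2 * (norm (D i m (R (e l)) - ?g l))\<^sup>2 + 2 * (norm (D i n (R (e l)) - ?g l))\<^sup>2)))"
    proof (intro suminf_le summableI ennreal_leI mult_left_mono \<tau>)
      fix l
      show "(norm (D i m (R (e l)) - D i n (R (e l))))\<^sup>2
          \<le> 2 * (norm (D i m (R (e l)) - ?g l))\<^sup>2 + 2 * (norm (D i n (R (e l)) - ?g l))\<^sup>2"
        using norm_diff_power2_le[of "D i m (R (e l)) - ?g l" "D i n (R (e l)) - ?g l"] by simp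
    qed
    also have "\<dots> = ennreal (\<tau> * (2 * c m + 2 * c n))"
      unfolding c_def using \<tau>
      by (intro suminf_ennreal_eq sums_mult sums_add summable_sums smc) auto
    finally show ?thesis .
  qed
  obtain r :: "nat \<Rightarrow> nat" where r: "strict_mono r" "AE \<omega> in M. Cauchy (\<lambda>n. D i (r n) (\<Delta> \<omega>))"
  proof (rule Cauchy_subseq_AE[of "\<lambda>n \<omega>. D i n (\<Delta> \<omega>)" M])
    show "(\<lambda>\<omega>. norm (D i l (\<Delta> \<omega>) - D i m (\<Delta> \<omega>))) \<in> borel_measurable M" for l m
      by (intro borel_measurable_norm_weak[OF e] weakly_measurable_diff weakly_measurable_diffq
          weakly_measurable_increment)
    fix \<epsilon> :: real assume \<epsilon>: "\<epsilon> > 0"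
    \<comment> \<open>The 4 covers 2 c m + 2 c n, and \<tau> + 1 avoids a division by zero when
      \<tau> = 0.\<close>
    define \<delta> where "\<delta> = \<epsilon> / (4 * (\<tau> + 1))"
    have \<delta>: "\<delta> > 0" "4 * \<tau> * \<delta> \<le> \<epsilon>"
      using \<epsilon> \<tau> by (auto simp: \<delta>_def field_simps)
    obtain N where N: "\<And>n. n \<ge> N \<Longrightarrow> c n < \<delta>"
      using order_tendstoD(2)[OF c0 \<delta>(1)] by (auto simp: eventually_sequentially)
    have "\<tau> * (2 * c m + 2 * c n) \<le> \<epsilon>" if "m \<ge> N" "n \<ge> N" for m n
    proof -
      have "\<tau> * (2 * c m + 2 * c n) \<le> \<tau> * (4 * \<delta>)"
        using N[OF that(1)] N[OF that(2)] \<tau> by (intro mult_left_mono) auto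
      with \<delta>(2) show ?thesis by simp
    qed
    then show "\<exists>N. \<forall>l\<ge>N. \<forall>m\<ge>N. (\<integral>\<^sup>+\<omega>. ennreal ((norm (D i l (\<Delta> \<omega>) - D i m (\<Delta> \<omega>)))\<^sup>2) \<partial>M) \<le> ennreal \<epsilon>"
      by (intro exI[of _ N] allI impI order_trans[OF nn] ennreal_leI)
  qed
  from r(2) show ?thesis
  proof eventually_elim
    case (elim \<omega>)
    then obtain g where g: "(\<lambda>n. D i (r n) (\<Delta> \<omega>)) \<longlonglongrightarrow> g"
      by (auto simp: Cauchy_convergent_iff convergent_def)
    have "(\<lambda>n. inverse (real (Suc (r n)))) \<longlonglongrightarrow> 0"
      using LIMSEQ_subseq_LIMSEQ[OF LIMSEQ_inverse_real_of_nat r(1)] by (simp add: comp_def)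
    from has_weak_partialI[OF this _ g] have "has_weak_partial i (\<Delta> \<omega>) g"
      by simp
    then show ?case
      by (simp add: weak_partial_eqI)
  qed
qed

lemma AE_increment_H1: "AE \<omega> in M. \<Delta> \<omega> \<in> H1"
proof -
  have "AE \<omega> in M. \<forall>i. has_weak_partial i (\<Delta> \<omega>) (weak_partial i (\<Delta> \<omega>))"
    by (intro eventually_all_finite AE_has_weak_partial)
  then show ?thesis
    by eventually_elim (auto simp: H1_def)
qed

section \<open>Moments of the weak derivative of an increment and its momentum\<close>

lemma borel_measurable_norm_increment [measurable]:
  "(\<lambda>\<omega>. norm (\<Delta> \<omega>)) \<in> borel_measurable M"
  "(\<lambda>\<omega>. norm (D i n (\<Delta> \<omega>))) \<in> borel_measurable M"
  "(\<lambda>\<omega>. norm (D i n (\<Delta> \<omega>) + c *\<^sub>C \<Delta> \<omega>)) \<in> borel_measurable M"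
  "(\<lambda>\<omega>. norm (weak_partial i (\<Delta> \<omega>))) \<in> borel_measurable M"
  "(\<lambda>\<omega>. norm (weak_partial i (\<Delta> \<omega>) + c *\<^sub>C \<Delta> \<omega>)) \<in> borel_measurable M"
  by (intro borel_measurable_norm_weak[OF e] weakly_measurable_add weakly_measurable_diffq
      weakly_measurable_scaleC weakly_measurable_weak_partial[OF e] weakly_measurable_increment)+

text \<open>Fatou along the quotients, whose second moments are bounded uniformly through the
  derivatives of the vectors \<open>R (e l)\<close>.\<close>

lemma integrable_weak_partial_increment: "integrable M (\<lambda>\<omega>. (norm (weak_partial i (\<Delta> \<omega>)))\<^sup>2)"
proof (rule integrableI_nonneg)
  let ?g = "\<lambda>l. weak_partial i (R (e l))"
  have "(\<integral>\<^sup>+\<omega>. ennreal ((norm (weak_partial i (\<Delta> \<omega>)))\<^sup>2) \<partial>M)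
      = (\<integral>\<^sup>+\<omega>. liminf (\<lambda>n. ennreal ((norm (D i n (\<Delta> \<omega>)))\<^sup>2)) \<partial>M)"
    using AE_has_weak_partial[of i]
    by (intro nn_integral_cong_AE, eventually_elim)
      (intro lim_imp_Liminf[symmetric] tendsto_intros tendsto_D, auto)
  also have "\<dots> \<le> liminf (\<lambda>n. \<integral>\<^sup>+\<omega>. ennreal ((norm (D i n (\<Delta> \<omega>)))\<^sup>2) \<partial>M)"
    by (rule nn_integral_liminf) measurable
  also have "\<dots> \<le> ennreal (\<tau> * (\<Sum>l. (norm (?g l))\<^sup>2))"
  proof (intro Liminf_le always_eventually allI)
    fix n
    have "(\<integral>\<^sup>+\<omega>. ennreal ((norm (D i n (\<Delta> \<omega>)))\<^sup>2) \<partial>M) = (\<Sum>l. ennreal (\<tau> * (norm (D i n (R (e l))))\<^sup>2))"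
      by (rule nn_integral_op_increment[OF ip_diffq_left])
    also have "\<dots> \<le> (\<Sum>l. ennreal (\<tau> * (norm (?g l))\<^sup>2))"
      by (intro suminf_le summableI ennreal_leI mult_left_mono power_mono
          norm_diffq_le[OF has_weak_partial_R] \<tau> norm_ge_zero)
    also have "\<dots> = ennreal (\<tau> * (\<Sum>l. (norm (?g l))\<^sup>2))"
      using \<tau> by (intro suminf_ennreal_eq sums_mult summable_sums summable_weak_partial_R) auto
    finally show "(\<integral>\<^sup>+\<omega>. ennreal ((norm (D i n (\<Delta> \<omega>)))\<^sup>2) \<partial>M) \<le> ennreal (\<tau> * (\<Sum>l. (norm (?g l))\<^sup>2))" .
  qed simp
  also have "\<dots> < \<infinity>" by simp
  finally show "(\<integral>\<^sup>+\<omega>. ennreal ((norm (weak_partial i (\<Delta> \<omega>)))\<^sup>2) \<partial>M) < \<infinity>" .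
qed auto

text \<open>The moment formula holds for \<open>D i n\<close> plus the scalar \<open>c\<close>,
  which has an adjoint; both sides pass to the limit by dominated convergence. The values c = \<i>
  and c = - \<i> are those required for polarization.\<close>

lemma integral_weak_partial_increment:
  shows "integrable M (\<lambda>\<omega>. (norm (weak_partial i (\<Delta> \<omega>) + c *\<^sub>C \<Delta> \<omega>))\<^sup>2)"
    and "summable (\<lambda>l. (norm (weak_partial i (R (e l)) + c *\<^sub>C R (e l)))\<^sup>2)"
    and "(\<integral>\<omega>. (norm (weak_partial i (\<Delta> \<omega>) + c *\<^sub>C \<Delta> \<omega>))\<^sup>2 \<partial>M)
      = \<tau> * (\<Sum>l. (norm (weak_partial i (R (e l)) + c *\<^sub>C R (e l)))\<^sup>2)"
proof -
  let ?g = "\<lambda>l. weak_partial i (R (e l))"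
  \<comment> \<open>One majorant for both limits: it is used for \<Delta> under the expectation and
    for \<open>R (e l)\<close> under the sum.\<close>
  define w where "w g u = 2 * (norm g)\<^sup>2 + 2 * (cmod c)\<^sup>2 * (norm u)\<^sup>2" for g u :: "'n L2"
  have w: "(norm (v + c *\<^sub>C u))\<^sup>2 \<le> w g u" if "norm v \<le> norm g" for v g u
  proof -
    have "(norm v)\<^sup>2 \<le> (norm g)\<^sup>2"
      using that by (rule power_mono) simp
    then show ?thesis
      using norm_add_power2_le[of v "c *\<^sub>C u"] unfolding w_def norm_scaleC power_mult_distrib by linarith
  qed
  have int_w: "integrable M (\<lambda>\<omega>. w (weak_partial i (\<Delta> \<omega>)) (\<Delta> \<omega>))"
    unfolding w_def by (intro Bochner_Integration.integrable_add integrable_mult_right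
        integrable_weak_partial_increment \<Delta>_square)
  have sm_w: "summable (\<lambda>l. w (?g l) (R (e l)))"
    unfolding w_def by (intro summable_add summable_mult summable_weak_partial_R summable_R)
  show int: "integrable M (\<lambda>\<omega>. (norm (weak_partial i (\<Delta> \<omega>) + c *\<^sub>C \<Delta> \<omega>))\<^sup>2)"
    by (rule Bochner_Integration.integrable_bound[OF int_w]) (auto intro!: AE_I2 order_trans[OF w])
  have "summable (\<lambda>l. (norm (v l + c *\<^sub>C R (e l)))\<^sup>2)" if "\<And>l. norm (v l) \<le> norm (?g l)" for v
    by (rule summable_comparison_test'[OF sm_w]) (use w[OF that] in auto)
  note sm = this
  show "summable (\<lambda>l. (norm (?g l + c *\<^sub>C R (e l)))\<^sup>2)"
    by (rule sm) simp
  have D_le: "norm (D i n (R (e l))) \<le> norm (?g l)" for n l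
    by (rule norm_diffq_le[OF has_weak_partial_R])
  have intD: "(\<integral>\<omega>. (norm (D i n (\<Delta> \<omega>) + c *\<^sub>C \<Delta> \<omega>))\<^sup>2 \<partial>M)
      = \<tau> * (\<Sum>l. (norm (D i n (R (e l)) + c *\<^sub>C R (e l)))\<^sup>2)" for n
  proof -
    have "(\<integral>\<^sup>+\<omega>. ennreal ((norm (D i n (\<Delta> \<omega>) + c *\<^sub>C \<Delta> \<omega>))\<^sup>2) \<partial>M)
        = (\<Sum>l. ennreal (\<tau> * (norm (D i n (R (e l)) + c *\<^sub>C R (e l)))\<^sup>2))"
      by (rule nn_integral_op_increment[where A="\<lambda>u. D i n u + c *\<^sub>C u"
            and B="\<lambda>v. - diffq i (- inverse (real (Suc n))) v + cnj c *\<^sub>C v"])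
        (simp only: ip_add_left ip_add_right ip_diffq_left ip_scaleC_adjoint)
    also have "\<dots> = ennreal (\<tau> * (\<Sum>l. (norm (D i n (R (e l)) + c *\<^sub>C R (e l)))\<^sup>2))"
      using \<tau> by (intro suminf_ennreal_eq sums_mult summable_sums sm D_le) auto
    finally have *: "(\<integral>\<^sup>+\<omega>. ennreal ((norm (D i n (\<Delta> \<omega>) + c *\<^sub>C \<Delta> \<omega>))\<^sup>2) \<partial>M)
        = ennreal (\<tau> * (\<Sum>l. (norm (D i n (R (e l)) + c *\<^sub>C R (e l)))\<^sup>2))" .
    have "0 \<le> \<tau> * (\<Sum>l. (norm (D i n (R (e l)) + c *\<^sub>C R (e l)))\<^sup>2)"
      using \<tau> by (intro mult_nonneg_nonneg suminf_nonneg sm D_le) auto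
    then have "enn2real (\<integral>\<^sup>+\<omega>. ennreal ((norm (D i n (\<Delta> \<omega>) + c *\<^sub>C \<Delta> \<omega>))\<^sup>2) \<partial>M)
        = \<tau> * (\<Sum>l. (norm (D i n (R (e l)) + c *\<^sub>C R (e l)))\<^sup>2)"
      unfolding * by (rule enn2real_ennreal)
    moreover have "(\<integral>\<omega>. (norm (D i n (\<Delta> \<omega>) + c *\<^sub>C \<Delta> \<omega>))\<^sup>2 \<partial>M)
        = enn2real (\<integral>\<^sup>+\<omega>. ennreal ((norm (D i n (\<Delta> \<omega>) + c *\<^sub>C \<Delta> \<omega>))\<^sup>2) \<partial>M)"
      by (rule integral_eq_nn_integral)
        (intro borel_measurable_power borel_measurable_norm_increment(3), simp)
    ultimately show ?thesis
      by (rule trans[rotated])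
  qed
  have "(\<lambda>n. \<integral>\<omega>. (norm (D i n (\<Delta> \<omega>) + c *\<^sub>C \<Delta> \<omega>))\<^sup>2 \<partial>M)
      \<longlonglongrightarrow> (\<integral>\<omega>. (norm (weak_partial i (\<Delta> \<omega>) + c *\<^sub>C \<Delta> \<omega>))\<^sup>2 \<partial>M)"
  proof (rule integral_dominated_convergence[OF _ _ int_w])
    show "AE \<omega> in M. (\<lambda>n. (norm (D i n (\<Delta> \<omega>) + c *\<^sub>C \<Delta> \<omega>))\<^sup>2)
        \<longlonglongrightarrow> (norm (weak_partial i (\<Delta> \<omega>) + c *\<^sub>C \<Delta> \<omega>))\<^sup>2"
      using AE_has_weak_partial[of i] by eventually_elim (intro tendsto_intros tendsto_D)
    show "AE \<omega> in M. norm ((norm (D i n (\<Delta> \<omega>) + c *\<^sub>C \<Delta> \<omega>))\<^sup>2) \<le> w (weak_partial i (\<Delta> \<omega>)) (\<Delta> \<omega>)" for n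
      using AE_has_weak_partial[of i]
      by eventually_elim (simp add: w norm_diffq_le)
  qed measurable
  moreover have "(\<lambda>n. \<tau> * (\<Sum>l. (norm (D i n (R (e l)) + c *\<^sub>C R (e l)))\<^sup>2))
      \<longlonglongrightarrow> \<tau> * (\<Sum>l. (norm (?g l + c *\<^sub>C R (e l)))\<^sup>2)"
  proof (intro tendsto_mult tendsto_const tendsto_suminf_dominated[OF _ _ sm_w])
    show "(\<lambda>n. (norm (D i n (R (e l)) + c *\<^sub>C R (e l)))\<^sup>2) \<longlonglongrightarrow> (norm (?g l + c *\<^sub>C R (e l)))\<^sup>2" for l
      by (intro tendsto_intros tendsto_D has_weak_partial_R)
    show "\<bar>(norm (D i n (R (e l)) + c *\<^sub>C R (e l)))\<^sup>2\<bar> \<le> w (?g l) (R (e l))" for l n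
      using w[OF D_le] by simp
  qed
  ultimately show "(\<integral>\<omega>. (norm (weak_partial i (\<Delta> \<omega>) + c *\<^sub>C \<Delta> \<omega>))\<^sup>2 \<partial>M)
      = \<tau> * (\<Sum>l. (norm (?g l + c *\<^sub>C R (e l)))\<^sup>2)"
    unfolding intD by (rule LIMSEQ_unique)
qed

text \<open>A signed quantity becomes a difference of two squared norms, each of which has a known
  expectation.\<close>

lemma Im_cinner_polarization:
  "Im (cinner u v) = ((norm (v + (- \<i>) *\<^sub>C u))\<^sup>2 - (norm (v + \<i> *\<^sub>C u))\<^sup>2) / 4"
proof -
  have "inner v (\<i> *\<^sub>C u) = - Im (cinner u v)"
    using arg_cong[OF cinner_commute[of v u], of Im] by (simp add: Im_cinner)
  moreover have "(norm (v + w))\<^sup>2 = (norm v)\<^sup>2 + 2 * inner v w + (norm w)\<^sup>2" for w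
    by (simp add: power2_norm_eq_inner inner_add_left inner_add_right inner_commute)
  moreover have "inner v ((- \<i>) *\<^sub>C u) = - inner v (\<i> *\<^sub>C u)"
    by (simp add: scaleC_minus_left)
  ultimately show ?thesis
    by (simp only: norm_scaleC) simp
qed

lemma integral_momentum_increment:
  shows "integrable M (\<lambda>\<omega>. Im (cinner (\<Delta> \<omega>) (weak_partial i (\<Delta> \<omega>))))"
    and "(\<integral>\<omega>. Im (cinner (\<Delta> \<omega>) (weak_partial i (\<Delta> \<omega>))) \<partial>M)
      = \<tau> * Im (hs_inner_L2 e R (\<lambda>f. weak_partial i (R f)))"
proof -
  note I = integral_weak_partial_increment[of i]
  show "integrable M (\<lambda>\<omega>. Im (cinner (\<Delta> \<omega>) (weak_partial i (\<Delta> \<omega>))))"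
    unfolding Im_cinner_polarization by (intro integrable_divide Bochner_Integration.integrable_diff I)
  have "(\<integral>\<omega>. Im (cinner (\<Delta> \<omega>) (weak_partial i (\<Delta> \<omega>))) \<partial>M)
      = \<tau> * (\<Sum>l. Im (cinner (R (e l)) (weak_partial i (R (e l)))))"
    unfolding Im_cinner_polarization
    by (simp only: integral_divide_zero Bochner_Integration.integral_diff[OF I(1) I(1)] I(3)
        suminf_divide[OF summable_diff[OF I(2) I(2)]] suminf_diff[OF I(2) I(2), symmetric])
      (simp add: right_diff_distrib)
  \<comment> \<open>\<open>hs_inner_L2\<close> is a complex series; its convergence is what allows
    \<open>Im\<close> to pass through the sum.\<close>
  also have "summable (\<lambda>l. cinner (R (e l)) (weak_partial i (R (e l))))"
  proof (rule summable_comparison_test'[OF summable_add[OF summable_R summable_weak_partial_R]])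
    fix l :: nat
    let ?u = "R (e l)" and ?v = "weak_partial i (R (e l))"
    have "norm ?u * norm ?v \<le> (norm ?u)\<^sup>2 + (norm ?v)\<^sup>2"
      using sum_squares_bound[of "norm ?u" "norm ?v"] mult_nonneg_nonneg[OF norm_ge_zero norm_ge_zero, of ?u ?v]
      by linarith
    then show "norm (cinner ?u ?v) \<le> (norm ?u)\<^sup>2 + (norm ?v)\<^sup>2"
      using cmod_cinner_le[of ?u ?v] by linarith
  qed
  from bounded_linear.suminf[OF bounded_linear_Im this]
  have "(\<Sum>l. Im (cinner (R (e l)) (weak_partial i (R (e l)))))
      = Im (hs_inner_L2 e R (\<lambda>f. weak_partial i (R f)))"
    by (simp add: hs_inner_L2_def)
  finally show "(\<integral>\<omega>. Im (cinner (\<Delta> \<omega>) (weak_partial i (\<Delta> \<omega>))) \<partial>M)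
      = \<tau> * Im (hs_inner_L2 e R (\<lambda>f. weak_partial i (R f)))" .
qed

lemma integrable_norm_of_square:
  assumes "integrable M (\<lambda>\<omega>. (f \<omega>)\<^sup>2)" "f \<in> borel_measurable M"
  shows "integrable M (f :: 'w \<Rightarrow> real)"
proof (rule Bochner_Integration.integrable_bound[OF Bochner_Integration.integrable_add[OF assms(1) integrable_const[of 1]]])
  have "\<bar>t\<bar> \<le> t\<^sup>2 + 1" for t :: real
    using zero_le_power2[of "\<bar>t\<bar> - 1/2"] by (simp add: power2_diff power_divide)
  then show "AE \<omega> in M. norm (f \<omega>) \<le> norm ((f \<omega>)\<^sup>2 + 1)"
    by (intro AE_I2) (simp add: abs_of_nonneg)
qed fact

lemma integrable_norm_increment: "integrable M (\<lambda>\<omega>. norm (\<Delta> \<omega>))"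
  by (rule integrable_norm_of_square[OF \<Delta>_square]) measurable

lemma integrable_norm_weak_partial: "integrable M (\<lambda>\<omega>. norm (weak_partial i (\<Delta> \<omega>)))"
  by (rule integrable_norm_of_square[OF integrable_weak_partial_increment]) measurable

lemma weak_partial_increment_mean: "(\<integral>\<omega>. inner (weak_partial i (\<Delta> \<omega>)) h \<partial>M) = 0"
proof -
  have "(\<lambda>n. \<integral>\<omega>. inner (D i n (\<Delta> \<omega>)) h \<partial>M) \<longlonglongrightarrow> (\<integral>\<omega>. inner (weak_partial i (\<Delta> \<omega>)) h \<partial>M)"
  proof (rule integral_dominated_convergence[OF _ _ integrable_mult_left[OF integrable_norm_weak_partial[of i], of "norm h"]])
    show "(\<lambda>\<omega>. inner (weak_partial i (\<Delta> \<omega>)) h) \<in> borel_measurable M"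
      by (intro weakly_measurableD weakly_measurable_weak_partial[OF e] weakly_measurable_increment)
    show "(\<lambda>\<omega>. inner (D i n (\<Delta> \<omega>)) h) \<in> borel_measurable M" for n
      by (intro weakly_measurableD weakly_measurable_diffq weakly_measurable_increment)
    show "AE \<omega> in M. (\<lambda>n. inner (D i n (\<Delta> \<omega>)) h) \<longlonglongrightarrow> inner (weak_partial i (\<Delta> \<omega>)) h"
      using AE_has_weak_partial[of i] by eventually_elim (intro tendsto_intros tendsto_D)
    show "AE \<omega> in M. norm (inner (D i n (\<Delta> \<omega>)) h) \<le> norm (weak_partial i (\<Delta> \<omega>)) * norm h" for n
      using AE_has_weak_partial[of i]
    proof eventually_elim
      case (elim \<omega>)
      show ?case
        unfolding real_norm_def
        by (rule order_trans[OF Cauchy_Schwarz_ineq2]) (intro mult_right_mono norm_diffq_le[OF elim] norm_ge_zero)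
    qed
  qed
  \<comment> \<open>The adjoint moves the quotient onto the fixed vector \<open>h\<close>, where the
    mean of \<Delta> is known.\<close>
  moreover have "(\<integral>\<omega>. inner (D i n (\<Delta> \<omega>)) h \<partial>M) = 0" for n
    by (simp only: inner_diffq_left integral_minus \<Delta>_mean)
  ultimately show ?thesis
    by (simp add: LIMSEQ_const_iff)
qed

text \<open>The cross term of one step. The weak derivative of \<Delta> is measurable for the
  sigma-algebra generated by \<Delta> alone, so it inherits the independence from
  \<open>G\<close>.\<close>

lemma integral_inner_weak_partial_increment:
  assumes G: "subalgebra M G"
    and indep: "indep_set (sets G) {\<Delta> -` B \<inter> space M |B. B \<in> sets borel}"
    and X: "weakly_measurable G X" "integrable M (\<lambda>\<omega>. norm (X \<omega>))"
  shows "integrable M (\<lambda>\<omega>. inner (X \<omega>) (weak_partial i (\<Delta> \<omega>)))"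
    and "(\<integral>\<omega>. inner (X \<omega>) (weak_partial i (\<Delta> \<omega>)) \<partial>M) = 0"
proof -
  let ?H = "vimage_algebra (space M) \<Delta> borel"
  have H_eq: "sets ?H = {\<Delta> -` B \<inter> space M |B. B \<in> sets borel}"
    by (rule sets_vimage_algebra2) auto
  have H: "subalgebra M ?H"
    using measurable_sets[OF \<Delta>_borel] unfolding subalgebra_def H_eq by auto
  have "weakly_measurable ?H (\<lambda>\<omega>. weak_partial i (\<Delta> \<omega>))"
    by (intro weakly_measurable_weak_partial[OF e] weakly_measurable_borel measurable_vimage_algebra1) auto
  note * = indep_inner_integral_zero[OF e prob_space_axioms G H indep[folded H_eq] X(1) this X(2)
      integrable_norm_weak_partial weak_partial_increment_mean]
  from * show "integrable M (\<lambda>\<omega>. inner (X \<omega>) (weak_partial i (\<Delta> \<omega>)))"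
    "(\<integral>\<omega>. inner (X \<omega>) (weak_partial i (\<Delta> \<omega>)) \<partial>M) = 0" by auto
qed

end

section \<open>Evolution of the momentum\<close>

lemma momentum_form_eq: "momentum_form u v = cinner u v - cinner v u"
proof transfer
  fix f g :: "real^'a \<Rightarrow> complex"
  assume "L2_rel f f" "L2_rel g g"
  then have "integrable lborel (\<lambda>x. f x * cnj (g x))" "integrable lborel (\<lambda>x. g x * cnj (f x))"
    by (simp_all add: square_integrable_prod)
  then show "(\<integral>x. (f x * cnj (g x) - cnj (f x) * g x) \<partial>lborel)
      = (\<integral>x. f x * cnj (g x) \<partial>lborel) - (\<integral>x. g x * cnj (f x) \<partial>lborel)"
    by (simp add: mult.commute[of "cnj _"])
qed

definition momentum_density :: "'n::finite \<Rightarrow> 'n L2 \<Rightarrow> real" where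
  "momentum_density i u = Im (cinner u (weak_partial i u))"

text \<open>For z = <u, \<partial>u> the component is \<i> (z - cnj z) = - 2 Im z; this is the
  origin of the factor - 2 in the drift of the momentum.\<close>

lemma momentum_nth: "momentum u $ i = complex_of_real (- 2 * momentum_density i u)"
  using cinner_commute[of "weak_partial i u" u]
  by (simp add: momentum_def momentum_form_eq momentum_density_def complex_eq_iff)

lemma momentum_expansion: "momentum u = (\<Sum>i\<in>UNIV. (- 2 * momentum_density i u) *\<^sub>R axis i (1 :: complex))"
proof -
  have "(a *\<^sub>R axis j (1 :: complex)) $ i = (if j = i then complex_of_real a else 0)" for a and i j :: 'a
    by (simp add: axis_def of_real_def)
  then show ?thesis
    by (simp only: vec_eq_iff momentum_nth sum_component sum.delta[OF finite] UNIV_I if_True) simp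
qed

lemma weak_partial_zero: "has_weak_partial i 0 0"
  by (simp add: has_weak_partial_iff_tendsto linear_simps[OF bounded_linear_diffq])

lemma H1_0: "0 \<in> H1"
  using weak_partial_zero by (rule has_weak_partial_H1I)

lemma H1_add: "u \<in> H1 \<Longrightarrow> v \<in> H1 \<Longrightarrow> u + v \<in> H1"
  by (rule has_weak_partial_H1I[of _ "\<lambda>i. weak_partial i u + weak_partial i v"])
    (intro has_weak_partial_add has_weak_partial_weak_partial)

lemma H1_scaleC: "u \<in> H1 \<Longrightarrow> c *\<^sub>C u \<in> H1"
  by (rule has_weak_partial_H1I, rule has_weak_partial_scaleC, rule has_weak_partial_weak_partial)

lemma weak_partial_add:
  "u \<in> H1 \<Longrightarrow> v \<in> H1 \<Longrightarrow> weak_partial i (u + v) = weak_partial i u + weak_partial i v"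
  by (intro weak_partial_eqI has_weak_partial_add has_weak_partial_weak_partial)

lemma weak_partial_scaleC: "u \<in> H1 \<Longrightarrow> weak_partial i (c *\<^sub>C u) = c *\<^sub>C weak_partial i u"
  by (intro weak_partial_eqI has_weak_partial_scaleC has_weak_partial_weak_partial)

text \<open>Symmetry of the operator \<i> \<partial>: the sign from integration by parts cancels
  against the conjugation of \<i>. It doubles the cross term in the momentum of a sum.\<close>

lemma Im_cinner_weak_partial_symmetric:
  assumes "u \<in> H1" "v \<in> H1"
  shows "Im (cinner v (weak_partial i u)) = Im (cinner u (weak_partial i v))"
proof -
  have "Im (cinner v (weak_partial i u)) = inner (\<i> *\<^sub>C weak_partial i u) v"
    by (simp add: Im_cinner inner_commute)
  also have "\<dots> = - inner (\<i> *\<^sub>C u) (weak_partial i v)"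
    by (rule inner_weak_partial[OF has_weak_partial_scaleC[OF has_weak_partial_weak_partial]
          has_weak_partial_weak_partial]) fact+
  also have "\<dots> = Im (cinner u (weak_partial i v))"
    by (simp add: inner_scaleC_left scaleC_minus_left Im_cinner)
  finally show ?thesis .
qed

lemma momentum_density_add:
  assumes u: "u \<in> H1" and v: "v \<in> H1"
  shows "momentum_density i (u + v) = momentum_density i u + momentum_density i v
    + 2 * Im (cinner u (weak_partial i v))"
proof -
  have "cinner (u + v) w = cinner u w + cinner v w" "cinner w (p + q) = cinner w p + cinner w q" for w p q
    using cinner_commute[of w "p + q"] cinner_commute[of w p] cinner_commute[of w q]
    by (simp_all add: cinner_add_left)
  then show ?thesis
    using Im_cinner_weak_partial_symmetric[OF u v, of i]
    by (simp add: momentum_density_def weak_partial_add u v)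
qed

lemma momentum_density_scaleC:
  assumes "u \<in> H1"
  shows "momentum_density i (c *\<^sub>C u) = (cmod c)\<^sup>2 * momentum_density i u"
proof -
  have "cinner (c *\<^sub>C u) (c *\<^sub>C weak_partial i u) = complex_of_real ((cmod c)\<^sup>2) * cinner u (weak_partial i u)"
    unfolding complex_norm_square by (simp add: cinner_scaleC_left cinner_scaleC_right)
  then show ?thesis
    by (simp add: momentum_density_def weak_partial_scaleC assms del: of_real_power)
qed

context
  fixes S :: "real \<Rightarrow> 'n::finite L2 \<Rightarrow> 'n L2"
  assumes S: "schrodinger_group S"
begin

lemma schrodinger_unitary: "unitary_group S"
  using S by (simp add: schrodinger_group_def)

lemma schrodinger_H1: "u \<in> H1 \<Longrightarrow> S t u \<in> H1"
  by (rule H1_commute[OF bounded_linear_unitary_group[OF schrodinger_unitary] schrodinger_translate[OF S]])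

lemma momentum_density_schrodinger: "u \<in> H1 \<Longrightarrow> momentum_density i (S t u) = momentum_density i u"
  using weak_partial_commute[OF bounded_linear_unitary_group[OF schrodinger_unitary] schrodinger_translate[OF S]]
  by (simp add: momentum_density_def cinner_unitary_group[OF schrodinger_unitary])

lemma integrator_step_eq: "S t u - \<i> *\<^sub>C S t v = S t (u + (- \<i>) *\<^sub>C v)"
  by (simp add: linear_simps[OF bounded_linear_unitary_group[OF schrodinger_unitary]] scaleC_minus_left
      unitary_group_scaleC[OF schrodinger_unitary])

text \<open>Since \<open>S\<close> preserves the density, a step acts like the addition of - \<i> v.
  This factor has modulus one, and it turns the imaginary part in the cross term into the real inner
  product.\<close>

lemma integrator_step:
  assumes u: "u \<in> H1" and v: "v \<in> H1"
  shows "S t u - \<i> *\<^sub>C S t v \<in> H1"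
    and "momentum_density i (S t u - \<i> *\<^sub>C S t v)
      = momentum_density i u + momentum_density i v + 2 * inner u (weak_partial i v)"
proof -
  note v' = H1_scaleC[OF v, of "- \<i>"]
  show "S t u - \<i> *\<^sub>C S t v \<in> H1"
    unfolding integrator_step_eq by (intro schrodinger_H1 H1_add u v')
  have "Im (cinner u (weak_partial i ((- \<i>) *\<^sub>C v))) = inner u (weak_partial i v)"
    by (simp add: weak_partial_scaleC[OF v] Im_cinner scaleC_scaleC)
  then show "momentum_density i (S t u - \<i> *\<^sub>C S t v)
      = momentum_density i u + momentum_density i v + 2 * inner u (weak_partial i v)"
    unfolding integrator_step_eq
    by (simp add: momentum_density_schrodinger H1_add u v' momentum_density_add
        momentum_density_scaleC[OF v])
qed

lemma norm_integrator_step: "norm (S t u - \<i> *\<^sub>C S t v) \<le> norm u + norm v"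
  using norm_triangle_ineq4[of "S t u" "\<i> *\<^sub>C S t v"]
  by (simp add: norm_scaleC norm_unitary_group[OF schrodinger_unitary])

end

section \<open>Iterating the scheme along the filtration\<close>

lemma centred_gaussian_mean:
  assumes "centred_gaussian M X" shows "(\<integral>\<omega>. X \<omega> \<partial>M) = 0"
proof -
  obtain \<sigma> where [measurable]: "X \<in> borel_measurable M"
    and \<sigma>: "distr M borel X = distr std_normal_distribution borel (\<lambda>z. \<sigma> * z)"
    using assms by (auto simp: centred_gaussian_def)
  have "(\<integral>\<omega>. X \<omega> \<partial>M) = (\<integral>x. x \<partial>distr M borel X)"
    by (subst integral_distr) auto
  also have "\<dots> = (\<integral>z. \<sigma> * z \<partial>std_normal_distribution)"
    unfolding \<sigma> by (subst integral_distr) auto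
  also have "\<dots> = 0"
    using integral_std_normal_distribution_moment_odd[of 1] by simp
  finally show ?thesis .
qed

text \<open>The scheme acts path by path, so a truncated initial value yields the original path on
  the retained event and the path from zero elsewhere.\<close>

lemma exp_integrator_pathwise:
  "u0 \<omega> = v0 \<omega> \<Longrightarrow> exp_integrator S W k u0 n \<omega> = exp_integrator S W k v0 n \<omega>"
  by (induction n) auto

locale stochastic_schrodinger = prob_space M + L2_form ip
  for M :: "'w measure" and ip :: "'n::finite L2 \<Rightarrow> 'n L2 \<Rightarrow> complex" +
  fixes F :: "real \<Rightarrow> 'w measure" and e :: "nat \<Rightarrow> 'n L2" and Q R :: "'n L2 \<Rightarrow> 'n L2"
    and S :: "real \<Rightarrow> 'n L2 \<Rightarrow> 'n L2" and W :: "real \<Rightarrow> 'w \<Rightarrow> 'n L2" and k :: real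
  assumes filtration: "normal_filtration M F"
    and e: "orthonormal_basis ip e"
    and R: "is_op_sqrt ip Q R"
    and R_HS: "hilbert_schmidt_H1 e R"
    and W: "Q_wiener_process ip M F Q W"
    and S: "schrodinger_group S"
    and k: "k > 0"
begin

lemma subalgebra_filtration: "0 \<le> t \<Longrightarrow> subalgebra M (F t)"
  using filtration by (simp add: normal_filtration_def)

lemma filtration_mono:
  assumes "0 \<le> s" "s \<le> t" shows "subalgebra (F t) (F s)"
proof -
  have "sets (F s) \<subseteq> sets (F t)"
    using filtration assms unfolding normal_filtration_def by blast
  then show ?thesis
    using subalgebra_filtration[of s] subalgebra_filtration[of t] assms by (simp add: subalgebra_def)
qed

lemma indep_increment:
  "0 \<le> s \<Longrightarrow> s \<le> t \<Longrightarrow>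
    indep_set (sets (F s)) {(\<lambda>\<omega>. W t \<omega> - W s \<omega>) -` B \<inter> space M |B. B \<in> sets borel}"
  using W by (simp add: Q_wiener_process_def)

lemma covariance_increment:
  assumes st: "0 \<le> s" "s \<le> t"
  shows "covariance_increment M ip e Q R (\<lambda>\<omega>. W t \<omega> - W s \<omega>) (t - s)"
proof unfold_locales
  have WI: "\<And>h. centred_gaussian M (\<lambda>\<omega>. inner (W t \<omega> - W s \<omega>) h)"
    "\<And>a b. (\<integral>\<omega>. ip (W t \<omega> - W s \<omega>) a * cnj (ip (W t \<omega> - W s \<omega>) b) \<partial>M)
        = complex_of_real (t - s) * ip (Q b) a"
    "integrable M (\<lambda>\<omega>. (norm (W t \<omega>))\<^sup>2)" "integrable M (\<lambda>\<omega>. (norm (W s \<omega>))\<^sup>2)"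
    using W st by (auto simp: Q_wiener_process_def)
  \<comment> \<open>\<open>indep_set\<close> includes that these preimages are events, and this is
    precisely Borel measurability of the increment.\<close>
  show borel: "(\<lambda>\<omega>. W t \<omega> - W s \<omega>) \<in> borel_measurable M"
    using indep_increment[OF st] by (auto simp: indep_sets2_eq measurable_def)
  show "integrable M (\<lambda>\<omega>. (norm (W t \<omega> - W s \<omega>))\<^sup>2)"
  proof (rule Bochner_Integration.integrable_bound)
    show "integrable M (\<lambda>\<omega>. 2 * (norm (W t \<omega>))\<^sup>2 + 2 * (norm (W s \<omega>))\<^sup>2)"
      by (intro Bochner_Integration.integrable_add integrable_mult_right WI)
    show "(\<lambda>\<omega>. (norm (W t \<omega> - W s \<omega>))\<^sup>2) \<in> borel_measurable M"
      using borel by measurable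
  qed (auto intro!: AE_I2 norm_diff_power2_le)
  show "(\<integral>\<omega>. inner (W t \<omega> - W s \<omega>) h \<partial>M) = 0" for h
    by (rule centred_gaussian_mean[OF WI(1)])
  show "(\<integral>\<omega>. ip (W t \<omega> - W s \<omega>) a * cnj (ip (W t \<omega> - W s \<omega>) b) \<partial>M)
        = complex_of_real (t - s) * ip (Q b) a" for a b
    by (rule WI)
qed (use st e R R_HS in auto)

abbreviation t :: "nat \<Rightarrow> real" where
  "t n \<equiv> real n * k"

abbreviation \<Delta> :: "nat \<Rightarrow> 'w \<Rightarrow> 'n L2" where
  "\<Delta> n \<omega> \<equiv> W (t (Suc n)) \<omega> - W (t n) \<omega>"

abbreviation U :: "('w \<Rightarrow> 'n L2) \<Rightarrow> nat \<Rightarrow> 'w \<Rightarrow> 'n L2" where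
  "U u0 \<equiv> exp_integrator S W k u0"

lemma t_nonneg: "0 \<le> t n" and t_mono: "t n \<le> t (Suc n)"
  using k by (auto simp: mult_right_mono)

lemma increment_locale: "covariance_increment M ip e Q R (\<Delta> n) k"
  using covariance_increment[OF t_nonneg t_mono, of n] by (simp add: algebra_simps)

lemma AE_integrator_H1:
  assumes "AE \<omega> in M. u0 \<omega> \<in> H1"
  shows "AE \<omega> in M. U u0 n \<omega> \<in> H1"
proof (induction n)
  case (Suc n)
  from Suc covariance_increment.AE_increment_H1[OF increment_locale, of n]
  show ?case
    by eventually_elim (simp add: integrator_step(1)[OF S] del: of_nat_Suc)
qed (simp add: assms)

lemma weakly_measurable_integrator:
  assumes u0: "weakly_measurable (F 0) u0"
  shows "weakly_measurable (F (t n)) (U u0 n)"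
proof (induction n)
  case (Suc n)
  have adj: "inner (S k u) v = inner u (S (- k) v)" for u v
    by (rule inner_unitary_group_left[OF schrodinger_unitary[OF S]])
  have WF: "weakly_measurable (F s) (W s)" if "0 \<le> s" for s
    using W that by (intro weakly_measurable_borel) (simp add: Q_wiener_process_def)
  note mono = weakly_measurable_subalgebra[OF filtration_mono[OF t_nonneg t_mono]]
  show ?case
    unfolding exp_integrator.simps
    by (intro weakly_measurable_diff weakly_measurable_scaleC weakly_measurable_adjoint[OF _ adj]
        mono[OF Suc] mono[OF WF] WF t_nonneg)
qed (simp add: u0)

lemma weakly_measurable_integrator_M:
  "weakly_measurable (F 0) u0 \<Longrightarrow> weakly_measurable M (U u0 n)"
  by (rule weakly_measurable_subalgebra[OF subalgebra_filtration[OF t_nonneg] weakly_measurable_integrator])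

lemma borel_measurable_momentum_density:
  fixes X :: "'w \<Rightarrow> 'n L2"
  assumes "weakly_measurable M X"
  shows "(\<lambda>\<omega>. momentum_density i (X \<omega>)) \<in> borel_measurable M"
  using assms unfolding momentum_density_def Im_cinner
  by (intro borel_measurable_inner_weak[OF e] weakly_measurable_scaleC weakly_measurable_weak_partial[OF e])

abbreviation drift :: "'n \<Rightarrow> real" where
  "drift i \<equiv> Im (hs_inner_L2 e R (\<lambda>f. weak_partial i (R f)))"

text \<open>The first moment of the norm is carried through the induction because it makes the cross
  term of the next step integrable, with expectation zero by independence.\<close>

lemma integral_momentum_density_integrator:
  assumes u0: "weakly_measurable (F 0) u0" "AE \<omega> in M. u0 \<omega> \<in> H1"
      "integrable M (\<lambda>\<omega>. norm (u0 \<omega>))" "\<And>i. integrable M (\<lambda>\<omega>. momentum_density i (u0 \<omega>))"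
  shows "integrable M (\<lambda>\<omega>. norm (U u0 n \<omega>)) \<and> (\<forall>i. integrable M (\<lambda>\<omega>. momentum_density i (U u0 n \<omega>)) \<and>
    (\<integral>\<omega>. momentum_density i (U u0 n \<omega>) \<partial>M) = (\<integral>\<omega>. momentum_density i (u0 \<omega>) \<partial>M) + t n * drift i)"
proof (induction n)
  case (Suc n)
  interpret inc: covariance_increment M ip e Q R "\<Delta> n" k
    by (rule increment_locale)
  note wU = weakly_measurable_integrator[OF u0(1)]
  note wM = weakly_measurable_integrator_M[OF u0(1)]
  have U_Suc: "U u0 (Suc n) \<omega> = S k (U u0 n \<omega>) - \<i> *\<^sub>C S k (\<Delta> n \<omega>)" for \<omega>
    by simp
  have norm: "integrable M (\<lambda>\<omega>. norm (U u0 (Suc n) \<omega>))"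
  proof (rule Bochner_Integration.integrable_bound)
    show "integrable M (\<lambda>\<omega>. norm (U u0 n \<omega>) + norm (\<Delta> n \<omega>))"
      using Suc inc.integrable_norm_increment by (intro Bochner_Integration.integrable_add) auto
    show "(\<lambda>\<omega>. norm (U u0 (Suc n) \<omega>)) \<in> borel_measurable M"
      by (rule borel_measurable_norm_weak[OF e wM])
    show "AE \<omega> in M. norm (norm (U u0 (Suc n) \<omega>)) \<le> norm (norm (U u0 n \<omega>) + norm (\<Delta> n \<omega>))"
      unfolding U_Suc using norm_integrator_step[OF S] by (auto intro!: AE_I2)
  qed
  have mom: "integrable M (\<lambda>\<omega>. momentum_density i (U u0 (Suc n) \<omega>))"
    "(\<integral>\<omega>. momentum_density i (U u0 (Suc n) \<omega>) \<partial>M)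
      = (\<integral>\<omega>. momentum_density i (u0 \<omega>) \<partial>M) + t (Suc n) * drift i" for i
  proof -
    let ?rhs = "\<lambda>\<omega>. momentum_density i (U u0 n \<omega>) + momentum_density i (\<Delta> n \<omega>)
        + 2 * inner (U u0 n \<omega>) (weak_partial i (\<Delta> n \<omega>))"
    note cross = inc.integral_inner_weak_partial_increment[OF subalgebra_filtration[OF t_nonneg]
        indep_increment[OF t_nonneg t_mono] wU conjunct1[OF Suc], of i]
    note ms = inc.integral_momentum_increment[of i, folded momentum_density_def]
    have int: "integrable M (\<lambda>\<omega>. momentum_density i (U u0 n \<omega>))"
      and val: "(\<integral>\<omega>. momentum_density i (U u0 n \<omega>) \<partial>M) = (\<integral>\<omega>. momentum_density i (u0 \<omega>) \<partial>M) + t n * drift i"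
      using Suc by auto
    have eq: "AE \<omega> in M. momentum_density i (U u0 (Suc n) \<omega>) = ?rhs \<omega>"
      using AE_integrator_H1[OF u0(2), of n] inc.AE_increment_H1
      unfolding U_Suc by eventually_elim (rule integrator_step(2)[OF S])
    have meas: "(\<lambda>\<omega>. momentum_density i (U u0 (Suc n) \<omega>)) \<in> borel_measurable M"
      by (rule borel_measurable_momentum_density[OF wM])
    have rhs: "integrable M ?rhs"
      by (intro Bochner_Integration.integrable_add integrable_mult_right int ms cross)
    show "integrable M (\<lambda>\<omega>. momentum_density i (U u0 (Suc n) \<omega>))"
      using integrable_cong_AE[OF meas borel_measurable_integrable[OF rhs] eq] rhs by simp
    have "(\<integral>\<omega>. momentum_density i (U u0 (Suc n) \<omega>) \<partial>M) = (\<integral>\<omega>. ?rhs \<omega> \<partial>M)"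
      by (rule integral_cong_AE[OF meas borel_measurable_integrable[OF rhs] eq])
    also have "\<dots> = (\<integral>\<omega>. momentum_density i (u0 \<omega>) \<partial>M) + t n * drift i + k * drift i"
      by (simp only: Bochner_Integration.integral_add[OF Bochner_Integration.integrable_add[OF int ms(1)]
            integrable_mult_right[OF cross(1)]] Bochner_Integration.integral_add[OF int ms(1)]
          val ms(2) integral_mult_right_zero cross(2))
    also have "\<dots> = (\<integral>\<omega>. momentum_density i (u0 \<omega>) \<partial>M) + t (Suc n) * drift i"
      by (simp add: algebra_simps)
    finally show "(\<integral>\<omega>. momentum_density i (U u0 (Suc n) \<omega>) \<partial>M)
      = (\<integral>\<omega>. momentum_density i (u0 \<omega>) \<partial>M) + t (Suc n) * drift i" .
  qed
  from norm mom show ?case by blast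
qed (simp add: u0)

text \<open>Truncated initial values are bounded, so the formula holds for each of them; both of its
  sides converge by dominated convergence as the truncation level grows.\<close>

lemma integral_momentum_density_integrator_general:
  assumes u0: "weakly_measurable (F 0) u0" "AE \<omega> in M. u0 \<omega> \<in> H1"
      "\<And>i. integrable M (\<lambda>\<omega>. momentum_density i (u0 \<omega>))"
    and int: "integrable M (\<lambda>\<omega>. momentum_density i (U u0 n \<omega>))"
  shows "(\<integral>\<omega>. momentum_density i (U u0 n \<omega>) \<partial>M) = (\<integral>\<omega>. momentum_density i (u0 \<omega>) \<partial>M) + t n * drift i"
proof -
  define v0 :: "nat \<Rightarrow> 'w \<Rightarrow> 'n L2" where "v0 m \<omega> = (if norm (u0 \<omega>) \<le> real m then u0 \<omega> else 0)" for m \<omega>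
  \<comment> \<open>The density along the path from zero is integrable by the preceding result;
    together with that of \<open>U u0 n\<close> it dominates every truncated density.\<close>
  define z :: "'w \<Rightarrow> 'n L2" where "z \<omega> = 0" for \<omega>
  have density_0: "momentum_density j (0 :: 'n L2) = 0" for j
    using cinner_scaleC_left[of 0 "0 :: 'n L2" "weak_partial j 0"] by (simp add: momentum_density_def)
  have z: "weakly_measurable (F 0) z"
    by (simp add: weakly_measurable_def z_def)
  have intz: "integrable M (\<lambda>\<omega>. momentum_density i (U z n \<omega>))"
    using integral_momentum_density_integrator[OF z, of n] by (simp add: z_def H1_0 density_0)
  have norm_meas: "(\<lambda>\<omega>. norm (u0 \<omega>)) \<in> borel_measurable (F 0)"
    by (rule borel_measurable_norm_weak[OF e u0(1)])
  \<comment> \<open>Written as a real factor times \<open>u0\<close>, with a factor measurable for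
    \<open>F 0\<close>, the truncation keeps the initial value adapted.\<close>
  have v0_eq: "v0 m \<omega> = (if norm (u0 \<omega>) \<le> real m then 1 else 0) *\<^sub>R u0 \<omega>" for m \<omega>
    by (simp add: v0_def)
  have v0: "weakly_measurable (F 0) (v0 m)" for m
    unfolding v0_eq[abs_def]
    by (rule weakly_measurable_scale[OF measurable_compose[OF norm_meas] u0(1)]) measurable
  have v0_M: "weakly_measurable M (v0 m)" for m
    by (rule weakly_measurable_subalgebra[OF subalgebra_filtration v0]) simp
  have v0_int: "integrable M (\<lambda>\<omega>. norm (v0 m \<omega>))" for m
    by (rule Bochner_Integration.integrable_bound[OF integrable_const[of "real m"]])
      (auto simp: v0_def intro!: borel_measurable_norm_weak[OF e v0_M[of m, unfolded v0_def[abs_def]]])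
  have v0_H1: "AE \<omega> in M. v0 m \<omega> \<in> H1" for m
    using u0(2) by eventually_elim (simp add: v0_def H1_0)
  have v0_mom: "integrable M (\<lambda>\<omega>. momentum_density j (v0 m \<omega>))" for j m
    by (rule Bochner_Integration.integrable_bound[OF u0(3)[of j] borel_measurable_momentum_density[OF v0_M]])
      (auto simp: v0_def density_0)
  have U_v0: "U (v0 m) n \<omega> = (if norm (u0 \<omega>) \<le> real m then U u0 n \<omega> else U z n \<omega>)" for m \<omega>
    by (auto simp: v0_def z_def intro!: exp_integrator_pathwise)
  have ev: "\<forall>\<^sub>F m in sequentially. norm (u0 \<omega>) \<le> real m" for \<omega>
  proof -
    obtain N where "norm (u0 \<omega>) \<le> real N"
      using real_arch_simple by blast
    then show ?thesis
      by (intro eventually_mono[OF eventually_ge_at_top[of N]]) (auto intro: order_trans)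
  qed
  have "(\<lambda>m. \<integral>\<omega>. momentum_density i (U (v0 m) n \<omega>) \<partial>M) \<longlonglongrightarrow> (\<integral>\<omega>. momentum_density i (U u0 n \<omega>) \<partial>M)"
  proof (rule integral_dominated_convergence)
    show "integrable M (\<lambda>\<omega>. \<bar>momentum_density i (U u0 n \<omega>)\<bar> + \<bar>momentum_density i (U z n \<omega>)\<bar>)"
      by (intro Bochner_Integration.integrable_add integrable_abs int intz)
    show "(\<lambda>\<omega>. momentum_density i (U (v0 m) n \<omega>)) \<in> borel_measurable M" for m
      by (intro borel_measurable_momentum_density weakly_measurable_integrator_M v0)
    show "AE \<omega> in M. (\<lambda>m. momentum_density i (U (v0 m) n \<omega>)) \<longlonglongrightarrow> momentum_density i (U u0 n \<omega>)"
    proof (rule AE_I2)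
      show "(\<lambda>m. momentum_density i (U (v0 m) n \<omega>)) \<longlonglongrightarrow> momentum_density i (U u0 n \<omega>)" for \<omega>
        by (rule tendsto_eventually, rule eventually_mono[OF ev[of \<omega>]]) (simp add: U_v0)
    qed
    show "AE \<omega> in M. norm (momentum_density i (U (v0 m) n \<omega>))
        \<le> \<bar>momentum_density i (U u0 n \<omega>)\<bar> + \<bar>momentum_density i (U z n \<omega>)\<bar>" for m
      by (simp add: U_v0)
  qed (rule borel_measurable_integrable[OF int])
  moreover have "(\<lambda>m. (\<integral>\<omega>. momentum_density i (v0 m \<omega>) \<partial>M) + t n * drift i)
      \<longlonglongrightarrow> (\<integral>\<omega>. momentum_density i (u0 \<omega>) \<partial>M) + t n * drift i"
  proof (intro tendsto_add tendsto_const integral_dominated_convergence[OF _ _ integrable_abs[OF u0(3)[of i]]])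
    show "AE \<omega> in M. (\<lambda>m. momentum_density i (v0 m \<omega>)) \<longlonglongrightarrow> momentum_density i (u0 \<omega>)"
    proof (rule AE_I2)
      show "(\<lambda>m. momentum_density i (v0 m \<omega>)) \<longlonglongrightarrow> momentum_density i (u0 \<omega>)" for \<omega>
        by (rule tendsto_eventually, rule eventually_mono[OF ev[of \<omega>]]) (simp add: v0_def)
    qed
    show "AE \<omega> in M. norm (momentum_density i (v0 m \<omega>)) \<le> \<bar>momentum_density i (u0 \<omega>)\<bar>" for m
      by (simp add: v0_def density_0)
  qed (use u0(3) v0_mom in \<open>auto intro: borel_measurable_integrable\<close>)
  moreover have "(\<integral>\<omega>. momentum_density i (U (v0 m) n \<omega>) \<partial>M)
      = (\<integral>\<omega>. momentum_density i (v0 m \<omega>) \<partial>M) + t n * drift i" for m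
    using integral_momentum_density_integrator[OF v0 v0_H1 v0_int v0_mom] by blast
  ultimately show ?thesis
    by (simp add: LIMSEQ_unique)
qed

end

section \<open>From momentum densities to the momentum vector\<close>

lemma integrable_momentum_iff:
  "integrable M (\<lambda>\<omega>. momentum (X \<omega>)) \<longleftrightarrow> (\<forall>i. integrable M (\<lambda>\<omega>. momentum_density i (X \<omega>)))"
proof (intro iffI allI)
  fix i assume "integrable M (\<lambda>\<omega>. momentum (X \<omega>))"
  from integrable_Re[OF integrable_bounded_linear[OF bounded_linear_vec_nth this], of i]
  have "integrable M (\<lambda>\<omega>. (- 2) * momentum_density i (X \<omega>))"
    by (simp add: momentum_nth)
  then show "integrable M (\<lambda>\<omega>. momentum_density i (X \<omega>))"
    using integrable_mult_right[of "- 1 / 2" M "\<lambda>\<omega>. (- 2) * momentum_density i (X \<omega>)"] by simp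
next
  assume *: "\<forall>i. integrable M (\<lambda>\<omega>. momentum_density i (X \<omega>))"
  show "integrable M (\<lambda>\<omega>. momentum (X \<omega>))"
    unfolding momentum_expansion
    by (intro Bochner_Integration.integrable_sum integrable_scaleR_left integrable_mult_right)
      (use * in auto)
qed

lemma integral_momentum_nth:
  assumes "integrable M (\<lambda>\<omega>. momentum (X \<omega>))"
  shows "(\<integral>\<omega>. momentum (X \<omega>) \<partial>M) $ i = complex_of_real (- 2 * (\<integral>\<omega>. momentum_density i (X \<omega>) \<partial>M))"
proof -
  have "(\<integral>\<omega>. momentum (X \<omega>) \<partial>M) $ i = (\<integral>\<omega>. momentum (X \<omega>) $ i \<partial>M)"
    by (rule integral_bounded_linear[OF bounded_linear_vec_nth assms, symmetric])
  then show ?thesis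
    by (simp only: momentum_nth integral_complex_of_real integral_mult_right_zero)
qed

text \<open>The Bochner integral of a non-integrable function is 0 by convention, so the formula is
  asserted where the momentum of \<open>u n\<close> is integrable; a first moment of
  \<open>norm (u0 \<omega>)\<close> guarantees this for every \<open>n\<close>.\<close>

theorem proposition3p10:
  fixes M :: "'w measure" and F :: "real \<Rightarrow> 'w measure"
    and ip :: "'n::finite L2 \<Rightarrow> 'n L2 \<Rightarrow> complex"
    and e :: "nat \<Rightarrow> 'n L2"
    and Q Qhalf :: "'n L2 \<Rightarrow> 'n L2"
    and S :: "real \<Rightarrow> 'n L2 \<Rightarrow> 'n L2"
    and W :: "real \<Rightarrow> 'w \<Rightarrow> 'n L2"
    and u0 :: "'w \<Rightarrow> 'n L2" and u :: "nat \<Rightarrow> 'w \<Rightarrow> 'n L2"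
    and k :: real
  assumes "prob_space M" and "normal_filtration M F"
    and ip: "ip = rinner \<or> ip = cinner"
    and e: "orthonormal_basis ip e"
    and Q: "nonneg_selfadjoint ip Q" and Qhalf: "is_op_sqrt ip Q Qhalf"
    and Qhalf_HS: "hilbert_schmidt_H1 e Qhalf"
    and W: "Q_wiener_process ip M F Q W"
    and S: "schrodinger_group S"
    and k: "k > 0"
    and u0_meas: "u0 \<in> borel_measurable (F 0)"
    and u0_H1: "AE \<omega> in M. u0 \<omega> \<in> H1"
    and u0_mom: "integrable M (\<lambda>\<omega>. momentum (u0 \<omega>))"
    and u: "u = exp_integrator S W k u0"
  shows "\<forall>n. (AE \<omega> in M. u n \<omega> \<in> H1) \<and>
     (integrable M (\<lambda>\<omega>. norm (u0 \<omega>)) \<longrightarrow> integrable M (\<lambda>\<omega>. momentum (u n \<omega>))) \<and>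
     (integrable M (\<lambda>\<omega>. momentum (u n \<omega>)) \<longrightarrow>
        (\<integral>\<omega>. momentum (u n \<omega>) \<partial>M) =
          (\<integral>\<omega>. momentum (u0 \<omega>) \<partial>M)
          - (2 * (real n * k)) *\<^sub>R
              (\<chi> i. complex_of_real (Im (hs_inner_L2 e Qhalf (\<lambda>f. weak_partial i (Qhalf f))))))"
proof (intro allI conjI impI)
  interpret prob_space M by fact
  interpret stochastic_schrodinger M ip F e Q Qhalf S W k
    by unfold_locales fact+
  note wm = weakly_measurable_borel[OF u0_meas]
  note dens = u0_mom[unfolded integrable_momentum_iff, rule_format]
  fix n
  show "AE \<omega> in M. u n \<omega> \<in> H1"
    unfolding u by (rule AE_integrator_H1[OF u0_H1])
  show "integrable M (\<lambda>\<omega>. momentum (u n \<omega>))" if "integrable M (\<lambda>\<omega>. norm (u0 \<omega>))"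
    unfolding u integrable_momentum_iff
    using integral_momentum_density_integrator[OF wm u0_H1 that dens] by blast
  assume int: "integrable M (\<lambda>\<omega>. momentum (u n \<omega>))"
  have "(\<integral>\<omega>. momentum_density i (u n \<omega>) \<partial>M) = (\<integral>\<omega>. momentum_density i (u0 \<omega>) \<partial>M)
      + real n * k * Im (hs_inner_L2 e Qhalf (\<lambda>f. weak_partial i (Qhalf f)))" for i
    unfolding u
    by (rule integral_momentum_density_integrator_general[OF wm u0_H1 dens])
      (use int in \<open>simp add: u integrable_momentum_iff\<close>)
  note density = this
  show "(\<integral>\<omega>. momentum (u n \<omega>) \<partial>M) = (\<integral>\<omega>. momentum (u0 \<omega>) \<partial>M)
          - (2 * (real n * k)) *\<^sub>R
              (\<chi> i. complex_of_real (Im (hs_inner_L2 e Qhalf (\<lambda>f. weak_partial i (Qhalf f)))))"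
    unfolding vec_eq_iff vector_minus_component vector_scaleR_component vec_lambda_beta
      integral_momentum_nth[OF int] integral_momentum_nth[OF u0_mom] density
    by (simp add: complex_eq_iff distrib_left)
qed

end
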